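(* Consider the following two statements. (U) For every locally finite Borel graph $G$ with $\mathsf{asi}(G)<\infty$ and every unbalanced bipartition $(A,B)$ of $G$, $G$ has a Borel matching covering $A$. (E) For every locally finite Borel graph $G$ with $\mathsf{asi}(G)<\infty$ and every Borel bipartition $(A,B)$ of $G$ that has combinatorial expansion, $G$ has a Borel matching covering $A$. If (U) holds, then (E) holds.
   Context: A Borel graph (multigraph) is a triple $G=(V,E,\pi)$ where the vertex set $V$ and the edge set $E$ are standard Borel spaces and $\pi\colon E\to[V]^2$ is a Borel map sending each edge to its pair of endpoints; $[V]^2$ is the set of unordered pairs of distinct elements of $V$. Thus graphs are undirected and loopless, and parallel edges are allowed; $G$ is simple if $\pi$ is injective. The underlying simple graph of $G$ is the simple graph on $V$ in which $\{x,y\}$ is an edge iff $\{x,y\}\in\pi(E)$. $\deg_G(x)$ is the number of edges incident to $x$; $G$ is locally finite if all degrees are finite. $N_G(x)$ is the set of neighbors of $x$, and $N_G(S)=\bigcup_{x\in S}N_G(x)$. A bipartition of $G$ is a partition $V=A\sqcup B$ such that every edge has one endpoint in $A$ and the other in $B$; it is Borel if $A$ and $B$ are Borel sets. It is of type $(a,b)$, for $a,b\in\mathbb{N}$, if $\deg_G(x)\ge a$ for all $x\in A$ and $\deg_G(y)\le b$ for all $y\in B$; it is unbalanced if it is of type $(a,b)$ for some $a>b$. It has combinatorial expansion if there is $c>1$ such that $|N_G(S)|\ge c|S|$ for every finite set $S\subseteq A$. Asymptotic separation index: For a simple graph $G$ and $k\in\mathbb{N}$, $G^k$ is the simple graph on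 the same vertex set in which $\{x,y\}$ is an edge iff $0<\mathrm{dist}_G(x,y)\le k$. A set $X$ of vertices of a graph $H$ is $H$-finite if every connected component of the induced subgraph $H[X]$ is finite. For a simple locally finite Borel graph $G$, $\mathsf{asi}(G)$ is the smallest $s\in\mathbb{N}$ such that for every $k\in\mathbb{N}$ the vertex set of $G$ can be covered by $s+1$ Borel $G^k$-finite sets; if no such $s$ exists, $\mathsf{asi}(G)=\infty$. For a multigraph, $\mathsf{asi}(G)$ is that of its underlying simple graph. A matching is a set $M\subseteq E$ of edges whose endpoint sets are pairwise disjoint; it is Borel if it is a Borel subset of $E$. $M$ covers $A$ if every $x\in A$ is an endpoint of some edge in $M$. *)

theory Defs
  imports "HOL-Analysis.Analysis"
begin

section \<open>Standard Borel spaces and unordered pairs\<close>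

text \<open>
  Borel spaces are carried by \<^typ>\<open>'a measure\<close>; only \<^const>\<open>space\<close> and \<^const>\<open>sets\<close> matter,
  the measure itself is ignored throughout.
\<close>

definition standard_borel_space :: "'a measure \<Rightarrow> bool" where
  "standard_borel_space M \<longleftrightarrow>
     (\<exists>T. completely_metrizable_space T \<and> second_countable T \<and>
          space M = topspace T \<and> sets M = sigma_sets (topspace T) {U. openin T U})"

definition unordered_pairs :: "'a set \<Rightarrow> 'a set set" where
  "unordered_pairs V = {p. p \<subseteq> V \<and> card p = 2}"

text \<open>
  The set of unordered pairs carries the quotient Borel structure: a set of unordered pairs is
  Borel iff its preimage under \<open>(x, y) \<mapsto> {x, y}\<close> is Borel in the square (see \<open>sets_pair_space\<close>).
\<close>

definition pair_space :: "'a measure \<Rightarrow> 'a set measure" where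
  "pair_space M = sigma (unordered_pairs (space M))
     {P. P \<subseteq> unordered_pairs (space M) \<and> {(x, y). {x, y} \<in> P} \<in> sets (M \<Otimes>\<^sub>M M)}"

section \<open>Borel multigraphs\<close>

record ('v, 'e) multigraph =
  verts :: "'v measure"
  edges :: "'e measure"
  ends  :: "'e \<Rightarrow> 'v set"

definition borel_graph :: "('v, 'e) multigraph \<Rightarrow> bool" where
  "borel_graph G \<longleftrightarrow>
     standard_borel_space (verts G) \<and> standard_borel_space (edges G) \<and>
     ends G \<in> measurable (edges G) (pair_space (verts G))"

definition incident_edges :: "('v, 'e) multigraph \<Rightarrow> 'v \<Rightarrow> 'e set" where
  "incident_edges G x = {e \<in> space (edges G). x \<in> ends G e}"

definition locally_finite :: "('v, 'e) multigraph \<Rightarrow> bool" where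
  "locally_finite G \<longleftrightarrow> (\<forall>x \<in> space (verts G). finite (incident_edges G x))"

text \<open>Degrees and neighborhood sizes are only used for locally finite graphs, so \<^const>\<open>card\<close> is exact.\<close>

definition degree :: "('v, 'e) multigraph \<Rightarrow> 'v \<Rightarrow> nat" where
  "degree G x = card (incident_edges G x)"

text \<open>The underlying simple graph is given by its (symmetric, irreflexive) adjacency relation.\<close>

definition adjacency :: "('v, 'e) multigraph \<Rightarrow> ('v \<times> 'v) set" where
  "adjacency G = {(x, y). {x, y} \<in> ends G ` space (edges G)}"

definition neighbors :: "('v, 'e) multigraph \<Rightarrow> 'v set \<Rightarrow> 'v set" where
  "neighbors G S = (\<Union>x\<in>S. {y. (x, y) \<in> adjacency G})"

section \<open>Bipartitions\<close>

definition bipartition :: "('v, 'e) multigraph \<Rightarrow> 'v set \<Rightarrow> 'v set \<Rightarrow> bool" where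
  "bipartition G A B \<longleftrightarrow>
     A \<union> B = space (verts G) \<and> A \<inter> B = {} \<and>
     (\<forall>e \<in> space (edges G). \<exists>x\<in>A. \<exists>y\<in>B. ends G e = {x, y})"

definition borel_bipartition :: "('v, 'e) multigraph \<Rightarrow> 'v set \<Rightarrow> 'v set \<Rightarrow> bool" where
  "borel_bipartition G A B \<longleftrightarrow>
     bipartition G A B \<and> A \<in> sets (verts G) \<and> B \<in> sets (verts G)"

definition of_type :: "('v, 'e) multigraph \<Rightarrow> 'v set \<Rightarrow> 'v set \<Rightarrow> nat \<Rightarrow> nat \<Rightarrow> bool" where
  "of_type G A B a b \<longleftrightarrow> (\<forall>x\<in>A. a \<le> degree G x) \<and> (\<forall>y\<in>B. degree G y \<le> b)"

definition unbalanced :: "('v, 'e) multigraph \<Rightarrow> 'v set \<Rightarrow> 'v set \<Rightarrow> bool" where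
  "unbalanced G A B \<longleftrightarrow> (\<exists>a b. b < a \<and> of_type G A B a b)"

definition combinatorial_expansion :: "('v, 'e) multigraph \<Rightarrow> 'v set \<Rightarrow> bool" where
  "combinatorial_expansion G A \<longleftrightarrow>
     (\<exists>c::real. 1 < c \<and>
        (\<forall>S. finite S \<and> S \<subseteq> A \<longrightarrow> c * real (card S) \<le> real (card (neighbors G S))))"

section \<open>Asymptotic separation index\<close>

text \<open>In this section a simple graph is given by its adjacency relation \<open>R\<close>.\<close>

definition graph_dist :: "('v \<times> 'v) set \<Rightarrow> 'v \<Rightarrow> 'v \<Rightarrow> enat" where
  "graph_dist R x y = Inf {enat n | n. (x, y) \<in> R ^^ n}"

definition graph_power :: "('v \<times> 'v) set \<Rightarrow> nat \<Rightarrow> ('v \<times> 'v) set" where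
  "graph_power R k = {(x, y). 0 < graph_dist R x y \<and> graph_dist R x y \<le> enat k}"

definition component :: "('v \<times> 'v) set \<Rightarrow> 'v set \<Rightarrow> 'v \<Rightarrow> 'v set" where
  "component R X x = {y \<in> X. (x, y) \<in> (R \<inter> X \<times> X)\<^sup>*}"

definition graph_finite :: "('v \<times> 'v) set \<Rightarrow> 'v set \<Rightarrow> bool" where
  "graph_finite R X \<longleftrightarrow> (\<forall>x\<in>X. finite (component R X x))"

definition asi :: "('v, 'e) multigraph \<Rightarrow> enat" where
  "asi G = Inf {enat s | s. \<forall>k. \<exists>X :: nat \<Rightarrow> 'v set.
     (\<forall>i\<le>s. X i \<in> sets (verts G) \<and> graph_finite (graph_power (adjacency G) k) (X i)) \<and>
     (\<Union>i\<le>s. X i) = space (verts G)}"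

section \<open>Matchings\<close>

definition matching :: "('v, 'e) multigraph \<Rightarrow> 'e set \<Rightarrow> bool" where
  "matching G M \<longleftrightarrow>
     M \<subseteq> space (edges G) \<and> (\<forall>e\<in>M. \<forall>f\<in>M. e \<noteq> f \<longrightarrow> ends G e \<inter> ends G f = {})"

definition borel_matching :: "('v, 'e) multigraph \<Rightarrow> 'e set \<Rightarrow> bool" where
  "borel_matching G M \<longleftrightarrow> matching G M \<and> M \<in> sets (edges G)"

definition covers :: "('v, 'e) multigraph \<Rightarrow> 'e set \<Rightarrow> 'v set \<Rightarrow> bool" where
  "covers G M A \<longleftrightarrow> (\<forall>x\<in>A. \<exists>e\<in>M. x \<in> ends G e)"

section \<open>The two statements\<close>

text \<open>
  HOL cannot quantify over types inside a formula, so each statement takes its vertex and edge types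
  as parameters. A Borel space may live on any subset of its type and carry any standard Borel
  structure there, and every standard Borel space has at most the cardinality of the continuum.
  Hence up to isomorphism the statements at type \<^typ>\<open>real\<close> already concern all Borel graphs.
\<close>

definition unbalanced_matching_property :: "'v itself \<Rightarrow> 'e itself \<Rightarrow> bool" where
  "unbalanced_matching_property _ _ \<longleftrightarrow>
     (\<forall>(G :: ('v, 'e) multigraph) A B.
        borel_graph G \<and> locally_finite G \<and> asi G < \<infinity> \<and> bipartition G A B \<and> unbalanced G A B
        \<longrightarrow> (\<exists>M. borel_matching G M \<and> covers G M A))"

definition expansion_matching_property :: "'v itself \<Rightarrow> 'e itself \<Rightarrow> bool" where
  "expansion_matching_property _ _ \<longleftrightarrow>
     (\<forall>(G :: ('v, 'e) multigraph) A B.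
        borel_graph G \<and> locally_finite G \<and> asi G < \<infinity> \<and> borel_bipartition G A B \<and>
        combinatorial_expansion G A
        \<longrightarrow> (\<exists>M. borel_matching G M \<and> covers G M A))"

section \<open>The quotient Borel structure on unordered pairs\<close>

lemma space_pair_space: "space (pair_space M) = unordered_pairs (space M)"
  unfolding pair_space_def by (rule space_measure_of) blast

text \<open>
  If the diagonal is not measurable, the family below need not contain the whole set of unordered
  pairs; for standard Borel spaces it always is.
\<close>

lemma sets_pair_space:
  assumes diag: "{(x, x) | x. x \<in> space M} \<in> sets (M \<Otimes>\<^sub>M M)"
  shows "sets (pair_space M) =
    {P. P \<subseteq> unordered_pairs (space M) \<and> {(x, y). {x, y} \<in> P} \<in> sets (M \<Otimes>\<^sub>M M)}"
    (is "_ = ?F")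
proof -
  let ?W = "unordered_pairs (space M)"
  let ?p = "\<lambda>P. {(x, y). {x, y} \<in> P}"
  have top: "?p ?W = space (M \<Otimes>\<^sub>M M) - {(x, x) | x. x \<in> space M}"
    by (auto simp: unordered_pairs_def space_pair_measure card_2_iff doubleton_eq_iff)
  have "sigma_algebra ?W ?F"
    unfolding sigma_algebra_iff2
  proof (intro conjI ballI allI impI)
    show "?F \<subseteq> Pow ?W" by blast
    show "{} \<in> ?F" by simp
  next
    fix P assume P: "P \<in> ?F"
    have "?p (?W - P) = ?p ?W - ?p P" by auto
    also have "\<dots> \<in> sets (M \<Otimes>\<^sub>M M)"
      using P diag unfolding top by blast
    finally show "?W - P \<in> ?F" by blast
  next
    fix P :: "nat \<Rightarrow> 'a set set" assume P: "range P \<subseteq> ?F"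
    have "?p (\<Union>i. P i) = (\<Union>i. ?p (P i))" by auto
    also have "\<dots> \<in> sets (M \<Otimes>\<^sub>M M)"
      using P by (intro sets.countable_UN) blast
    finally show "(\<Union>i. P i) \<in> ?F" using P by blast
  qed
  then show ?thesis
    unfolding pair_space_def by (rule sigma_algebra.sets_measure_of_eq)
qed

end

theory Submission
  imports Defs
begin

text \<open>
  Let \<open>d (c - 1) \<ge> 1\<close>. By Hall's theorem every finite \<open>S \<subseteq> A\<close> admits integer edge weights with sum at least
  \<open>d + 1\<close> at each vertex of \<open>S\<close> and at most \<open>d\<close> at each vertex of \<open>B\<close>. Cover the graph by \<open>s + 1\<close> Borel sets
  \<open>X i\<close> that are finite for a large power of the graph. Near \<open>X i\<close> the matching problem splits into
  finite pieces, so it has a Borel solution \<open>\<phi> i\<close>. An integer partition of unity \<open>w i\<close> of total mass \<open>R\<close>, with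
  \<open>w i\<close> supported near \<open>X i\<close> and changing by at most 2 along edges, glues these to
  \<open>m e = (\<Sum>i. w i (\<alpha> e) * \<phi> i e)\<close>, where \<open>\<alpha> e\<close> is the endpoint of \<open>e\<close> in \<open>A\<close>. The sum of \<open>m\<close> is at least
  \<open>R (d + 1)\<close> on \<open>A\<close> and at most \<open>(R + 2 (s + 1)) d\<close> on \<open>B\<close>. For large \<open>R\<close> taking \<open>m e\<close> parallel copies of
  each edge gives an unbalanced multigraph, and a matching of it projects to a matching of the
  original graph.

  Everything is Borel because images of Borel sets under finite-to-one Borel maps are Borel, which
  follows from Novikov's separation theorem and a Koenig argument.
\<close>

section \<open>Refining Polish topologies\<close>

text \<open>Matchings found near different \<open>X i\<close> cannot be merged where their regions
  overlap, but weights can be averaged. This is why demand \<open>d + 1\<close> is played against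
  capacity \<open>d\<close>: the averaging may spoil some capacity, and the surplus has to absorb
  it. At a vertex of \<open>A\<close> nothing is lost, since each edge takes its factor
  \<open>w i\<close> from its end in \<open>A\<close>. At a vertex of \<open>B\<close> each index
  costs at most \<open>2 * d\<close>, in total \<open>2 * (s + 1) * d\<close>, whatever
  \<open>R\<close> is, while the surplus is \<open>R\<close>. So
  \<open>R = 2 * (s + 1) * d + 1\<close> is enough. It depends on \<open>s\<close> and
  \<open>d\<close> only and is fixed before the cover is chosen; a finite separation index gives one
  \<open>s\<close> for all powers of the graph, in particular for \<open>2 * R + 2\<close>. The
  degree bounds required by (U) come from the weights alone, as degrees of the original graph may be
  unbounded.

  The Borel obstacle is to choose solutions on finite pieces and to sum over fibres of the endpoint
  maps. Both reduce to images under finite-to-one maps, and these need only convergent nested cells,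
  obtained from a Polish topology in which countably many given Borel sets are clopen.\<close>

definition polish_topology :: "'a topology \<Rightarrow> bool" where
  "polish_topology T \<longleftrightarrow> completely_metrizable_space T \<and> second_countable T"

definition polish_for :: "'a measure \<Rightarrow> 'a topology \<Rightarrow> bool" where
  "polish_for M T \<longleftrightarrow> polish_topology T \<and> space M = topspace T \<and>
     sets M = sigma_sets (topspace T) {U. openin T U}"

lemma standard_borel_space_iff: "standard_borel_space M \<longleftrightarrow> (\<exists>T. polish_for M T)"
  unfolding standard_borel_space_def polish_for_def polish_topology_def by (simp add: conj_assoc)

lemma homeomorphic_space_pullback:
  assumes "inj_on f X" "f ` X \<subseteq> topspace Y"
  shows "pullback_topology X f Y homeomorphic_space subtopology Y (f ` X)"
proof -
  have ts: "topspace (pullback_topology X f Y) = X"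
    using assms by (auto simp: topspace_pullback_topology)
  have "homeomorphic_map (pullback_topology X f Y) (subtopology Y (f ` X)) f"
    unfolding homeomorphic_eq_everything_map
  proof (intro conjI)
    show "continuous_map (pullback_topology X f Y) (subtopology Y (f ` X)) f"
      using continuous_map_pullback[OF continuous_map_id, of X f Y] ts
      by (auto simp: continuous_map_in_subtopology)
    show "open_map (pullback_topology X f Y) (subtopology Y (f ` X)) f"
      unfolding open_map_def openin_pullback_topology openin_subtopology by blast
    then show "closed_map (pullback_topology X f Y) (subtopology Y (f ` X)) f"
      using bijective_open_imp_closed_map ts assms
      by (smt (verit) inf.absorb_iff2 topspace_subtopology inf_commute \<open>continuous_map _ _ f\<close>)
  qed (use ts assms in auto)
  then show ?thesis
    by (rule homeomorphic_map_imp_homeomorphic_space)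
qed

text \<open>Every refined topology below is a pullback along an injection into a product, so its
  completeness reduces to the image being a G-delta set (Alexandrov's theorem).\<close>

lemma completely_metrizable_space_pullback:
  assumes "inj_on f X" "gdelta_in Y (f ` X)" "completely_metrizable_space Y"
  shows "completely_metrizable_space (pullback_topology X f Y)"
proof -
  have "f ` X \<subseteq> topspace Y"
    using assms(2) by (rule gdelta_in_subset)
  then have "pullback_topology X f Y homeomorphic_space subtopology Y (f ` X)"
    by (rule homeomorphic_space_pullback[OF assms(1)])
  moreover have "completely_metrizable_space (subtopology Y (f ` X))"
    using assms(3,2) by (rule completely_metrizable_space_gdelta_in)
  ultimately show ?thesis
    using homeomorphic_completely_metrizable_space by metis
qed

text \<open>Used to see that a refinement creates no new Borel sets: it is enough that a countable
  base of it consists of old Borel sets.\<close>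

lemma openin_sigma_sets_base:
  assumes "countable \<B>" "\<And>V. V \<in> \<B> \<Longrightarrow> V \<in> sigma_sets X A"
    and "\<And>x. x \<in> U \<Longrightarrow> \<exists>V\<in>\<B>. x \<in> V \<and> V \<subseteq> U"
  shows "U \<in> sigma_sets X A"
proof -
  have "U = \<Union>{V \<in> \<B>. V \<subseteq> U}"
    using assms(3) by blast
  moreover have "countable {V \<in> \<B>. V \<subseteq> U}"
    using assms(1) by simp
  ultimately show ?thesis
    using assms(2) by (metis (no_types, lifting) mem_Collect_eq sigma_sets_UNION)
qed

lemma second_countableE:
  assumes "second_countable T"
  obtains \<B> where "countable \<B>" "\<And>V. V \<in> \<B> \<Longrightarrow> openin T V"
    "\<And>U x. openin T U \<Longrightarrow> x \<in> U \<Longrightarrow> \<exists>V\<in>\<B>. x \<in> V \<and> V \<subseteq> U"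
proof -
  obtain \<B> where "countable \<B> \<and> (\<forall>V\<in>\<B>. openin T V) \<and>
      (\<forall>U x. openin T U \<and> x \<in> U \<longrightarrow> (\<exists>V\<in>\<B>. x \<in> V \<and> V \<subseteq> U))"
    using assms unfolding second_countable_def ..
  then show ?thesis using that[of \<B>] by simp
qed

lemma second_countable_prod_topology:
  assumes "second_countable S" "second_countable T"
  shows "second_countable (prod_topology S T)"
proof -
  obtain \<B> where B: "countable \<B>" "\<forall>V\<in>\<B>. openin S V"
      "\<And>U x. openin S U \<Longrightarrow> x \<in> U \<Longrightarrow> (\<exists>V\<in>\<B>. x \<in> V \<and> V \<subseteq> U)"
    using assms(1) by (auto simp: second_countable_def)
  obtain \<C> where C: "countable \<C>" "\<forall>V\<in>\<C>. openin T V"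
      "\<And>U x. openin T U \<Longrightarrow> x \<in> U \<Longrightarrow> (\<exists>V\<in>\<C>. x \<in> V \<and> V \<subseteq> U)"
    using assms(2) by (auto simp: second_countable_def)
  show ?thesis
    unfolding second_countable_def
  proof (intro exI[of _ "(\<lambda>(B, C). B \<times> C) ` (\<B> \<times> \<C>)"] conjI allI impI)
    show "countable ((\<lambda>(B, C). B \<times> C) ` (\<B> \<times> \<C>))"
      using B(1) C(1) by simp
    show "\<forall>V\<in>(\<lambda>(B, C). B \<times> C) ` (\<B> \<times> \<C>). openin (prod_topology S T) V"
      using B(2) C(2) by (auto simp: openin_prod_Times_iff)
    fix U z assume Uz: "openin (prod_topology S T) U \<and> z \<in> U"
    obtain x y where z: "z = (x, y)" by (cases z)
    obtain V W where VW: "openin S V" "openin T W" "x \<in> V" "y \<in> W" "V \<times> W \<subseteq> U"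
      using Uz unfolding z openin_prod_topology_alt by blast
    obtain V' W' where "V' \<in> \<B>" "x \<in> V'" "V' \<subseteq> V" "W' \<in> \<C>" "y \<in> W'" "W' \<subseteq> W"
      using B(3) C(3) VW by metis
    then show "\<exists>V\<in>(\<lambda>(B, C). B \<times> C) ` (\<B> \<times> \<C>). z \<in> V \<and> V \<subseteq> U"
      using VW(5) z by (intro bexI[of _ "V' \<times> W'"]) auto
  qed
qed

text \<open>The new topology is that of the disjoint sum of \<open>U\<close> and its complement,
  realized as the graph of the indicator of \<open>U\<close> in the product with a discrete
  two-point space. The graph is the union of an open and a closed set, hence a G-delta set.\<close>

lemma polish_for_clopen:
  assumes T: "polish_for M T" and U: "openin T U"
  obtains T' where "polish_for M T'" "\<And>W. openin T W \<Longrightarrow> openin T' W"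
    "openin T' U" "openin T' (space M - U)"
proof -
  define X where "X = topspace T"
  define f where "f = (\<lambda>x. (x, x \<in> U))"
  define Y where "Y = prod_topology T (discrete_topology (UNIV :: bool set))"
  define T' where "T' = pullback_topology X f Y"
  have cm: "completely_metrizable_space T" and sc: "second_countable T"
    and sp: "space M = X" and st: "sets M = sigma_sets X {U. openin T U}"
    using T by (auto simp: polish_for_def polish_topology_def X_def)
  have UX: "U \<subseteq> X" using U openin_subset X_def by blast
  have img: "f ` X = U \<times> {True} \<union> (X - U) \<times> {False}"
    using UX by (auto simp: f_def)
  have cmY: "completely_metrizable_space Y"
    unfolding Y_def by (simp add: completely_metrizable_space_prod_topology cm
        completely_metrizable_space_discrete_topology)
  have "gdelta_in Y (U \<times> {True})"
    unfolding Y_def by (intro open_imp_gdelta_in) (simp add: openin_prod_Times_iff U)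
  moreover have "closedin Y ((X - U) \<times> {False})"
    unfolding Y_def using U X_def by (subst closedin_prod_Times_iff) (auto intro: closedin_diff)
  then have "gdelta_in Y ((X - U) \<times> {False})"
    using closed_imp_gdelta_in cmY completely_metrizable_imp_metrizable_space by blast
  ultimately have gd: "gdelta_in Y (f ` X)"
    unfolding img by (rule gdelta_in_Un)
  have cm': "completely_metrizable_space T'"
    unfolding T'_def using gd cmY by (intro completely_metrizable_space_pullback) (auto simp: f_def inj_on_def)
  have ts: "topspace T' = X"
    unfolding T'_def Y_def topspace_pullback_topology by (auto simp: f_def X_def)
  \<comment> \<open>Traces of old open sets on \<open>U\<close> and on its complement: they yield a
    base of the new topology and are Borel for the old one.\<close>
  have fin: "openin T' (W \<inter> {x. x \<in> U \<longleftrightarrow> b})" if "openin T W" for W b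
  proof -
    have "openin Y (W \<times> {b})"
      unfolding Y_def using that by (simp add: openin_prod_Times_iff)
    moreover have "W \<inter> {x. x \<in> U \<longleftrightarrow> b} = f -` (W \<times> {b}) \<inter> X"
      using openin_subset[OF that] by (auto simp: f_def X_def)
    ultimately show ?thesis
      unfolding T'_def openin_pullback_topology by blast
  qed
  have "openin T X" by (simp add: X_def)
  moreover have "X \<inter> {x. x \<in> U \<longleftrightarrow> True} = U" "X \<inter> {x. x \<in> U \<longleftrightarrow> False} = X - U"
    using UX by auto
  ultimately have clop: "openin T' U" "openin T' (X - U)"
    using fin[of X True] fin[of X False] by simp_all
  have finer: "openin T' W" if "openin T W" for W
  proof -
    have eq: "(W \<inter> {x. x \<in> U \<longleftrightarrow> True}) \<union> (W \<inter> {x. x \<in> U \<longleftrightarrow> False}) = W" by auto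
    show ?thesis using openin_Un[OF fin[OF that, of True] fin[OF that, of False]] unfolding eq .
  qed
  obtain \<B> where B: "countable \<B>" "\<And>V. V \<in> \<B> \<Longrightarrow> openin T V"
      "\<And>U x. openin T U \<Longrightarrow> x \<in> U \<Longrightarrow> \<exists>V\<in>\<B>. x \<in> V \<and> V \<subseteq> U"
    by (rule second_countableE[OF sc]) blast
  define \<B>' where "\<B>' = (\<lambda>(V, b). V \<inter> {x. x \<in> U \<longleftrightarrow> b}) ` (\<B> \<times> UNIV)"
  have B'c: "countable \<B>'" unfolding \<B>'_def using B(1) by simp
  have B': "\<exists>V\<in>\<B>'. x \<in> V \<and> V \<subseteq> W" if W: "openin T' W" and x: "x \<in> W" for W x
  proof -
    obtain Q where Q: "openin Y Q" "W = f -` Q \<inter> X"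
      using W unfolding T'_def openin_pullback_topology by blast
    have "(x, x \<in> U) \<in> Q" using Q x by (simp add: f_def)
    then obtain P R where PR: "openin T P" "x \<in> P" "(x \<in> U) \<in> R" "P \<times> R \<subseteq> Q"
      using Q(1) unfolding Y_def openin_prod_topology_alt by blast
    obtain V where V: "V \<in> \<B>" "x \<in> V" "V \<subseteq> P"
      using B(3) PR by blast
    have "V \<inter> {z. z \<in> U \<longleftrightarrow> x \<in> U} \<subseteq> W"
      using V PR Q openin_subset[OF PR(1)] by (auto simp: f_def X_def)
    then show ?thesis
      using V by (intro bexI[of _ "V \<inter> {z. z \<in> U \<longleftrightarrow> x \<in> U}"]) (auto simp: \<B>'_def)
  qed
  have sc': "second_countable T'"
    unfolding second_countable_def
  proof (intro exI[of _ \<B>'] conjI allI impI ballI)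
    show "openin T' V" if "V \<in> \<B>'" for V
      using that fin[OF B(2)] by (auto simp: \<B>'_def)
    show "\<exists>V\<in>\<B>'. x \<in> V \<and> V \<subseteq> W" if "openin T' W \<and> x \<in> W" for W x
      using B' that by simp
  qed (rule B'c)
  have Um: "W \<in> sets M" if "openin T W" for W
    using that st by auto
  have Ub: "V \<inter> {x. x \<in> U \<longleftrightarrow> b} \<in> sets M" if "openin T V" for V b
  proof (cases b)
    case True
    then have "V \<inter> {x. x \<in> U \<longleftrightarrow> b} = V \<inter> U" by auto
    then show ?thesis using Um[OF that] Um[OF U] by auto
  next
    case False
    then have "V \<inter> {x. x \<in> U \<longleftrightarrow> b} = V - U" by auto
    then show ?thesis using Um[OF that] Um[OF U] by auto
  qed
  have B'm: "V \<in> sigma_sets X {U. openin T U}" if "V \<in> \<B>'" for V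
    using that Ub[OF B(2)] unfolding st[symmetric] by (auto simp: \<B>'_def)
  have "W \<in> sigma_sets X {U. openin T U}" if "openin T' W" for W
    by (rule openin_sigma_sets_base[OF B'c]) (auto intro: B'm B'[OF that] simp del: mem_Collect_eq)
  then have "sigma_sets X {U. openin T' U} = sigma_sets X {U. openin T U}"
    using finer by (intro sigma_sets_eqI) auto
  then have "polish_for M T'"
    unfolding polish_for_def polish_topology_def using cm' sc' ts sp st by simp
  then show ?thesis using that[of T'] finer clop sp by simp
qed

text \<open>The space is embedded as the diagonal of the countable product of the
  \<open>T n\<close>. The common coarsening \<open>T 0\<close> is Hausdorff, which makes the
  diagonal closed.\<close>

lemma polish_for_join:
  fixes T :: "nat \<Rightarrow> 'a topology"
  assumes T: "\<And>n. polish_for M (T n)" and T0: "\<And>n W. openin (T 0) W \<Longrightarrow> openin (T n) W"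
  obtains T' where "polish_for M T'" "\<And>n W. openin (T n) W \<Longrightarrow> openin T' W"
proof -
  define X where "X = space M"
  define f where "f = (\<lambda>x (n :: nat). x :: 'a)"
  define Y where "Y = product_topology T UNIV"
  define T' where "T' = pullback_topology X f Y"
  have ts: "topspace (T n) = X" and cm: "completely_metrizable_space (T n)"
    and sc: "second_countable (T n)" and st: "sets M = sigma_sets X {U. openin (T n) U}" for n
    using T[of n] by (auto simp: polish_for_def polish_topology_def X_def)
  have cmY: "completely_metrizable_space Y"
    unfolding Y_def completely_metrizable_space_product_topology using cm by auto
  have img: "f ` X = (\<Inter>n. {g \<in> topspace Y. g n = g 0})"
    by (auto simp: f_def Y_def ts image_iff fun_eq_iff PiE_iff)
  have proj: "continuous_map Y (T n) (\<lambda>g. g n)" for n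
    unfolding Y_def by (intro continuous_map_product_projection) simp
  \<comment> \<open>Coordinates are compared in \<open>T 0\<close>, the one topology into which
    every projection is known to be continuous.\<close>
  have "closedin Y {g \<in> topspace Y. g n = g 0}" for n
  proof (rule closedin_continuous_maps_eq)
    show "Hausdorff_space (T 0)"
      using cm completely_metrizable_imp_metrizable_space metrizable_imp_Hausdorff_space by blast
    show "continuous_map Y (T 0) (\<lambda>g. g 0)"
      by (rule proj)
    show "continuous_map Y (T 0) (\<lambda>g. g n)"
      unfolding continuous_map_def
    proof (intro conjI allI impI)
      show "(\<lambda>g. g n) \<in> topspace Y \<rightarrow> topspace (T 0)"
        using proj[of n] ts by (simp add: continuous_map_def)
      fix U assume "openin (T 0) U"
      then have "openin (T n) U" by (rule T0)
      then show "openin Y {g \<in> topspace Y. g n \<in> U}"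
        by (rule openin_continuous_map_preimage[OF proj])
    qed
  qed
  then have "closedin Y (f ` X)"
    unfolding img by (intro closedin_Inter) auto
  then have gd: "gdelta_in Y (f ` X)"
    using closed_imp_gdelta_in cmY completely_metrizable_imp_metrizable_space by blast
  have cm': "completely_metrizable_space T'"
    unfolding T'_def using gd cmY
    by (intro completely_metrizable_space_pullback) (auto simp: f_def inj_on_def fun_eq_iff)
  have ts': "topspace T' = X"
    unfolding T'_def Y_def topspace_pullback_topology by (auto simp: f_def ts)
  have finer: "openin T' W" if W: "openin (T n) W" for n W
  proof -
    have "openin Y {g \<in> topspace Y. g n \<in> W}"
      by (rule openin_continuous_map_preimage[OF proj W])
    moreover have "W = f -` {g \<in> topspace Y. g n \<in> W} \<inter> X"
      using openin_subset[OF W] by (auto simp: f_def Y_def ts)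
    ultimately show ?thesis
      unfolding T'_def openin_pullback_topology by blast
  qed
  have "\<exists>\<B>. countable \<B> \<and> (\<forall>V\<in>\<B>. openin (T n) V) \<and>
      (\<forall>U x. openin (T n) U \<and> x \<in> U \<longrightarrow> (\<exists>V\<in>\<B>. x \<in> V \<and> V \<subseteq> U))" for n
    using sc[of n] by (simp add: second_countable_def)
  then obtain \<B> where B: "\<And>n. countable (\<B> n)" "\<And>n V. V \<in> \<B> n \<Longrightarrow> openin (T n) V"
      "\<And>n U x. openin (T n) U \<Longrightarrow> x \<in> U \<Longrightarrow> (\<exists>V\<in>\<B> n. x \<in> V \<and> V \<subseteq> U)"
    by metis
  \<comment> \<open>The factor \<open>X\<close> turns the intersection of the empty family into the
    whole space.\<close>
  define \<B>' where "\<B>' = (\<lambda>\<F>. X \<inter> \<Inter>\<F>) ` {\<F>. finite \<F> \<and> \<F> \<subseteq> (\<Union>n. \<B> n)}"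
  have "countable {\<F>. finite \<F> \<and> \<F> \<subseteq> (\<Union>n. \<B> n)}"
    using B(1) by (intro countable_Collect_finite_subset) auto
  then have B'c: "countable \<B>'" unfolding \<B>'_def by simp
  have B': "\<exists>V\<in>\<B>'. x \<in> V \<and> V \<subseteq> W" if W: "openin T' W" and x: "x \<in> W" for W x
  proof -
    obtain Q where Q: "openin Y Q" "W = f -` Q \<inter> X"
      using W unfolding T'_def openin_pullback_topology by blast
    have "f x \<in> Q" using Q x by auto
    then obtain V where V: "finite {n. V n \<noteq> X}" "\<And>n. openin (T n) (V n)"
        "f x \<in> PiE UNIV V" "PiE UNIV V \<subseteq> Q"
      using Q(1) unfolding Y_def openin_product_topology_alt by (auto simp: ts)
    have "\<forall>n. \<exists>C\<in>\<B> n. x \<in> C \<and> C \<subseteq> V n"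
      using B(3) V(2,3) by (simp add: f_def PiE_iff)
    then obtain C where C: "\<And>n. C n \<in> \<B> n" "\<And>n. x \<in> C n" "\<And>n. C n \<subseteq> V n"
      by metis
    have "X \<inter> \<Inter>(C ` {n. V n \<noteq> X}) \<subseteq> W"
    proof
      fix y assume y: "y \<in> X \<inter> \<Inter>(C ` {n. V n \<noteq> X})"
      then have "y \<in> V n" for n
        using C(3)[of n] by (cases "V n = X") auto
      then show "y \<in> W" using y V(4) Q(2) by (auto simp: f_def PiE_iff)
    qed
    moreover have "X \<inter> \<Inter>(C ` {n. V n \<noteq> X}) \<in> \<B>'"
      unfolding \<B>'_def using V(1) C(1) by blast
    moreover have "x \<in> X \<inter> \<Inter>(C ` {n. V n \<noteq> X})"
      using C(2) x Q(2) by auto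
    ultimately show ?thesis by (meson bexI)
  qed
  have fB: "X \<inter> \<Inter>\<F> \<in> sets M \<and> openin T' (X \<inter> \<Inter>\<F>)" if "finite \<F>" "\<F> \<subseteq> (\<Union>n. \<B> n)" for \<F>
    using that
  proof (induction \<F>)
    case empty
    show ?case using ts' X_def openin_topspace[of T'] by simp
  next
    case (insert C \<F>)
    then obtain n where "openin (T n) C" using B(2) by blast
    then have "C \<in> sets M" "openin T' C" using st finer by auto
    moreover have "X \<inter> \<Inter>(insert C \<F>) = C \<inter> (X \<inter> \<Inter>\<F>)" by auto
    ultimately show ?case using insert by auto
  qed
  have sc': "second_countable T'"
    unfolding second_countable_def
  proof (intro exI[of _ \<B>'] conjI allI impI ballI)
    show "openin T' V" if "V \<in> \<B>'" for V
      using that fB by (auto simp: \<B>'_def)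
    show "\<exists>V\<in>\<B>'. x \<in> V \<and> V \<subseteq> W" if "openin T' W \<and> x \<in> W" for W x
      using B' that by simp
  qed (rule B'c)
  have B'm: "V \<in> sigma_sets X {U. openin (T 0) U}" if "V \<in> \<B>'" for V
    using that fB unfolding st[of 0, symmetric] by (auto simp: \<B>'_def)
  have "W \<in> sigma_sets X {U. openin (T 0) U}" if "openin T' W" for W
    by (rule openin_sigma_sets_base[OF B'c]) (auto intro: B'm B'[OF that] simp del: mem_Collect_eq)
  then have "sigma_sets X {U. openin T' U} = sigma_sets X {U. openin (T 0) U}"
    using finer by (intro sigma_sets_eqI) auto
  then have "polish_for M T'"
    unfolding polish_for_def polish_topology_def using cm' sc' ts' st[of 0] X_def by simp
  then show ?thesis using that[of T'] finer by simp
qed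

text \<open>The sets that can be made clopen form a sigma-algebra: the condition is symmetric under
  complements, and for a countable union the joined topology makes the union open, after which one
  more refinement makes it clopen.\<close>

lemma polish_for_measurable_clopen:
  assumes T: "polish_for M T" and S: "S \<in> sets M"
  shows "\<exists>T'. polish_for M T' \<and> (\<forall>W. openin T W \<longrightarrow> openin T' W) \<and>
    openin T' S \<and> openin T' (space M - S)"
proof -
  have "S \<in> sigma_sets (space M) {U. openin T U}"
    using T S by (simp add: polish_for_def)
  then show ?thesis
  proof (induction S)
    case (Basic U)
    then have U: "openin T U" by simp
    show ?case
      by (rule polish_for_clopen[OF T U]) metis
  next
    case Empty
    show ?case
    proof (intro exI[of _ T] conjI)
      show "openin T (space M - {})"
        using T by (simp add: polish_for_def)
    qed (use T in auto)
  next
    case (Compl S)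
    then have "S \<subseteq> space M"
      using T sigma_sets_into_sp[of "{U. openin T U}" "space M"] openin_subset
      by (metis (mono_tags, lifting) PowI mem_Collect_eq polish_for_def subsetI)
    then show ?case
      using Compl.IH by (metis double_diff order_refl)
  next
    case (Union S)
    then obtain T1 where T1: "\<And>i. polish_for M (T1 i)" "\<And>i W. openin T W \<Longrightarrow> openin (T1 i) W"
        "\<And>i. openin (T1 i) (S i)"
      by metis
    \<comment> \<open>\<open>T\<close> itself is put at index 0 because the join needs a coarsest
      member there.\<close>
    define T2 where "T2 = case_nat T T1"
    have 1: "polish_for M (T2 n)" for n
      using T T1(1) by (simp add: T2_def split: nat.split)
    have 2: "openin (T2 n) W" if "openin (T2 0) W" for n W
      using that T1(2) by (simp add: T2_def split: nat.split)
    obtain T3 where T3: "polish_for M T3" "\<And>n W. openin (T2 n) W \<Longrightarrow> openin T3 W"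
      using polish_for_join[of M T2] 1 2 by metis
    have "openin T3 W" if "openin T W" for W
      using T3(2)[of 0 W] that by (simp add: T2_def)
    moreover have "openin T3 (S i)" for i
      using T3(2)[of "Suc i" "S i"] T1(3) by (simp add: T2_def)
    then have U: "openin T3 (\<Union>i. S i)"
      by (intro openin_Union) auto
    ultimately show ?case
      by (rule_tac polish_for_clopen[OF T3(1) U]) metis
  qed
qed

lemma polish_for_clopen_sequence:
  assumes "standard_borel_space M" and S: "\<And>n :: nat. S n \<in> sets M"
  obtains T where "polish_for M T" "\<And>n. openin T (S n)" "\<And>n. openin T (space M - S n)"
proof -
  obtain T where T: "polish_for M T"
    using assms(1) standard_borel_space_iff by blast
  have "\<exists>T'. polish_for M T' \<and> (\<forall>W. openin T W \<longrightarrow> openin T' W) \<and>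
      openin T' (S n) \<and> openin T' (space M - S n)" for n
    by (rule polish_for_measurable_clopen[OF T S])
  then obtain T1 where T1: "\<And>i. polish_for M (T1 i)" "\<And>i W. openin T W \<Longrightarrow> openin (T1 i) W"
      "\<And>i. openin (T1 i) (S i)" "\<And>i. openin (T1 i) (space M - S i)"
    by metis
  define T2 where "T2 = case_nat T T1"
  have 1: "polish_for M (T2 n)" for n
    using T T1(1) by (simp add: T2_def split: nat.split)
  have 2: "openin (T2 n) W" if "openin (T2 0) W" for n W
    using that T1(2) by (simp add: T2_def split: nat.split)
  obtain T3 where T3: "polish_for M T3" "\<And>n W. openin (T2 n) W \<Longrightarrow> openin T3 W"
    using polish_for_join[of M T2] 1 2 by metis
  have "openin T3 (S i)" "openin T3 (space M - S i)" for i
    using T3(2)[of "Suc i"] T1(3,4) by (simp_all add: T2_def)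
  then show ?thesis
    using that T3(1) by blast
qed

text \<open>
  Only this combinatorial trace of a Polish topology is used below: nested intersections of cells
  converge, and every set \<open>S j\<close> is decided by the cells of level \<open>j\<close>.
\<close>

definition complete_cells :: "'a measure \<Rightarrow> (nat \<Rightarrow> 'a set) \<Rightarrow> (nat \<Rightarrow> nat \<Rightarrow> 'a set) \<Rightarrow> bool" where
  "complete_cells M S c \<longleftrightarrow>
     (\<forall>r k. c r k \<in> sets M) \<and> (\<forall>r. (\<Union>k. c r k) = space M) \<and> (\<forall>r. disjoint_family (c r)) \<and>
     (\<forall>j k. c j k \<subseteq> S j \<or> c j k \<inter> S j = {}) \<and>
     (\<forall>x f. (\<forall>r. \<forall>\<^sub>F n in sequentially. x n \<in> c r (f r)) \<longrightarrow>
       (\<exists>z\<in>space M. \<forall>j. z \<in> S j \<longleftrightarrow> c j (f j) \<subseteq> S j))"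

lemma complete_cellsD:
  assumes "complete_cells M S c"
  shows "c r k \<in> sets M" "(\<Union>k. c r k) = space M" "disjoint_family (c r)"
    "c j k \<subseteq> S j \<or> c j k \<inter> S j = {}"
  using assms unfolding complete_cells_def by simp_all

lemma complete_cells_limit:
  assumes "complete_cells M S c" and x: "\<And>r. \<forall>\<^sub>F n in sequentially. x n \<in> c r (f r)"
  shows "\<exists>z\<in>space M. \<forall>j. z \<in> S j \<longleftrightarrow> c j (f j) \<subseteq> S j"
proof -
  have "(\<forall>r. \<forall>\<^sub>F n in sequentially. x n \<in> c r (f r)) \<longrightarrow>
      (\<exists>z\<in>space M. \<forall>j. z \<in> S j \<longleftrightarrow> c j (f j) \<subseteq> S j)"
    using assms(1) unfolding complete_cells_def by presburger
  then show ?thesis using x by simp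
qed

text \<open>Take a complete metric for a topology in which all \<open>S j\<close> are clopen, and
  cut the space at level \<open>r\<close> into pieces of diameter less than \<open>(1/2)^r\<close>
  on one side of \<open>S r\<close>. A sequence that is eventually in each chosen piece is Cauchy.
  Its limit may leave the pieces, which are not closed, but it stays on the right side of every
  \<open>S j\<close>.\<close>

lemma standard_borel_cells:
  assumes M: "standard_borel_space M" and S: "\<And>j :: nat. S j \<in> sets M"
  obtains c where "complete_cells M S c"
proof -
  obtain T where T: "polish_for M T" and clop: "\<And>n. openin T (S n)" "\<And>n. openin T (space M - S n)"
    using polish_for_clopen_sequence[of M S] M S by blast
  then obtain X d where "Metric_space X d" and mc: "Metric_space.mcomplete X d"
      and mt: "T = Metric_space.mtopology X d"
    by (auto simp: polish_for_def polish_topology_def completely_metrizable_space_def)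
  then interpret Metric_space X d by simp
  have X: "space M = X" "topspace T = X"
    using T mt by (simp_all add: polish_for_def)
  have om: "W \<in> sets M" if "openin T W" for W
    using T that by (auto simp: polish_for_def)
  have "second_countable T"
    using T by (simp add: polish_for_def polish_topology_def)
  then obtain \<B> where B: "countable \<B>" "\<And>V. V \<in> \<B> \<Longrightarrow> openin T V"
      "\<And>U x. openin T U \<Longrightarrow> x \<in> U \<Longrightarrow> \<exists>V\<in>\<B>. x \<in> V \<and> V \<subseteq> U"
    by (rule second_countableE) blast
  define \<C> where "\<C> r = {V \<in> \<B>. (V \<subseteq> S r \<or> V \<inter> S r = {}) \<and> (\<forall>x\<in>V. \<forall>y\<in>V. d x y < (1/2)^r)}" for r
  have cover: "\<exists>V\<in>\<C> r. x \<in> V" if x: "x \<in> X" for r x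
  proof -
    define H where "H = (if x \<in> S r then S r else X - S r)"
    have H: "openin T H" "x \<in> H"
      using clop X x by (auto simp: H_def)
    have "openin T (mball x ((1/2)^r / 2))"
      unfolding mt by (rule openin_mball)
    moreover have "x \<in> mball x ((1/2)^r / 2)"
      using x by simp
    ultimately obtain V where V: "V \<in> \<B>" "x \<in> V" "V \<subseteq> H \<inter> mball x ((1/2)^r / 2)"
      using B(3)[of "H \<inter> mball x ((1/2)^r / 2)" x] H by (meson IntI openin_Int)
    have "d y z < (1/2)^r" if "y \<in> V" "z \<in> V" for y z
    proof -
      have *: "y \<in> X" "z \<in> X" "d x y < (1/2)^r / 2" "d x z < (1/2)^r / 2"
        using that V(3) by auto
      have "d y z \<le> d x y + d x z"
        using * x triangle''[of y x z] by (simp add: commute)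
      then show ?thesis using * by linarith
    qed
    moreover have "V \<subseteq> S r \<or> V \<inter> S r = {}"
      using V(3) by (auto simp: H_def split: if_splits)
    ultimately have "V \<in> \<C> r"
      using V(1) by (simp add: \<C>_def)
    then show ?thesis using V(2) by blast
  qed
  \<comment> \<open>The added empty set keeps the enumeration meaningful when the space is empty;
    repetitions disappear in \<open>disjointed\<close>.\<close>
  define b where "b r = from_nat_into (insert {} (\<C> r))" for r
  have ctb: "countable (insert {} (\<C> r))" for r
    using B(1) by (simp add: \<C>_def)
  have b: "b r k \<in> insert {} (\<C> r)" for r k
    unfolding b_def by (rule from_nat_into) simp
  have bU: "(\<Union>k. b r k) = X" for r
  proof
    have "V \<subseteq> X" if "V \<in> \<C> r" for V
      using that B(2) X openin_subset by (metis (no_types, lifting) \<C>_def mem_Collect_eq)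
    then show "(\<Union>k. b r k) \<subseteq> X"
      using b by blast
    show "X \<subseteq> (\<Union>k. b r k)"
    proof
      fix x assume "x \<in> X"
      then obtain V where V: "V \<in> \<C> r" "x \<in> V" using cover by blast
      then have "V \<in> range (b r)"
        unfolding b_def using ctb by (simp add: range_from_nat_into)
      then show "x \<in> (\<Union>k. b r k)" using V(2) by blast
    qed
  qed
  define c where "c r = disjointed (b r)" for r
  have cb: "c r k \<subseteq> b r k" for r k
    unfolding c_def by (rule disjointed_subset)
  have "complete_cells M S c"
    unfolding complete_cells_def
  proof (intro conjI allI impI)
    have "b r k \<in> sets M" for r k
      using b[of r k] B(2) om by (auto simp: \<C>_def)
    then show "c r k \<in> sets M" for r k
      using sets.range_disjointed_sets[of "b r" M] by (auto simp: c_def)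
    show "(\<Union>k. c r k) = space M" for r
      unfolding c_def UN_disjointed_eq bU X ..
    show "disjoint_family (c r)" for r
      unfolding c_def by (rule disjoint_family_disjointed)
    have dec: "b j k \<subseteq> S j \<or> b j k \<inter> S j = {}" for j k
      using b[of j k] by (auto simp: \<C>_def)
    then show "c j k \<subseteq> S j \<or> c j k \<inter> S j = {}" for j k
      using cb by (meson disjoint_iff subset_eq)
    fix x f assume ev': "\<forall>r. \<forall>\<^sub>F n in sequentially. x n \<in> c r (f r)"
    have ev: "\<forall>\<^sub>F n in sequentially. x n \<in> c r (f r)" for r
      using ev' by simp
    have cX: "c r k \<subseteq> X" for r k
      using cb bU by blast
    obtain n0 where n0: "\<And>n. n \<ge> n0 \<Longrightarrow> x n \<in> c 0 (f 0)"
      using ev[of 0] unfolding eventually_sequentially by blast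
    \<comment> \<open>Early terms of \<open>x\<close> are unconstrained and may lie outside the
      space, so they are dropped.\<close>
    define y where "y n = x (n + n0)" for n
    have evy: "\<forall>\<^sub>F n in sequentially. y n \<in> c r (f r)" for r
      unfolding y_def using ev[of r] by (rule eventually_sequentially_seg[THEN iffD2])
    have yX: "range y \<subseteq> X"
    proof
      fix u assume "u \<in> range y"
      then obtain n where "u = x (n + n0)" by (auto simp: y_def)
      then show "u \<in> X" using n0[of "n + n0"] cX by auto
    qed
    have "MCauchy y"
      unfolding MCauchy_def
    proof (intro conjI allI impI)
      fix \<epsilon> :: real assume "\<epsilon> > 0"
      then obtain r where r: "(1/2 :: real)^r < \<epsilon>"
        using real_arch_pow_inv[of \<epsilon> "1/2"] by auto
      obtain N where N: "\<And>n. n \<ge> N \<Longrightarrow> y n \<in> c r (f r)"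
        using evy[of r] unfolding eventually_sequentially by blast
      have "d u v < \<epsilon>" if "u \<in> c r (f r)" "v \<in> c r (f r)" for u v
      proof -
        have "u \<in> b r (f r)" "v \<in> b r (f r)" using that cb by auto
        then have "d u v < (1/2)^r"
          using b[of r "f r"] by (auto simp: \<C>_def)
        then show ?thesis using r by simp
      qed
      then show "\<exists>N. \<forall>n n'. N \<le> n \<longrightarrow> N \<le> n' \<longrightarrow> d (y n) (y n') < \<epsilon>"
        using N by blast
    qed (rule yX)
    then obtain z where z: "limitin mtopology y z sequentially"
      using mc unfolding mcomplete_def by blast
    have zX: "z \<in> X" using z limitin_mspace by blast
    have zc: "z \<in> C" if "closedin T C" "\<forall>\<^sub>F n in sequentially. y n \<in> C" for C
      using limitin_closedin[OF z] that mt by simp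
    have "z \<in> S j \<longleftrightarrow> c j (f j) \<subseteq> S j" for j
    proof
      assume L: "c j (f j) \<subseteq> S j"
      have "S j = X - (X - S j)"
        using clop(1)[of j] X openin_subset by blast
      then have "closedin T (S j)"
        using clop(2)[of j] X by (metis openin_closedin_eq openin_closedin closedin_def Diff_subset)
      then show "z \<in> S j"
        by (rule zc) (rule eventually_mono[OF evy[of j]], use L in auto)
    next
      assume R: "z \<in> S j"
      show "c j (f j) \<subseteq> S j"
      proof (rule ccontr)
        assume "\<not> ?thesis"
        then have "b j (f j) \<inter> S j = {}"
          using dec[of j "f j"] cb[of j "f j"] by blast
        then have "c j (f j) \<subseteq> X - S j"
          using cb[of j "f j"] cX by blast
        moreover have "closedin T (X - S j)"
          using clop(1)[of j] X by (metis closedin_diff closedin_topspace)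
        ultimately have "z \<in> X - S j"
          using zc evy[of j] by (metis (mono_tags, lifting) eventually_mono subsetD)
        then show False using R by simp
      qed
    qed
    then show "\<exists>z\<in>space M. \<forall>j. z \<in> S j \<longleftrightarrow> c j (f j) \<subseteq> S j"
      using zX X by blast
  qed
  then show ?thesis by (rule that)
qed

text \<open>The target of a Borel map enters the separation and image theorems only through such a
  family: two images agree once no \<open>W n\<close> tells them apart.\<close>

definition separating :: "'a measure \<Rightarrow> (nat \<Rightarrow> 'a set) \<Rightarrow> bool" where
  "separating M W \<longleftrightarrow> (\<forall>n. W n \<in> sets M) \<and>
     (\<forall>x\<in>space M. \<forall>y\<in>space M. (\<forall>n. x \<in> W n \<longleftrightarrow> y \<in> W n) \<longrightarrow> x = y)"

lemma standard_borel_separating: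
  assumes "standard_borel_space M"
  obtains W where "separating M W"
proof -
  obtain T where T: "polish_for M T"
    using assms standard_borel_space_iff by blast
  then have "second_countable T" "completely_metrizable_space T"
    by (auto simp: polish_for_def polish_topology_def)
  then obtain \<B> where B: "countable \<B>" "\<And>V. V \<in> \<B> \<Longrightarrow> openin T V"
      "\<And>U x. openin T U \<Longrightarrow> x \<in> U \<Longrightarrow> \<exists>V\<in>\<B>. x \<in> V \<and> V \<subseteq> U"
    by (rule_tac second_countableE) blast+
  have H: "Hausdorff_space T"
    using \<open>completely_metrizable_space T\<close> completely_metrizable_imp_metrizable_space
      metrizable_imp_Hausdorff_space by blast
  define W where "W = from_nat_into (insert {} \<B>)"
  have W: "W n \<in> insert {} \<B>" for n
    unfolding W_def by (rule from_nat_into) simp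
  have rW: "range W = insert {} \<B>"
    unfolding W_def using B(1) by (simp add: range_from_nat_into)
  have "separating M W"
    unfolding separating_def
  proof (intro conjI allI ballI impI)
    show "W n \<in> sets M" for n
      using W[of n] B(2) T by (auto simp: polish_for_def)
    fix x y assume xy: "x \<in> space M" "y \<in> space M" and eq: "\<forall>n. x \<in> W n \<longleftrightarrow> y \<in> W n"
    show "x = y"
    proof (rule ccontr)
      assume "x \<noteq> y"
      then obtain U V where UV: "openin T U" "x \<in> U" "y \<in> V" "disjnt U V"
        using H xy T unfolding Hausdorff_space_def polish_for_def by metis
      then obtain V' where V': "V' \<in> \<B>" "x \<in> V'" "V' \<subseteq> U" using B(3) by blast
      then have "V' \<in> range W" using rW by simp
      then have "y \<in> V'" using eq V'(2) by auto
      then show False using UV V'(3) by (auto simp: disjnt_def)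
    qed
  qed
  then show ?thesis by (rule that)
qed

section \<open>Separation of analytic sets and finite-to-one images\<close>

text \<open>The conclusion of Novikov's separation theorem for a sequence of analytic sets. Pairwise
  disjoint hulls are not demanded, only an empty intersection of all of them.\<close>

definition separable_images :: "'b measure \<Rightarrow> ('a \<Rightarrow> 'b) \<Rightarrow> (nat \<Rightarrow> 'a set) \<Rightarrow> bool" where
  "separable_images N p C \<longleftrightarrow>
     (\<exists>B. (\<forall>n. B n \<in> sets N \<and> p ` C n \<subseteq> B n) \<and> (\<Inter>n. B n) = {})"

text \<open>Read contrapositively: a non-separable family stays so when one coordinate is cut down
  to a suitable piece. For the proof, hulls of the pieces are united in coordinate \<open>n\<close>
  and intersected elsewhere; a point in all of these picks a \<open>k\<close> in coordinate
  \<open>n\<close> and then lies in every \<open>B k m\<close>.\<close>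

lemma separable_images_split:
  assumes sep: "\<And>k :: nat. separable_images N p (C(n := C n \<inter> D k))" and cover: "C n \<subseteq> (\<Union>k. D k)"
  shows "separable_images N p C"
proof -
  have "\<forall>k. \<exists>B. (\<forall>m. B m \<in> sets N \<and> p ` (C(n := C n \<inter> D k)) m \<subseteq> B m) \<and> (\<Inter>m. B m) = {}"
    using sep unfolding separable_images_def by blast
  then obtain B where B: "\<And>k m. B k m \<in> sets N" "\<And>k m. p ` (C(n := C n \<inter> D k)) m \<subseteq> B k m"
      "\<And>k. (\<Inter>m. B k m) = {}"
    by metis
  define B' where "B' m = (if m = n then (\<Union>k. B k m) else (\<Inter>k. B k m))" for m
  have "B' m \<in> sets N" for m
    unfolding B'_def using B(1) by (auto intro!: sets.countable_INT')
  moreover have "p ` C m \<subseteq> B' m" for m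
  proof (cases "m = n")
    case True
    have "p ` C n \<subseteq> (\<Union>k. p ` (C n \<inter> D k))" using cover by blast
    also have "\<dots> \<subseteq> (\<Union>k. B k n)" using B(2)[of _ n] by fastforce
    finally show ?thesis by (simp add: B'_def True)
  next
    case False
    then have "p ` C m \<subseteq> B k m" for k using B(2)[of k m] by simp
    then show ?thesis using False by (auto simp: B'_def)
  qed
  moreover have "(\<Inter>m. B' m) = {}"
  proof (rule ccontr)
    assume "(\<Inter>m. B' m) \<noteq> {}"
    then obtain x where x: "\<And>m. x \<in> B' m" by blast
    obtain k where k: "x \<in> B k n" using x[of n] by (auto simp: B'_def)
    have "x \<in> B k m" for m
      using x[of m] k by (cases "m = n") (auto simp: B'_def)
    then show False using B(3)[of k] by blast
  qed
  ultimately show ?thesis unfolding separable_images_def by blast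
qed

text \<open>The source of the contradictions in Novikov's theorem: two coordinates with disjoint
  hulls suffice, the others take the whole space.\<close>

lemma separable_images_disjoint:
  assumes "A \<in> sets N" "B \<in> sets N" "A \<inter> B = {}" "m \<noteq> n" "p ` C m \<subseteq> A" "p ` C n \<subseteq> B"
    and "\<And>i. p ` C i \<subseteq> space N"
  shows "separable_images N p C"
  unfolding separable_images_def
proof (intro exI[of _ "(\<lambda>_. space N)(m := A, n := B)"] conjI allI)
  show "(\<Inter>i. ((\<lambda>_. space N)(m := A, n := B)) i) = {}"
    using assms(3,4) by (auto split: if_splits dest!: spec[where x = m] spec[where x = n])
qed (use assms in auto)

text \<open>If the family were not separable, all coordinates could be cut to ever smaller cells
  without becoming separable. The cells of coordinate \<open>n\<close> converge to a point
  \<open>z n\<close> of \<open>S n\<close>. Were \<open>p (z n)\<close> different from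
  \<open>p (z 0)\<close>, some \<open>W k\<close> would distinguish them and already separate the
  two images at a finite stage. So \<open>p (z 0)\<close> lies in all images, contrary to
  assumption.\<close>

theorem novikov_separation:
  assumes M: "standard_borel_space M" and W: "separating N W" and p: "p \<in> measurable M N"
    and S: "\<And>n. S n \<in> sets M" and disj: "(\<Inter>n. p ` S n) = {}"
  shows "separable_images N p S"
proof (rule ccontr)
  assume nsep: "\<not> separable_images N p S"
  \<comment> \<open>Even levels of the cells decide membership in the \<open>S n\<close>, odd levels
    the side of the \<open>W k\<close> on which the image lies.\<close>
  define Q where "Q j = (if even j then S (j div 2) else p -` W (j div 2) \<inter> space M)" for j
  have Wm: "W k \<in> sets N" for k using W by (simp add: separating_def)
  have "Q j \<in> sets M" for j
    unfolding Q_def using S measurable_sets[OF p Wm] by simp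
  then obtain c where cc: "complete_cells M Q c"
    by (rule standard_borel_cells[OF M])
  note c = complete_cellsD[OF cc]
  have SM: "S n \<subseteq> space M" for n using S sets.sets_into_space by blast
  define bad where "bad C \<longleftrightarrow> \<not> separable_images N p C \<and> (\<forall>n. C n \<subseteq> S n)" for C
  \<comment> \<open>Stage \<open>t\<close> decodes to a coordinate and a level, so each coordinate
    is cut at each level exactly once.\<close>
  define step where "step t C C' \<longleftrightarrow>
    (\<exists>k. C' = C(fst (prod_decode t) := C (fst (prod_decode t)) \<inter> c (snd (prod_decode t)) k))" for t C C'
  have "\<exists>C. \<forall>t. bad (C t) \<and> step t (C t) (C (Suc t))"
  proof (rule dependent_nat_choice)
    show "\<exists>C. bad C" using nsep by (auto simp: bad_def)
    fix C :: "nat \<Rightarrow> 'a set" and t assume C: "bad C"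
    define n where "n = fst (prod_decode t)"
    define r where "r = snd (prod_decode t)"
    have "C n \<subseteq> (\<Union>k. c r k)"
      using C SM c(2) by (fastforce simp: bad_def)
    then obtain k where "\<not> separable_images N p (C(n := C n \<inter> c r k))"
      using separable_images_split[of N p C n "c r"] C by (auto simp: bad_def)
    then have "bad (C(n := C n \<inter> c r k))"
      using C by (auto simp: bad_def)
    then show "\<exists>C'. bad C' \<and> step t C C'"
      unfolding step_def n_def r_def by blast
  qed
  then obtain C where bad: "\<And>t. bad (C t)" and "\<forall>t. step t (C t) (C (Suc t))" by blast
  then have "\<forall>t. \<exists>k. C (Suc t) = (C t)(fst (prod_decode t) :=
      C t (fst (prod_decode t)) \<inter> c (snd (prod_decode t)) k)"
    by (simp add: step_def)
  then obtain K where K: "\<And>t. C (Suc t) = (C t)(fst (prod_decode t) :=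
      C t (fst (prod_decode t)) \<inter> c (snd (prod_decode t)) (K t))"
    by metis
  have mono: "C t n \<subseteq> C s n" if "s \<le> t" for s t n
    using that by (rule lift_Suc_antimono_le[of "\<lambda>t. C t n", rotated]) (auto simp: K)
  have Cc: "C t n \<subseteq> c r (K (prod_encode (n, r)))" if "t > prod_encode (n, r)" for t n r
  proof -
    have "C t n \<subseteq> C (Suc (prod_encode (n, r))) n"
      by (rule mono) (use that in simp)
    then show ?thesis by (auto simp: K)
  qed
  \<comment> \<open>An empty coordinate would have the hull \<open>{}\<close>, which makes the
    family separable; hence points can be picked at every stage.\<close>
  have ne: "C t n \<noteq> {}" for t n
  proof
    assume e: "C t n = {}"
    have "p ` C t i \<subseteq> space N" for i
      using bad[of t] SM measurable_space[OF p] by (fastforce simp: bad_def)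
    then have "separable_images N p (C t)"
      using e by (intro separable_images_disjoint[of "{}" N "space N" n "Suc n"]) auto
    then show False using bad by (simp add: bad_def)
  qed
  have "\<forall>n. \<exists>z\<in>space M. \<forall>j. z \<in> Q j \<longleftrightarrow> c j (K (prod_encode (n, j))) \<subseteq> Q j"
  proof
    fix n
    define x where "x t = (SOME y. y \<in> C t n)" for t
    have x: "x t \<in> C t n" for t
      unfolding x_def using ne[of t n] by (simp add: some_in_eq)
    show "\<exists>z\<in>space M. \<forall>j. z \<in> Q j \<longleftrightarrow> c j (K (prod_encode (n, j))) \<subseteq> Q j"
    proof (rule complete_cells_limit[OF cc, of x])
      fix r
      show "\<forall>\<^sub>F t in sequentially. x t \<in> c r (K (prod_encode (n, r)))"
        using eventually_gt_at_top[of "prod_encode (n, r)"]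
        by (rule eventually_mono) (use x Cc in blast)
    qed
  qed
  then obtain z where z: "\<And>n. z n \<in> space M"
      "\<And>n j. z n \<in> Q j \<longleftrightarrow> c j (K (prod_encode (n, j))) \<subseteq> Q j"
    by metis
  have zS: "z n \<in> S n" for n
  proof -
    define j where "j = 2 * n"
    obtain y where "y \<in> C (Suc (prod_encode (n, j))) n" using ne by blast
    then have "y \<in> c j (K (prod_encode (n, j)))" "y \<in> S n"
      using Cc[of n j "Suc (prod_encode (n, j))"] bad by (auto simp: bad_def)
    moreover have "Q j = S n" by (simp add: Q_def j_def)
    ultimately show ?thesis
      using z(2)[of n j] c(4)[of j "K (prod_encode (n, j))"] by blast
  qed
  have "p (z n) = p (z 0)" for n
  proof (rule ccontr)
    assume ne: "p (z n) \<noteq> p (z 0)"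
    have "p (z n) \<in> space N" "p (z 0) \<in> space N"
      using z(1) measurable_space[OF p] by auto
    then obtain k where k: "(p (z n) \<in> W k) \<noteq> (p (z 0) \<in> W k)"
      using ne W unfolding separating_def by blast
    define j where "j = 2 * k + 1"
    have Qj: "Q j = p -` W k \<inter> space M" by (simp add: Q_def j_def)
    \<comment> \<open>A stage after both coordinates have been cut at the level that decides
      \<open>W k\<close>.\<close>
    define t where "t = Suc (prod_encode (n, j) + prod_encode (0, j))"
    have sub: "C t i \<subseteq> c j (K (prod_encode (i, j)))" if "i = n \<or> i = 0" for i
      using that by (intro Cc) (auto simp: t_def)
    \<comment> \<open>By then all images of the coordinate lie on the same side of
      \<open>W k\<close> as the image of its limit.\<close>
    have side: "(\<forall>i' \<in> C t i. p i' \<in> W k) \<and> p (z i) \<in> W k \<or>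
        (\<forall>i' \<in> C t i. p i' \<in> space N - W k) \<and> p (z i) \<notin> W k" if i: "i = n \<or> i = 0" for i
    proof (cases "c j (K (prod_encode (i, j))) \<subseteq> Q j")
      case True
      then have "z i \<in> Q j" using z(2) by blast
      then show ?thesis using True sub[OF i] unfolding Qj by blast
    next
      case False
      then have "z i \<notin> Q j" using z(2) by blast
      moreover have "C t i \<inter> Q j = {}" using False sub[OF i] c(4) by blast
      moreover have "C t i \<subseteq> space M" using bad[of t] SM by (fastforce simp: bad_def)
      ultimately show ?thesis
        using z(1)[of i] measurable_space[OF p] unfolding Qj by blast
    qed
    have n0: "n \<noteq> 0" using ne by metis
    have sp: "p ` C t i \<subseteq> space N" for i
      using bad[of t] SM measurable_space[OF p] by (fastforce simp: bad_def)
    have "separable_images N p (C t)"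
    proof (cases "p (z n) \<in> W k")
      case True
      show ?thesis
        by (rule separable_images_disjoint[of "W k" N "space N - W k" n 0])
          (use side[of n] side[of 0] True k Wm n0 sp in auto)
    next
      case False
      show ?thesis
        by (rule separable_images_disjoint[of "W k" N "space N - W k" 0 n])
          (use side[of n] side[of 0] False k Wm n0 sp in auto)
    qed
    then show False using bad by (simp add: bad_def)
  qed
  then have "p (z 0) \<in> (\<Inter>n. p ` S n)"
    using zS by (metis INT_I image_eqI)
  then show False using disj by simp
qed

text \<open>The tails \<open>S n\<close>, taken over pieces with index at least \<open>n\<close>,
  have images with empty intersection: a common point would have preimages in infinitely many
  disjoint pieces. If Novikov hulls of the tails are intersected up to \<open>k\<close>, a point
  missing from \<open>B n\<close> can lie in \<open>H k\<close> only for
  \<open>k < n\<close>.\<close>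

lemma point_finite_cover_of_images:
  assumes M: "standard_borel_space M" and W: "separating N W" and p: "p \<in> measurable M N"
    and A: "A \<in> sets M" and fin: "\<And>x. finite {z \<in> A. p z = x}"
    and D: "\<And>k :: nat. D k \<in> sets M" "disjoint_family D"
  shows "\<exists>H. (\<forall>k. H k \<in> sets N \<and> p ` (A \<inter> D k) \<subseteq> H k) \<and> (\<forall>x. finite {k. x \<in> H k})"
proof -
  define S where "S n = A \<inter> (\<Union>k\<in>{n..}. D k)" for n
  have "(\<Inter>n. p ` S n) = {}"
  proof (rule ccontr)
    assume "(\<Inter>n. p ` S n) \<noteq> {}"
    then obtain x where "\<And>n. x \<in> p ` S n" by blast
    then have "\<forall>n. \<exists>z k. n \<le> k \<and> z \<in> A \<and> z \<in> D k \<and> p z = x"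
      by (fastforce simp: S_def)
    then obtain z k where zk: "\<And>n. n \<le> k n" "\<And>n. z n \<in> A" "\<And>n. z n \<in> D (k n)" "\<And>n. p (z n) = x"
      by metis
    have "finite (range z)"
      by (rule finite_subset[OF _ fin[of x]]) (use zk in auto)
    moreover define idx where "idx y = (THE j. y \<in> D j)" for y
    have "idx (z n) = k n" for n
      unfolding idx_def using zk(3)[of n] D(2)
      by (intro the_equality) (auto simp: disjoint_family_on_def)
    then have "range k \<subseteq> idx ` range z" by (metis image_comp image_subsetI comp_apply rangeI image_eqI)
    ultimately have "finite (range k)" by (meson finite_imageI finite_subset)
    then obtain b where "\<And>n. k n \<le> b" by (meson finite_nat_set_iff_bounded_le rangeI)
    then show False using zk(1)[of "Suc b"] by (meson not_less_eq_eq order_trans)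
  qed
  moreover have "S n \<in> sets M" for n
    unfolding S_def using A D(1) by (intro sets.Int sets.countable_UN') auto
  ultimately have "separable_images N p S"
    by (intro novikov_separation[OF M W p])
  then obtain B where B: "\<And>n. B n \<in> sets N" "\<And>n. p ` S n \<subseteq> B n" "(\<Inter>n. B n) = {}"
    unfolding separable_images_def by blast
  define H where "H k = (\<Inter>n\<in>{..k}. B n)" for k
  show ?thesis
  proof (intro exI[of _ H] conjI allI)
    fix k
    show "H k \<in> sets N"
      unfolding H_def using B(1) by (intro sets.finite_INT) auto
    have "A \<inter> D k \<subseteq> S n" if "n \<le> k" for n
      using that by (auto simp: S_def)
    then show "p ` (A \<inter> D k) \<subseteq> H k"
      unfolding H_def using B(2) by blast
  next
    fix x
    obtain n where n: "x \<notin> B n" using B(3) by blast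
    have "{k. x \<in> H k} \<subseteq> {..<n}"
      using n by (auto simp: H_def not_le[symmetric])
    then show "finite {k. x \<in> H k}" by (rule finite_subset) simp
  qed
qed

text \<open>The image is the set of points that lie in some hull \<open>H \<sigma>\<close> at every
  level. For such an \<open>x\<close> the addresses whose hull contains \<open>x\<close> form a
  finitely branching tree, so there is an infinite branch; its cells converge to a point
  \<open>z\<close> of \<open>S\<close> with \<open>p z = x\<close>. Point-finiteness of the hulls
  thus replaces the union over all branches by countable Borel operations.\<close>

theorem finite_to_one_image_measurable:
  assumes M: "standard_borel_space M" and W: "separating N W" and p: "p \<in> measurable M N"
    and S: "S \<in> sets M" and fin: "\<And>x. finite {z \<in> S. p z = x}"
  shows "p ` S \<in> sets N"
proof -
  define Q where "Q j = (case j of 0 \<Rightarrow> S | Suc k \<Rightarrow> p -` W k \<inter> space M)" for j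
  have Wm: "W k \<in> sets N" for k using W by (simp add: separating_def)
  have "Q j \<in> sets M" for j
    unfolding Q_def using S measurable_sets[OF p Wm] by (simp split: nat.split)
  then obtain c where cc: "complete_cells M Q c"
    by (rule standard_borel_cells[OF M])
  note c = complete_cellsD[OF cc]
  have SM: "S \<subseteq> space M" using S sets.sets_into_space by blast
  have pS: "p z \<in> space N" if "z \<in> S" for z
    using that SM measurable_space[OF p] by blast
  have "\<forall>A r. \<exists>H. A \<in> sets M \<longrightarrow> A \<subseteq> S \<longrightarrow>
      (\<forall>k. H k \<in> sets N \<and> p ` (A \<inter> c r k) \<subseteq> H k) \<and> (\<forall>x. finite {k. x \<in> H k})"
  proof (intro allI)
    fix A r
    show "\<exists>H. A \<in> sets M \<longrightarrow> A \<subseteq> S \<longrightarrow>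
        (\<forall>k. H k \<in> sets N \<and> p ` (A \<inter> c r k) \<subseteq> H k) \<and> (\<forall>x. finite {k. x \<in> H k})"
    proof (cases "A \<in> sets M \<and> A \<subseteq> S")
      case True
      have "finite {z \<in> A. p z = x}" for x
        by (rule finite_subset[OF _ fin[of x]]) (use True in auto)
      then show ?thesis
        using point_finite_cover_of_images[OF M W p _ _ c(1) c(3)] True by metis
    qed simp
  qed
  then obtain h where
    "\<forall>A r. A \<in> sets M \<longrightarrow> A \<subseteq> S \<longrightarrow>
      (\<forall>k. h A r k \<in> sets N \<and> p ` (A \<inter> c r k) \<subseteq> h A r k) \<and> (\<forall>x. finite {k. x \<in> h A r k})"
    by metis
  then have h: "h A r k \<in> sets N" "p ` (A \<inter> c r k) \<subseteq> h A r k" "finite {k. x \<in> h A r k}"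
    if "A \<in> sets M" "A \<subseteq> S" for A r k x
    using that by simp_all
  \<comment> \<open>Level 0 of the cells decides \<open>S\<close>, level \<open>Suc j\<close> the
    preimage of \<open>W j\<close>. \<open>D r k\<close> records the side of \<open>W j\<close> that
    contains the images of cell \<open>k\<close>.\<close>
  define D where "D r k = (case r of 0 \<Rightarrow> space N |
      Suc j \<Rightarrow> if c r k \<subseteq> Q r then W j else space N - W j)" for r k
  have Dm: "D r k \<in> sets N" for r k
    unfolding D_def using Wm by (simp split: nat.split)
  have pD: "p z \<in> D r k" if "z \<in> S" "z \<in> c r k" for z r k
    using that pS[OF that(1)] SM c(4)[of r k] by (auto simp: D_def Q_def split: nat.splits)
  text \<open>Addresses of cells are lists with the deepest level first.\<close>
  define Z where "Z = rec_list S (\<lambda>k \<sigma> A. A \<inter> c (length \<sigma>) k)"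
  \<comment> \<open>Empty cells get an empty hull, so that a branch through hulls of
    \<open>x\<close> passes through nonempty cells, from which a convergent sequence can be
    picked.\<close>
  define H where "H = rec_list (space N)
    (\<lambda>k \<sigma> B. if Z (k # \<sigma>) = {} then {} else B \<inter> h (Z \<sigma>) (length \<sigma>) k \<inter> D (length \<sigma>) k)"
  have Z: "Z [] = S" "Z (k # \<sigma>) = Z \<sigma> \<inter> c (length \<sigma>) k" for k \<sigma>
    by (simp_all add: Z_def)
  have H: "H [] = space N" "H (k # \<sigma>) =
      (if Z (k # \<sigma>) = {} then {} else H \<sigma> \<inter> h (Z \<sigma>) (length \<sigma>) k \<inter> D (length \<sigma>) k)" for k \<sigma>
    by (simp_all add: H_def)
  have Zm: "Z \<sigma> \<in> sets M \<and> Z \<sigma> \<subseteq> S" for \<sigma>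
    by (induction \<sigma>) (use S c(1) in \<open>auto simp: Z\<close>)
  have Hm: "H \<sigma> \<in> sets N" for \<sigma>
    by (induction \<sigma>) (use h(1) Zm Dm in \<open>auto simp: H intro!: sets.Int\<close>)
  have pH: "p ` Z \<sigma> \<subseteq> H \<sigma>" for \<sigma>
  proof (induction \<sigma>)
    case (Cons k \<sigma>)
    show ?case
    proof
      fix y assume "y \<in> p ` Z (k # \<sigma>)"
      then obtain z where z: "z \<in> Z (k # \<sigma>)" "y = p z" by blast
      then have zz: "z \<in> Z \<sigma>" "z \<in> c (length \<sigma>) k" by (auto simp: Z)
      then have "p z \<in> H \<sigma>" "p z \<in> h (Z \<sigma>) (length \<sigma>) k" "p z \<in> D (length \<sigma>) k"
        using Cons h(2)[of "Z \<sigma>" "length \<sigma>" k] Zm[of \<sigma>] pD by blast+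
      moreover have "Z (k # \<sigma>) \<noteq> {}" using z by blast
      ultimately show "y \<in> H (k # \<sigma>)" using z(2) by (simp add: H(2))
    qed
  qed (use pS in \<open>auto simp: Z H\<close>)
  have Hmono: "H (\<tau> @ \<sigma>) \<subseteq> H \<sigma>" for \<tau> \<sigma>
    by (induction \<tau>) (auto simp: H(2))
  have Hfin: "finite {k. x \<in> H (k # \<sigma>)}" for x \<sigma>
    by (rule finite_subset[OF _ h(3)[of "Z \<sigma>" x "length \<sigma>"]])
      (use Zm in \<open>auto simp: H(2) split: if_splits\<close>)
  have "p ` S = (\<Inter>r. \<Union>\<sigma>\<in>{\<sigma>. length \<sigma> = r}. H \<sigma>)"
  proof (intro equalityI subsetI)
    fix y assume "y \<in> p ` S"
    then obtain z where z: "z \<in> S" "y = p z" by blast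
    have "\<exists>\<sigma>. length \<sigma> = r \<and> z \<in> Z \<sigma>" for r
    proof (induction r)
      case 0
      show ?case using z by (simp add: Z)
    next
      case (Suc r)
      then obtain \<sigma> where "length \<sigma> = r" "z \<in> Z \<sigma>" by blast
      moreover obtain k where "z \<in> c r k" using c(2)[of r] z(1) SM by blast
      ultimately show ?case by (intro exI[of _ "k # \<sigma>"]) (simp add: Z)
    qed
    then show "y \<in> (\<Inter>r. \<Union>\<sigma>\<in>{\<sigma>. length \<sigma> = r}. H \<sigma>)"
      using pH z(2) by blast
  next
    fix x assume x: "x \<in> (\<Inter>r. \<Union>\<sigma>\<in>{\<sigma>. length \<sigma> = r}. H \<sigma>)"
    \<comment> \<open>Koenig's lemma: \<open>\<sigma>\<close> is good if it has extensions of every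
      length with \<open>x\<close> in the hull. Some child is again good, since otherwise the
      finitely many children whose hull contains \<open>x\<close> would all die out by a common
      depth.\<close>
    define good where "good \<sigma> \<longleftrightarrow> (\<forall>r. \<exists>\<tau>. length \<tau> = r \<and> x \<in> H (\<tau> @ \<sigma>))" for \<sigma>
    have good_step: "\<exists>k. good (k # \<sigma>)" if g: "good \<sigma>" for \<sigma>
    proof (rule ccontr)
      assume "\<not> ?thesis"
      then have "\<forall>k. \<exists>r. \<forall>\<tau>. length \<tau> = r \<longrightarrow> x \<notin> H (\<tau> @ k # \<sigma>)"
        unfolding good_def by blast
      then obtain R where R: "\<And>k \<tau>. length \<tau> = R k \<Longrightarrow> x \<notin> H (\<tau> @ k # \<sigma>)" by metis
      define F where "F = {k. x \<in> H (k # \<sigma>)}"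
      have F: "finite F" unfolding F_def by (rule Hfin)
      define r where "r = Max (insert 0 (R ` F))"
      obtain \<tau> where \<tau>: "length \<tau> = Suc r" "x \<in> H (\<tau> @ \<sigma>)"
        using g unfolding good_def by blast
      then obtain \<tau>' k where \<tau>': "\<tau> = \<tau>' @ [k]" by (cases \<tau> rule: rev_cases) auto
      have "x \<in> H (\<tau>' @ k # \<sigma>)" using \<tau>(2) \<tau>' by simp
      then have "k \<in> F" unfolding F_def using Hmono[of \<tau>' "k # \<sigma>"] by blast
      then have "R k \<le> r" unfolding r_def using F by simp
      then have len: "length (drop (length \<tau>' - R k) \<tau>') = R k"
        using \<tau>(1) \<tau>' by simp
      have "x \<in> H (take (length \<tau>' - R k) \<tau>' @ drop (length \<tau>' - R k) \<tau>' @ k # \<sigma>)"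
        using \<open>x \<in> H (\<tau>' @ k # \<sigma>)\<close> by (simp flip: append_assoc)
      then have "x \<in> H (drop (length \<tau>' - R k) \<tau>' @ k # \<sigma>)"
        using Hmono by blast
      then show False using R[OF len] by simp
    qed
    have "\<exists>\<sigma>. \<forall>n. (good (\<sigma> n) \<and> length (\<sigma> n) = n) \<and> (\<exists>k. \<sigma> (Suc n) = k # \<sigma> n)"
    proof (rule dependent_nat_choice)
      show "\<exists>\<sigma>. good \<sigma> \<and> length \<sigma> = 0"
        using x by (auto simp: good_def)
      show "\<exists>\<sigma>'. (good \<sigma>' \<and> length \<sigma>' = Suc n) \<and> (\<exists>k. \<sigma>' = k # \<sigma>)"
        if "good \<sigma> \<and> length \<sigma> = n" for \<sigma> n
        using good_step[of \<sigma>] that by auto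
    qed
    then obtain \<sigma> where \<sigma>: "\<And>n. good (\<sigma> n)" "\<And>n. length (\<sigma> n) = n" "\<And>n. \<exists>k. \<sigma> (Suc n) = k # \<sigma> n"
      by metis
    then obtain f where f: "\<And>n. \<sigma> (Suc n) = f n # \<sigma> n" by metis
    have xH: "x \<in> H (\<sigma> n)" for n
      using \<sigma>(1)[of n] unfolding good_def by (auto dest!: spec[of _ 0])
    have ne: "Z (\<sigma> (Suc n)) \<noteq> {}" for n
      using xH[of "Suc n"] by (auto simp: f H(2) split: if_splits)
    define y where "y n = (SOME v. v \<in> Z (\<sigma> (Suc n)))" for n
    have y: "y n \<in> Z (\<sigma> (Suc n))" for n
      unfolding y_def using ne[of n] by (simp add: some_in_eq)
    have Zdec: "Z (\<sigma> t) \<subseteq> Z (\<sigma> s)" if "s \<le> t" for s t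
      using that by (rule lift_Suc_antimono_le[of "\<lambda>t. Z (\<sigma> t)", rotated]) (auto simp: f Z)
    have Zc: "Z (\<sigma> (Suc n)) \<subseteq> c n (f n)" for n
      by (auto simp: f Z \<sigma>(2))
    have yc: "y n \<in> c r (f r)" if "r \<le> n" for r n
      using y[of n] Zdec[of "Suc r" "Suc n"] Zc[of r] that by auto
    have "\<exists>z\<in>space M. \<forall>j. z \<in> Q j \<longleftrightarrow> c j (f j) \<subseteq> Q j"
    proof (rule complete_cells_limit[OF cc, of y])
      show "\<forall>\<^sub>F n in sequentially. y n \<in> c r (f r)" for r
        using yc unfolding eventually_sequentially by blast
    qed
    then obtain z where z: "z \<in> space M" "\<And>j. z \<in> Q j \<longleftrightarrow> c j (f j) \<subseteq> Q j" by blast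
    have "y 0 \<in> S" using y[of 0] Zm by blast
    then have "c 0 (f 0) \<inter> Q 0 \<noteq> {}" using yc[of 0 0] by (auto simp: Q_def)
    then have "z \<in> Q 0" using z(2)[of 0] c(4)[of 0 "f 0"] by blast
    then have zS: "z \<in> S" by (simp add: Q_def)
    \<comment> \<open>Both sides equal the verdict of the cell at level \<open>Suc k\<close>: for
      \<open>x\<close> through \<open>D\<close>, for \<open>z\<close> through the limit
      property.\<close>
    have "p z \<in> W k \<longleftrightarrow> x \<in> W k" for k
    proof -
      have "x \<in> D (Suc k) (f (Suc k))"
        using xH[of "Suc (Suc k)"] by (auto simp: f[of "Suc k"] H(2) \<sigma>(2) split: if_splits)
      then have "x \<in> W k \<longleftrightarrow> c (Suc k) (f (Suc k)) \<subseteq> Q (Suc k)"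
        by (auto simp: D_def split: if_splits)
      also have "\<dots> \<longleftrightarrow> z \<in> Q (Suc k)" using z(2) by simp
      also have "\<dots> \<longleftrightarrow> p z \<in> W k" using z(1) by (simp add: Q_def)
      finally show ?thesis by simp
    qed
    moreover have "x \<in> space N" using xH[of 0] \<sigma>(2)[of 0] by (simp add: H)
    ultimately have "p z = x"
      using W pS[OF zS] unfolding separating_def by blast
    then show "x \<in> p ` S" using zS by blast
  qed
  moreover have "countable {\<sigma> :: nat list. length \<sigma> = r}" for r
    by simp
  ultimately show ?thesis
    using Hm by (auto intro!: sets.countable_INT' sets.countable_UN')
qed

section \<open>Counting fibres, and constructions of standard Borel spaces\<close>

lemma measurable_count_space_binary:
  fixes f :: "'a \<Rightarrow> 'b :: countable" and g :: "'a \<Rightarrow> 'c"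
  assumes f: "f \<in> measurable M (count_space UNIV)" and g: "g \<in> measurable M (count_space UNIV)"
  shows "(\<lambda>x. h (f x) (g x)) \<in> measurable M (count_space UNIV)"
proof (rule measurable_compose_countable[OF _ f, of "\<lambda>i x. h i (g x)"])
  show "(\<lambda>x. h i (g x)) \<in> measurable M (count_space UNIV)" for i
    by (rule measurable_compose[OF g]) simp
qed

lemma measurable_count_space_sum:
  fixes f :: "'i \<Rightarrow> 'a \<Rightarrow> nat"
  assumes "\<And>i. i \<in> I \<Longrightarrow> f i \<in> measurable M (count_space UNIV)"
  shows "(\<lambda>x. \<Sum>i\<in>I. f i x) \<in> measurable M (count_space UNIV)"
  using assms
proof (induction I rule: infinite_finite_induct)
  case (insert i I)
  then show ?case
    using measurable_count_space_binary[of "f i" M "\<lambda>x. \<Sum>i\<in>I. f i x" "(+)"] by simp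
qed simp_all

lemma measurable_count_space_levels:
  fixes f :: "'a \<Rightarrow> nat"
  assumes "\<And>n. {x \<in> space M. n \<le> f x} \<in> sets M"
  shows "f \<in> measurable M (count_space UNIV)"
proof -
  have "f -` {n} \<inter> space M = {x \<in> space M. n \<le> f x} - {x \<in> space M. Suc n \<le> f x}" for n
    by auto
  then have "f -` {n} \<inter> space M \<in> sets M" for n
    using assms by (simp add: sets.Diff)
  then show ?thesis
    by (subst measurable_count_space_eq2_countable) auto
qed

text \<open>A Borel map with finitely many values that is injective on any given finite set once
  \<open>r\<close> is large. It allows statements about unknown finite sets to be replaced by
  countably many Borel conditions.\<close>

definition label :: "(nat \<Rightarrow> 'a set) \<Rightarrow> nat \<Rightarrow> 'a \<Rightarrow> nat" where
  "label W r x = set_encode {k. k < r \<and> x \<in> W k}"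

lemma label_eq_iff: "label W r x = label W r y \<longleftrightarrow> (\<forall>k<r. x \<in> W k \<longleftrightarrow> y \<in> W k)"
  unfolding label_def by (subst set_encode_eq) auto

lemma label_measurable:
  assumes "\<And>n. W n \<in> sets M"
  shows "label W r \<in> measurable M (count_space UNIV)"
proof -
  have "label W r = (\<lambda>x. \<Sum>k<r. if x \<in> W k then 2^k else 0)"
    unfolding label_def set_encode_def
    by (auto simp: sum.If_cases fun_eq_iff lessThan_def Int_def intro!: sum.cong)
  moreover have "\<dots> \<in> measurable M (count_space UNIV)"
    using assms by (intro measurable_count_space_sum measurable_If_set) auto
  ultimately show ?thesis by simp
qed

lemma label_inj_on:
  assumes W: "separating M W" and K: "finite K" "K \<subseteq> space M"
  shows "\<exists>r. inj_on (label W r) K"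
proof -
  have "\<forall>x y. \<exists>n. x \<in> space M \<longrightarrow> y \<in> space M \<longrightarrow> x \<noteq> y \<longrightarrow> (x \<in> W n) \<noteq> (y \<in> W n)"
    using W unfolding separating_def by metis
  then obtain n where n: "\<And>x y. x \<in> space M \<Longrightarrow> y \<in> space M \<Longrightarrow> x \<noteq> y \<Longrightarrow>
      (x \<in> W (n x y)) \<noteq> (y \<in> W (n x y))"
    by metis
  define r where "r = Suc (\<Sum>x\<in>K. \<Sum>y\<in>K. n x y)"
  have nr: "n x y < r" if "x \<in> K" "y \<in> K" for x y
  proof -
    have "n x y \<le> (\<Sum>y\<in>K. n x y)"
      using K(1) that by (intro member_le_sum) auto
    also have "\<dots> \<le> (\<Sum>x\<in>K. \<Sum>y\<in>K. n x y)"
      using K(1) that by (intro member_le_sum[of x K "\<lambda>x. \<Sum>y\<in>K. n x y"]) auto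
    finally show ?thesis by (simp add: r_def)
  qed
  have "inj_on (label W r) K"
  proof (rule inj_onI)
    fix x y assume xy: "x \<in> K" "y \<in> K" "label W r x = label W r y"
    then have "(x \<in> W (n x y)) = (y \<in> W (n x y))"
      using nr by (simp add: label_eq_iff)
    then show "x = y" using n xy K(2) by blast
  qed
  then show ?thesis ..
qed

text \<open>A fibre has at least \<open>n\<close> points iff, for some \<open>r\<close>, at least
  \<open>n\<close> labels occur on it. That a given label occurs on the fibre of \<open>x\<close>
  means that \<open>x\<close> lies in the image of one Borel piece.\<close>

lemma fiber_card_measurable:
  assumes M: "standard_borel_space M" and W: "separating N W" and p: "p \<in> measurable M N"
    and S: "S \<in> sets M" and fin: "\<And>x. finite {z \<in> S. p z = x}"
  shows "(\<lambda>x. card {z \<in> S. p z = x}) \<in> measurable N (count_space UNIV)"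
proof (rule measurable_count_space_levels)
  fix n
  obtain V where V: "separating M V" using standard_borel_separating[OF M] .
  have SM: "S \<subseteq> space M" using S sets.sets_into_space by blast
  define cell where "cell r l = {z \<in> S. label V r z = l}" for r l
  have cell: "p ` cell r l \<in> sets N" for r l
  proof (rule finite_to_one_image_measurable[OF M W p])
    have "cell r l = S \<inter> (label V r -` {l} \<inter> space M)"
      using SM by (auto simp: cell_def)
    moreover have "label V r -` {l} \<inter> space M \<in> sets M"
      using V by (intro measurable_sets[OF label_measurable]) (auto simp: separating_def)
    ultimately show "cell r l \<in> sets M" using S by simp
    show "finite {z \<in> cell r l. p z = x}" for x
      by (rule finite_subset[OF _ fin[of x]]) (auto simp: cell_def)
  qed
  have "{x \<in> space N. n \<le> card {z \<in> S. p z = x}} =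
      (\<Union>r. \<Union>L\<in>{L. finite L \<and> card L = n}. space N \<inter> (\<Inter>l\<in>L. p ` cell r l))" (is "?A = ?B")
  proof (intro equalityI subsetI)
    fix x assume x: "x \<in> ?A"
    then obtain K where K: "K \<subseteq> {z \<in> S. p z = x}" "card K = n"
      by (metis (no_types, lifting) mem_Collect_eq obtain_subset_with_card_n)
    then have fK: "finite K" using fin finite_subset by blast
    moreover have "K \<subseteq> space M" using K(1) SM by blast
    ultimately obtain r where r: "inj_on (label V r) K"
      using label_inj_on[OF V] by blast
    have "x \<in> space N \<inter> (\<Inter>l\<in>label V r ` K. p ` cell r l)"
      using x K(1) by (force simp: cell_def)
    moreover have "finite (label V r ` K) \<and> card (label V r ` K) = n"
      using fK K(2) r by (simp add: card_image)
    ultimately show "x \<in> ?B" by blast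
  next
    fix x assume "x \<in> ?B"
    then obtain r L where L: "finite L" "card L = n" "x \<in> space N" "\<And>l. l \<in> L \<Longrightarrow> x \<in> p ` cell r l"
      by blast
    then have "L \<subseteq> label V r ` {z \<in> S. p z = x}"
      by (fastforce simp: cell_def)
    then have "n \<le> card (label V r ` {z \<in> S. p z = x})"
      using L(2) fin card_mono finite_imageI by metis
    also have "\<dots> \<le> card {z \<in> S. p z = x}" by (rule card_image_le[OF fin])
    finally show "x \<in> ?A" using L(3) by simp
  qed
  moreover have ctb: "countable {L :: nat set. finite L \<and> card L = n}"
    by (rule countable_subset[OF _ countable_Collect_finite]) auto
  moreover have fin_m: "space N \<inter> (\<Inter>l\<in>L. p ` cell r l) \<in> sets N" if "finite L" for r L
    using that cell by (cases "L = {}") (auto intro!: sets.Int sets.finite_INT)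
  have "(\<Union>L\<in>{L. finite L \<and> card L = n}. space N \<inter> (\<Inter>l\<in>L. p ` cell r l)) \<in> sets N" for r
    by (rule sets.countable_UN'[OF ctb]) (use fin_m in auto)
  then have "?B \<in> sets N" by (rule sets.countable_UN''[OF countableI_type])
  ultimately show "?A \<in> sets N" by simp
qed

text \<open>Layer-cake summation: the bounded weight of a point is the number of thresholds
  \<open>v < b\<close> below it, so the sum is a finite sum of fibre cardinalities.\<close>

lemma fiber_sum_measurable:
  fixes \<psi> :: "'a \<Rightarrow> nat"
  assumes M: "standard_borel_space M" and W: "separating N W" and p: "p \<in> measurable M N"
    and S: "S \<in> sets M" and fin: "\<And>x. finite {z \<in> S. p z = x}"
    and \<psi>: "\<psi> \<in> measurable M (count_space UNIV)" and b: "\<And>z. z \<in> S \<Longrightarrow> \<psi> z \<le> b"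
  shows "(\<lambda>x. \<Sum>z\<in>{z \<in> S. p z = x}. \<psi> z) \<in> measurable N (count_space UNIV)"
proof -
  define S' where "S' v = {z \<in> S. v < \<psi> z}" for v
  have SM: "S \<subseteq> space M" using S sets.sets_into_space by blast
  have "(\<Sum>z\<in>{z \<in> S. p z = x}. \<psi> z) = (\<Sum>v<b. card {z \<in> S' v. p z = x})" for x
  proof -
    have "(\<Sum>z\<in>{z \<in> S. p z = x}. \<psi> z) = (\<Sum>z\<in>{z \<in> S. p z = x}. \<Sum>v<b. of_bool (v < \<psi> z))"
    proof (rule sum.cong)
      fix z assume "z \<in> {z \<in> S. p z = x}"
      then have "{..<b} \<inter> {v. v < \<psi> z} = {..<\<psi> z}" using b by fastforce
      then show "\<psi> z = (\<Sum>v<b. of_bool (v < \<psi> z))" by simp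
    qed simp
    also have "\<dots> = (\<Sum>v<b. \<Sum>z\<in>{z \<in> S. p z = x}. of_bool (v < \<psi> z))"
      by (rule sum.swap)
    also have "\<dots> = (\<Sum>v<b. card {z \<in> S' v. p z = x})"
    proof (rule sum.cong)
      fix v
      have "{z \<in> S' v. p z = x} = {z \<in> S. p z = x} \<inter> {z. v < \<psi> z}" by (auto simp: S'_def)
      then show "(\<Sum>z\<in>{z \<in> S. p z = x}. of_bool (v < \<psi> z)) = card {z \<in> S' v. p z = x}"
        using fin[of x] by simp
    qed simp
    finally show ?thesis .
  qed
  moreover have "(\<lambda>x. \<Sum>v<b. card {z \<in> S' v. p z = x}) \<in> measurable N (count_space UNIV)"
  proof (intro measurable_count_space_sum fiber_card_measurable[OF M W p])
    fix v
    have "S' v = S \<inter> (\<psi> -` {v<..} \<inter> space M)"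
      using SM by (auto simp: S'_def)
    moreover have "\<psi> -` {v<..} \<inter> space M \<in> sets M"
      by (rule measurable_sets[OF \<psi>]) simp
    ultimately show "S' v \<in> sets M" using S by simp
    show "finite {z \<in> S' v. p z = x}" for x
      by (rule finite_subset[OF _ fin[of x]]) (auto simp: S'_def)
  qed
  ultimately show ?thesis by simp
qed

section \<open>Subspaces, countable multiples and injective images of standard Borel spaces\<close>

lemma standard_borel_restrict_space:
  assumes M: "standard_borel_space M" and S: "S \<in> sets M"
  shows "standard_borel_space (restrict_space M S)"
proof -
  obtain T where T: "polish_for M T" "openin T S"
    using polish_for_clopen_sequence[of M "\<lambda>_. S"] M S by metis
  have SM: "S \<subseteq> space M" using S sets.sets_into_space by blast
  have sp: "space M = topspace T" and st: "sets M = sigma_sets (space M) {U. openin T U}"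
    using T(1) by (simp_all add: polish_for_def)
  have "sets (restrict_space M S) = (\<inter>) S ` sigma_sets (space M) {U. openin T U}"
    using st by (simp add: sets_restrict_space)
  also have "\<dots> = sigma_sets S ((\<inter>) S ` {U. openin T U})"
    using S st SM by (intro sigma_sets_Int) auto
  also have "(\<inter>) S ` {U. openin T U} = {U. openin (subtopology T S) U}"
    by (auto simp: openin_subtopology)
  finally have "sets (restrict_space M S) = sigma_sets S {U. openin (subtopology T S) U}" .
  moreover have "completely_metrizable_space (subtopology T S)" "second_countable (subtopology T S)"
    using T completely_metrizable_space_openin second_countable_subtopology
    by (auto simp: polish_for_def polish_topology_def)
  moreover have "topspace (subtopology T S) = S" "space (restrict_space M S) = S"
    using SM sp by (auto simp: space_restrict_space)
  ultimately show ?thesis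
    unfolding standard_borel_space_def by metis
qed

lemma standard_borel_pair_count_space:
  assumes M: "standard_borel_space M"
  shows "standard_borel_space (M \<Otimes>\<^sub>M count_space (UNIV :: nat set))"
proof -
  obtain T where T: "polish_for M T"
    using M standard_borel_space_iff by blast
  define P where "P = prod_topology T (discrete_topology (UNIV :: nat set))"
  let ?N = "M \<Otimes>\<^sub>M count_space (UNIV :: nat set)"
  have sp: "space M = topspace T" and st: "sets M = sigma_sets (topspace T) {U. openin T U}"
    using T by (simp_all add: polish_for_def)
  have cm: "completely_metrizable_space P" and sc: "second_countable P"
    using T unfolding P_def
    by (auto simp: completely_metrizable_space_prod_topology polish_for_def polish_topology_def
        completely_metrizable_space_discrete_topology second_countable_discrete_topology
        intro!: second_countable_prod_topology)
  have tP: "topspace P = space ?N"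
    by (simp add: P_def sp space_pair_measure)
  have "U \<in> sets ?N" if U: "openin P U" for U
  proof -
    have "U = (\<Union>n. {x. (x, n) \<in> U} \<times> {n})" by auto
    moreover have "openin T {x. (x, n) \<in> U}" for n
    proof (subst openin_subopen, intro ballI)
      fix x assume "x \<in> {x. (x, n) \<in> U}"
      then obtain A B where "openin T A" "x \<in> A" "n \<in> B" "A \<times> B \<subseteq> U"
        using U unfolding P_def openin_prod_topology_alt by blast
      then show "\<exists>A. openin T A \<and> x \<in> A \<and> A \<subseteq> {x. (x, n) \<in> U}" by blast
    qed
    then have "{x. (x, n) \<in> U} \<times> {n} \<in> sets ?N" for n
      using st by (intro pair_measureI) auto
    then have "(\<Union>n. {x. (x, n) \<in> U} \<times> {n}) \<in> sets ?N" by blast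
    ultimately show ?thesis by simp
  qed
  then have sub1: "sigma_sets (topspace P) {U. openin P U} \<subseteq> sets ?N"
    unfolding tP by (intro sets.sigma_sets_subset) auto
  interpret P: sigma_algebra "topspace P" "sigma_sets (topspace P) {U. openin P U}"
    by (rule sigma_algebra_sigma_sets) (auto dest: openin_subset)
  have rect: "A \<times> {n} \<in> sigma_sets (topspace P) {U. openin P U}" if "A \<in> sets M" for A n
    using that unfolding st
  proof (induction A)
    case (Basic A)
    then show ?case
      by (intro sigma_sets.Basic) (simp add: P_def openin_prod_Times_iff)
  next
    case (Compl A)
    have "topspace T \<times> {n} \<in> sigma_sets (topspace P) {U. openin P U}"
      by (intro sigma_sets.Basic) (simp add: P_def openin_prod_Times_iff)
    moreover have "(topspace T - A) \<times> {n} = topspace T \<times> {n} - A \<times> {n}" by auto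
    ultimately show ?case
      using Compl.IH by (simp add: P.Diff)
  next
    case (Union A)
    have "(\<Union>i. A i) \<times> {n} = (\<Union>i. A i \<times> {n})" by auto
    then show ?case using Union.IH by (simp add: sigma_sets.Union)
  qed (simp add: sigma_sets.Empty)
  have "A \<times> B \<in> sigma_sets (topspace P) {U. openin P U}" if "A \<in> sets M" for A B
  proof -
    have "A \<times> B = (\<Union>n\<in>B. A \<times> {n})" by auto
    also have "\<dots> \<in> sigma_sets (topspace P) {U. openin P U}"
      by (rule sigma_sets_UNION) (use rect[OF that] in auto)
    finally show ?thesis .
  qed
  then have "sets ?N \<subseteq> sigma_sets (topspace P) {U. openin P U}"
    unfolding sets_pair_measure tP space_pair_measure[symmetric]
    by (intro sigma_sets_mono) auto
  then show ?thesis
    unfolding standard_borel_space_def using sub1 cm sc tP by (intro exI[of _ P]) auto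
qed

text \<open>Transport of Borel structure. For injective \<open>f\<close> the generators are already
  all Borel sets of the image, by \<open>sets_image_space_iff\<close>.\<close>

definition image_space :: "('a \<Rightarrow> 'b) \<Rightarrow> 'a measure \<Rightarrow> 'b measure" where
  "image_space f M = sigma (f ` space M) ((`) f ` sets M)"

lemma image_space_generators: "(`) f ` sets M \<subseteq> Pow (f ` space M)"
proof (rule image_subsetI, rule PowI)
  fix A assume "A \<in> sets M"
  then show "f ` A \<subseteq> f ` space M"
    by (intro image_mono sets.sets_into_space)
qed

lemma space_image_space [simp]: "space (image_space f M) = f ` space M"
  unfolding image_space_def by (rule space_measure_of[OF image_space_generators])

lemma image_space_generator: "f ` A \<in> sets (image_space f M)" if "A \<in> sets M"
  unfolding image_space_def sets_measure_of[OF image_space_generators]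
  using that by (intro sigma_sets.Basic imageI)

lemma measurable_image_space:
  assumes "inj_on f (space M)"
  shows "f \<in> measurable M (image_space f M)"
  unfolding image_space_def
proof (rule measurable_measure_of)
  show "(`) f ` sets M \<subseteq> Pow (f ` space M)"
    by (rule image_space_generators)
  show "f -` B \<inter> space M \<in> sets M" if B: "B \<in> (`) f ` sets M" for B
  proof -
    obtain A where A: "A \<in> sets M" "B = f ` A" using B by blast
    then have "f -` B \<inter> space M = A"
      using assms sets.sets_into_space[OF A(1)] by (auto dest: inj_onD)
    then show ?thesis using A by simp
  qed
qed auto

lemma sets_image_space_iff:
  assumes "inj_on f (space M)"
  shows "B \<in> sets (image_space f M) \<longleftrightarrow> (\<exists>A\<in>sets M. B = f ` A)"
proof
  assume B: "B \<in> sets (image_space f M)"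
  then have "f -` B \<inter> space M \<in> sets M"
    by (rule measurable_sets[OF measurable_image_space[OF assms]])
  moreover have "B = f ` (f -` B \<inter> space M)"
    using sets.sets_into_space[OF B] by auto
  ultimately show "\<exists>A\<in>sets M. B = f ` A" by blast
qed (use image_space_generator in auto)

text \<open>The image carries the pullback of a Polish topology along the inverse of
  \<open>f\<close>, which makes \<open>f\<close> a homeomorphism.\<close>

lemma standard_borel_image_space:
  assumes M: "standard_borel_space M" and f: "inj_on f (space M)"
  shows "standard_borel_space (image_space f M)"
proof -
  obtain T where T: "polish_for M T"
    using M standard_borel_space_iff by blast
  have sp: "space M = topspace T" and st: "sets M = sigma_sets (topspace T) {U. openin T U}"
    using T by (simp_all add: polish_for_def)
  define g where "g = inv_into (space M) f"
  have gf: "g (f x) = x" if "x \<in> space M" for x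
    using f that by (simp add: g_def)
  define P where "P = pullback_topology (f ` space M) g T"
  have gi: "g ` f ` space M = space M" using gf by force
  have ginj: "inj_on g (f ` space M)"
    by (rule inj_onI) (use gf in auto)
  have hs: "P homeomorphic_space T"
    unfolding P_def using homeomorphic_space_pullback[OF ginj, of T] gi sp by simp
  have tP: "topspace P = f ` space M"
    unfolding P_def topspace_pullback_topology using gf sp by auto
  have op: "openin P U \<longleftrightarrow> (\<exists>V. openin T V \<and> U = f ` V)" for U
  proof -
    have "g -` V \<inter> f ` space M = f ` V" if "openin T V" for V
      using openin_subset[OF that] gf sp by force
    then show ?thesis
      unfolding P_def openin_pullback_topology by metis
  qed
  have "second_countable P"
  proof -
    have "T homeomorphic_space P" using hs homeomorphic_space_sym by metis
    then obtain k where k: "homeomorphic_map T P k" unfolding homeomorphic_space ..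
    have k: "continuous_map T P k" "open_map T P k" "k ` topspace T = topspace P"
      using k unfolding homeomorphic_eq_everything_map by argo+
    have "second_countable T" using T by (simp add: polish_for_def polish_topology_def)
    with k show ?thesis by (rule second_countable_open_map_image)
  qed
  moreover have "completely_metrizable_space P"
    using T hs homeomorphic_completely_metrizable_space
    unfolding polish_for_def polish_topology_def by blast
  moreover have "sets (image_space f M) = sigma_sets (topspace P) {U. openin P U}"
  proof
    have im: "f ` A \<in> sigma_sets (topspace P) {U. openin P U}" if "A \<in> sets M" for A
      using that unfolding st
    proof (induction A)
      case (Basic A)
      then show ?case using op by (intro sigma_sets.Basic) auto
    next
      case (Compl A)
      have "A \<subseteq> space M"
        using Compl.hyps st sets.sets_into_space by blast
      then have "f ` (topspace T - A) = topspace P - f ` A"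
        using f unfolding tP sp by (simp add: inj_on_image_set_diff)
      then show ?case using Compl.IH by (simp add: sigma_sets.Compl)
    next
      case (Union A)
      then show ?case by (simp add: image_UN sigma_sets.Union)
    qed (simp add: sigma_sets.Empty)
    show "sets (image_space f M) \<subseteq> sigma_sets (topspace P) {U. openin P U}"
    proof
      fix B assume "B \<in> sets (image_space f M)"
      then obtain A where "A \<in> sets M" "B = f ` A" unfolding sets_image_space_iff[OF f] ..
      then show "B \<in> sigma_sets (topspace P) {U. openin P U}" using im by simp
    qed
    have "{U. openin P U} \<subseteq> sets (image_space f M)"
    proof
      fix U assume "U \<in> {U. openin P U}"
      then obtain V where V: "openin T V" "U = f ` V" using op by auto
      then have "V \<in> sets M" unfolding st by (intro sigma_sets.Basic) simp
      then show "U \<in> sets (image_space f M)" unfolding V(2) by (rule image_space_generator)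
    qed
    then show "sigma_sets (topspace P) {U. openin P U} \<subseteq> sets (image_space f M)"
      using sets.sigma_sets_subset[of _ "image_space f M"] by (simp add: tP)
  qed
  ultimately show ?thesis
    unfolding standard_borel_space_def by (intro exI[of _ P]) (simp_all add: tP)
qed

text \<open>A point is determined by its set of indices in a separating family, and sets of naturals
  inject into the reals. Injectivity suffices, because the Borel structure is transported by
  \<open>image_space\<close>.\<close>

lemma standard_borel_inj_real:
  assumes "standard_borel_space M"
  obtains f :: "'a \<Rightarrow> real" where "inj_on f (space M)"
proof -
  obtain W where W: "separating M W" using standard_borel_separating[OF assms] .
  obtain g :: "nat set \<Rightarrow> real" where g: "inj g"
    using nat_sets_lepoll_reals01 unfolding lepoll_def by blast
  have "inj_on (\<lambda>x. g {n. x \<in> W n}) (space M)"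
  proof (rule inj_onI)
    fix x y assume xy: "x \<in> space M" "y \<in> space M" "g {n. x \<in> W n} = g {n. y \<in> W n}"
    then have "{n. x \<in> W n} = {n. y \<in> W n}" using g by (simp add: inj_eq)
    then show "x = y" using W xy unfolding separating_def by blast
  qed
  then show ?thesis by (rule that)
qed

section \<open>Weighted matchings on finite and Borel graphs\<close>

text \<open>Induction after Halmos and Vaughan. If some nonempty proper \<open>J\<close> is tight,
  match \<open>J\<close> first and remove all its candidates from the rest, where tightness
  preserves the condition. If none is tight, there is a surplus of one everywhere, so any choice for
  a single index can be made.\<close>

theorem hall_marriage:
  fixes F :: "'i \<Rightarrow> 'b set"
  assumes "finite I" "\<And>i. i \<in> I \<Longrightarrow> finite (F i)"
    and "\<And>J. J \<subseteq> I \<Longrightarrow> card J \<le> card (\<Union>i\<in>J. F i)"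
  shows "\<exists>g. inj_on g I \<and> (\<forall>i\<in>I. g i \<in> F i)"
  using assms
proof (induction "card I" arbitrary: I F rule: less_induct)
  case less
  note fin = less.prems(1) and finF = less.prems(2) and H = less.prems(3)
  have finU: "finite (\<Union>i\<in>J. F i)" if "J \<subseteq> I" for J
    using that fin finF finite_subset by (metis finite_UN subsetD)
  show ?case
  proof (cases "\<exists>J. J \<subset> I \<and> J \<noteq> {} \<and> card (\<Union>i\<in>J. F i) = card J")
    case True
    then obtain J where J: "J \<subset> I" "J \<noteq> {}" "card (\<Union>i\<in>J. F i) = card J" by blast
    have JI: "J \<subseteq> I" using J by blast
    define F' where "F' i = F i - (\<Union>j\<in>J. F j)" for i
    have "card J < card I" using fin J by (simp add: psubset_card_mono)
    then have "\<exists>g. inj_on g J \<and> (\<forall>i\<in>J. g i \<in> F i)"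
      by (rule less.hyps) (use JI fin finF H finite_subset in auto)
    then obtain g where g: "inj_on g J" "\<And>i. i \<in> J \<Longrightarrow> g i \<in> F i" by blast
    have finJ: "finite J" using JI fin finite_subset by blast
    have "card (I - J) < card I"
      using fin J by (intro psubset_card_mono) auto
    then have "\<exists>g. inj_on g (I - J) \<and> (\<forall>i\<in>I - J. g i \<in> F' i)"
    proof (rule less.hyps)
      fix K assume K: "K \<subseteq> I - J"
      have finK: "finite K" using K fin finite_subset by (metis finite_Diff)
      have "card K + card J = card (K \<union> J)"
        using K finK finJ by (subst card_Un_disjoint) auto
      also have "\<dots> \<le> card (\<Union>i\<in>K \<union> J. F i)"
        by (rule H) (use K JI in blast)
      also have "(\<Union>i\<in>K \<union> J. F i) = (\<Union>i\<in>K. F' i) \<union> (\<Union>i\<in>J. F i)"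
        by (auto simp: F'_def)
      also have "card \<dots> \<le> card (\<Union>i\<in>K. F' i) + card (\<Union>i\<in>J. F i)"
        by (rule card_Un_le)
      finally show "card K \<le> card (\<Union>i\<in>K. F' i)" using J(3) by simp
    qed (use fin finF in \<open>auto simp: F'_def\<close>)
    then obtain g' where g': "inj_on g' (I - J)" "\<And>i. i \<in> I - J \<Longrightarrow> g' i \<in> F' i" by blast
    have "inj_on (\<lambda>i. if i \<in> J then g i else g' i) I"
    proof (rule inj_onI)
      fix i k assume ik: "i \<in> I" "k \<in> I" "(if i \<in> J then g i else g' i) = (if k \<in> J then g k else g' k)"
      have sep: "g i \<noteq> g' k" if "i \<in> J" "k \<in> I - J" for i k
        using g(2)[OF that(1)] g'(2)[OF that(2)] that by (auto simp: F'_def)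
      show "i = k"
        using ik g(1) g'(1) sep[of i k] sep[of k i] by (auto split: if_splits dest: inj_onD)
    qed
    moreover have "\<forall>i\<in>I. (if i \<in> J then g i else g' i) \<in> F i"
      using g(2) g'(2) by (auto simp: F'_def)
    ultimately show ?thesis by blast
  next
    case False
    show ?thesis
    proof (cases "I = {}")
      case True
      then show ?thesis by simp
    next
      case False': False
      then obtain i where i: "i \<in> I" by blast
      have "F i \<noteq> {}"
        using H[of "{i}"] i by auto
      then obtain y where y: "y \<in> F i" by blast
      define F' where "F' k = F k - {y}" for k
      have "card (I - {i}) < card I" using fin i by (simp add: card_gt_0_iff False')
      then have "\<exists>g. inj_on g (I - {i}) \<and> (\<forall>k\<in>I - {i}. g k \<in> F' k)"
      proof (rule less.hyps)
        fix K assume K: "K \<subseteq> I - {i}"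
        show "card K \<le> card (\<Union>k\<in>K. F' k)"
        proof (cases "K = {}")
          case False'': False
          have "K \<subset> I" using K i by blast
          then have "card (\<Union>k\<in>K. F k) \<noteq> card K" "card K \<le> card (\<Union>k\<in>K. F k)"
            using False False'' H by auto
          then have "card K \<le> card (\<Union>k\<in>K. F k) - 1" by simp
          also have "\<dots> \<le> card ((\<Union>k\<in>K. F k) - {y})"
            using finU[of K] \<open>K \<subset> I\<close> by (simp add: card_Diff_singleton_if)
          also have "(\<Union>k\<in>K. F k) - {y} = (\<Union>k\<in>K. F' k)" by (auto simp: F'_def)
          finally show ?thesis .
        qed simp
      qed (use fin finF in \<open>auto simp: F'_def\<close>)
      then obtain g where g: "inj_on g (I - {i})" "\<And>k. k \<in> I - {i} \<Longrightarrow> g k \<in> F' k" by blast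
      have "inj_on (g(i := y)) I"
      proof (rule inj_onI)
        fix j k assume jk: "j \<in> I" "k \<in> I" "(g(i := y)) j = (g(i := y)) k"
        have "g l \<noteq> y" if "l \<in> I" "l \<noteq> i" for l
          using g(2)[of l] that by (auto simp: F'_def)
        then show "j = k"
          using jk g(1) by (auto split: if_splits dest: inj_onD)
      qed
      moreover have "\<forall>k\<in>I. (g(i := y)) k \<in> F k"
        using g(2) y by (auto simp: F'_def)
      ultimately show ?thesis by blast
    qed
  qed
qed

lemma sum_card_fibers:
  assumes "finite I" "finite E" "\<And>q. q \<in> I \<Longrightarrow> h q \<in> E"
  shows "(\<Sum>e\<in>{e \<in> E. P e}. card {q \<in> I. h q = e}) = card {q \<in> I. P (h q)}"
proof -
  have "{q \<in> I. P (h q)} = (\<Union>e\<in>{e \<in> E. P e}. {q \<in> I. h q = e})"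
    using assms(3) by auto
  also have "card \<dots> = (\<Sum>e\<in>{e \<in> E. P e}. card {q \<in> I. h q = e})"
    using assms(1,2) by (subst card_UN_disjoint) auto
  finally show ?thesis by simp
qed

text \<open>Hall's theorem for \<open>a\<close> clones of every left end and \<open>b\<close> slots
  at every right end; the weight of an edge counts the clones that use it. A set of clones has at
  most \<open>a\<close> members over each left end, so the condition need only be known for sets of
  left ends.\<close>

lemma finite_weighted_matching:
  fixes \<alpha> :: "'e \<Rightarrow> 'v" and \<beta> :: "'e \<Rightarrow> 'w"
  assumes E: "finite E"
    and H: "\<And>S. S \<subseteq> \<alpha> ` E \<Longrightarrow> a * card S \<le> b * card (\<beta> ` {e \<in> E. \<alpha> e \<in> S})"
  shows "\<exists>\<psi> :: 'e \<Rightarrow> nat. (\<forall>x\<in>\<alpha> ` E. a \<le> (\<Sum>e\<in>{e \<in> E. \<alpha> e = x}. \<psi> e)) \<and>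
    (\<forall>y. (\<Sum>e\<in>{e \<in> E. \<beta> e = y}. \<psi> e) \<le> b)"
proof -
  define I where "I = \<alpha> ` E \<times> {..<a}"
  define F where "F q = \<beta> ` {e \<in> E. \<alpha> e = fst q} \<times> {..<b}" for q :: "'v \<times> nat"
  have fI: "finite I" using E by (simp add: I_def)
  have "\<exists>g. inj_on g I \<and> (\<forall>q\<in>I. g q \<in> F q)"
  proof (rule hall_marriage[OF fI])
    show "finite (F q)" for q using E by (simp add: F_def)
    fix J assume J: "J \<subseteq> I"
    have fJ: "finite J" using J fI finite_subset by blast
    have "card J \<le> card (fst ` J \<times> {..<a})"
      using J fJ by (intro card_mono) (force simp: I_def)+
    also have "\<dots> = a * card (fst ` J)" by (simp add: card_cartesian_product)
    also have "\<dots> \<le> b * card (\<beta> ` {e \<in> E. \<alpha> e \<in> fst ` J})"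
      by (rule H) (use J in \<open>auto simp: I_def\<close>)
    also have "\<dots> = card (\<beta> ` {e \<in> E. \<alpha> e \<in> fst ` J} \<times> {..<b})"
      by (simp add: card_cartesian_product)
    also have "\<beta> ` {e \<in> E. \<alpha> e \<in> fst ` J} \<times> {..<b} = (\<Union>q\<in>J. F q)"
      unfolding F_def by blast
    finally show "card J \<le> card (\<Union>q\<in>J. F q)" .
  qed
  then obtain g where g: "inj_on g I" "\<And>q. q \<in> I \<Longrightarrow> g q \<in> F q" by blast
  \<comment> \<open>The matching assigns slots only. Which of several parallel edges realizes the
    assignment is immaterial, as they share both ends.\<close>
  have "\<forall>q\<in>I. \<exists>e\<in>E. \<alpha> e = fst q \<and> \<beta> e = fst (g q)"
    using g(2) by (force simp: F_def)
  then obtain h where h: "\<And>q. q \<in> I \<Longrightarrow> h q \<in> E" "\<And>q. q \<in> I \<Longrightarrow> \<alpha> (h q) = fst q"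
      "\<And>q. q \<in> I \<Longrightarrow> \<beta> (h q) = fst (g q)"
    by metis
  define \<psi> where "\<psi> e = card {q \<in> I. h q = e}" for e
  have "a \<le> (\<Sum>e\<in>{e \<in> E. \<alpha> e = x}. \<psi> e)" if x: "x \<in> \<alpha> ` E" for x
  proof -
    have "{q \<in> I. \<alpha> (h q) = x} = {x} \<times> {..<a}"
      using x h(2) by (auto simp: I_def)
    then show ?thesis
      unfolding \<psi>_def by (subst sum_card_fibers[OF fI E h(1)]) (simp_all add: card_cartesian_product)
  qed
  moreover have "(\<Sum>e\<in>{e \<in> E. \<beta> e = y}. \<psi> e) \<le> b" for y
  proof -
    have "card {q \<in> I. \<beta> (h q) = y} = card (g ` {q \<in> I. \<beta> (h q) = y})"
      by (rule card_image[symmetric]) (rule inj_on_subset[OF g(1)], auto)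
    also have "\<dots> \<le> card ({y} \<times> {..<b})"
    proof (rule card_mono)
      show "g ` {q \<in> I. \<beta> (h q) = y} \<subseteq> {y} \<times> {..<b}"
        using g(2) h(3) by (force simp: F_def)
    qed simp
    finally show ?thesis
      unfolding \<psi>_def by (subst sum_card_fibers[OF fI E h(1)]) (simp_all add: card_cartesian_product)
  qed
  ultimately show ?thesis by blast
qed

section \<open>Borel choice of weights on edge sets with finite components\<close>

locale borel_edges =
  fixes N :: "'e measure" and M :: "'v measure" and \<alpha> \<beta> :: "'e \<Rightarrow> 'v"
  assumes standard_edges: "standard_borel_space N" and standard_verts: "standard_borel_space M"
    and \<alpha>: "\<alpha> \<in> measurable N M" and \<beta>: "\<beta> \<in> measurable N M"
    and finite_\<alpha>: "\<And>x. finite {e \<in> space N. \<alpha> e = x}"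
    and finite_\<beta>: "\<And>y. finite {e \<in> space N. \<beta> e = y}"
begin

lemma finite_fiber:
  assumes "p = \<alpha> \<or> p = \<beta>" "Q \<in> sets N"
  shows "finite {e \<in> Q. p e = x}"
proof -
  have "{e \<in> Q. p e = x} \<subseteq> {e \<in> space N. p e = x}"
    using sets.sets_into_space[OF assms(2)] by auto
  then show ?thesis
    using finite_\<alpha> finite_\<beta> assms(1) finite_subset by metis
qed

lemma image_measurable:
  assumes "p = \<alpha> \<or> p = \<beta>" "Q \<in> sets N"
  shows "p ` Q \<in> sets M"
proof -
  obtain W where "separating M W" using standard_borel_separating[OF standard_verts] .
  then show ?thesis
    using finite_to_one_image_measurable[OF standard_edges _ _ assms(2) finite_fiber[OF assms]]
      \<alpha> \<beta> assms(1) by blast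
qed

lemma saturation_measurable:
  assumes "p = \<alpha> \<or> p = \<beta>" "Q \<in> sets N"
  shows "{e \<in> space N. p e \<in> p ` Q} \<in> sets N"
proof -
  have "p \<in> measurable N M" using assms(1) \<alpha> \<beta> by blast
  then have "p -` (p ` Q) \<inter> space N \<in> sets N"
    by (rule measurable_sets[OF _ image_measurable[OF assms]])
  moreover have "p -` (p ` Q) \<inter> space N = {e \<in> space N. p e \<in> p ` Q}" by blast
  ultimately show ?thesis by simp
qed

text \<open>The line graph on \<open>E\<close>, with loops. Its components, the classes of
  \<open>meet_class\<close>, are the pieces into which the matching problem splits.\<close>

definition meet :: "'e set \<Rightarrow> ('e \<times> 'e) set" where
  "meet E = {(e, f). e \<in> E \<and> f \<in> E \<and> (\<alpha> e = \<alpha> f \<or> \<beta> e = \<beta> f)}"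

definition meet_class :: "'e set \<Rightarrow> 'e \<Rightarrow> 'e set" where
  "meet_class E e = {f. (e, f) \<in> (meet E)\<^sup>*}"

lemma meet_sym: "sym ((meet E)\<^sup>*)"
  by (rule sym_rtrancl) (auto simp: meet_def sym_def)

lemma meet_class_subset: "e \<in> E \<Longrightarrow> meet_class E e \<subseteq> E"
  by (auto simp: meet_class_def meet_def elim: rtranclE)

lemma meet_class_eq: "(e, f) \<in> meet E \<Longrightarrow> meet_class E e = meet_class E f"
  unfolding meet_class_def using meet_sym[of E]
  by (metis (no_types, lifting) r_into_rtrancl rtrancl_trans symE Collect_cong)

text \<open>The saturation is the union of the iterates of one step, passing to all edges of
  \<open>E\<close> that share an end with the current set. A step preserves Borel sets because both
  endpoint maps are finite-to-one.\<close>

lemma meet_class_saturation_measurable: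
  assumes E: "E \<in> sets N" and Q: "Q \<in> sets N" "Q \<subseteq> E"
  shows "{e \<in> E. meet_class E e \<inter> Q \<noteq> {}} \<in> sets N"
proof -
  define S where "S R = E \<inter> ({e \<in> space N. \<alpha> e \<in> \<alpha> ` R} \<union> {e \<in> space N. \<beta> e \<in> \<beta> ` R})" for R
  have Sm: "(S ^^ n) Q \<in> sets N" for n
  proof (induction n)
    case (Suc n)
    then show ?case
      unfolding funpow.simps comp_def S_def using E saturation_measurable by simp
  qed (use Q in simp)
  have step: "(S ^^ n) Q \<subseteq> E \<and> (\<forall>e\<in>(S ^^ n) Q. \<exists>f\<in>Q. (f, e) \<in> (meet E)\<^sup>*)" for n
  proof (induction n)
    case (Suc n)
    show ?case
    proof (intro conjI ballI)
      show "(S ^^ Suc n) Q \<subseteq> E" by (auto simp: S_def)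
      fix e assume e: "e \<in> (S ^^ Suc n) Q"
      then obtain e' where e': "e' \<in> (S ^^ n) Q" "e \<in> E" "\<alpha> e = \<alpha> e' \<or> \<beta> e = \<beta> e'"
        by (auto simp: S_def)
      then have "(e', e) \<in> meet E" using Suc by (auto simp: meet_def)
      then show "\<exists>f\<in>Q. (f, e) \<in> (meet E)\<^sup>*"
        using Suc e'(1) by (meson rtrancl.rtrancl_into_rtrancl)
    qed
  qed (use Q in auto)
  have reach: "\<exists>n. e \<in> (S ^^ n) Q" if "(f, e) \<in> (meet E)\<^sup>*" "f \<in> Q" for e f
    using that
  proof (induction rule: rtrancl_induct)
    case base
    then show ?case by (intro exI[of _ 0]) simp
  next
    case (step e e')
    then obtain n where n: "e \<in> (S ^^ n) Q" by blast
    have "\<alpha> e' \<in> \<alpha> ` (S ^^ n) Q \<or> \<beta> e' \<in> \<beta> ` (S ^^ n) Q"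
      using n step.hyps(2) unfolding meet_def by (metis (mono_tags, lifting) case_prodD image_eqI mem_Collect_eq)
    moreover have "e' \<in> E" using step.hyps(2) by (simp add: meet_def)
    ultimately have "e' \<in> (S ^^ Suc n) Q"
      using sets.sets_into_space[OF E] by (auto simp: S_def)
    then show ?case by blast
  qed
  have "{e \<in> E. meet_class E e \<inter> Q \<noteq> {}} = (\<Union>n. (S ^^ n) Q)"
  proof (intro equalityI subsetI)
    fix e assume "e \<in> {e \<in> E. meet_class E e \<inter> Q \<noteq> {}}"
    then obtain f where "f \<in> Q" "(e, f) \<in> (meet E)\<^sup>*" by (auto simp: meet_class_def)
    then show "e \<in> (\<Union>n. (S ^^ n) Q)"
      using reach meet_sym[of E] by (auto dest: symD)
  next
    fix e assume "e \<in> (\<Union>n. (S ^^ n) Q)"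
    then obtain n where "e \<in> (S ^^ n) Q" by blast
    then obtain f where "e \<in> E" "f \<in> Q" "(f, e) \<in> (meet E)\<^sup>*" using step[of n] by blast
    then show "e \<in> {e \<in> E. meet_class E e \<inter> Q \<noteq> {}}"
      using meet_sym[of E] by (auto simp: meet_class_def dest: symD)
  qed
  then show ?thesis using Sm by auto
qed

text \<open>
  A finite class is separated by finitely many labels, so every function on it is one of countably
  many Borel functions; the first one that solves the matching problem on the class is a Borel choice.
\<close>

lemma borel_weighted_matching:
  assumes E: "E \<in> sets N" and fin: "\<And>e. e \<in> E \<Longrightarrow> finite (meet_class E e)"
    and H: "\<And>S. finite S \<Longrightarrow> S \<subseteq> \<alpha> ` E \<Longrightarrow> a * card S \<le> b * card (\<beta> ` {e \<in> E. \<alpha> e \<in> S})"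
  obtains \<phi> :: "'e \<Rightarrow> nat" where "\<phi> \<in> measurable N (count_space UNIV)"
    "\<And>x. x \<in> \<alpha> ` E \<Longrightarrow> a \<le> (\<Sum>e\<in>{e \<in> E. \<alpha> e = x}. \<phi> e)"
    "\<And>y. (\<Sum>e\<in>{e \<in> E. \<beta> e = y}. \<phi> e) \<le> b"
proof -
  obtain W where W: "separating M W" using standard_borel_separating[OF standard_verts] .
  obtain V where V: "separating N V" using standard_borel_separating[OF standard_edges] .
  have EN: "E \<subseteq> space N" using E sets.sets_into_space by blast
  \<comment> \<open>The \<open>j\<close>-th candidate: \<open>j\<close> codes a number
    \<open>r\<close> of label bits and a table \<open>l\<close> of values indexed by labels. Entries
    beyond the table are 0, and the cap \<open>b\<close> supplies the bound required for measurable
    fibre sums.\<close>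
  define \<psi> :: "nat \<Rightarrow> 'e \<Rightarrow> nat" where "\<psi> j e = (let (r, l) = from_nat j; n = label V r e
    in if n < length l then min b (l ! n) else 0)" for j e
  have \<psi>m: "\<psi> j \<in> measurable N (count_space UNIV)" for j
  proof -
    have "label V (fst (from_nat j :: nat \<times> nat list)) \<in> measurable N (count_space UNIV)"
      using V by (intro label_measurable) (simp add: separating_def)
    from measurable_compose[OF this, of "\<lambda>n. let l = snd (from_nat j :: nat \<times> nat list)
        in if n < length l then min b (l ! n) else 0" "count_space UNIV"]
    show ?thesis by (simp add: \<psi>_def[abs_def] case_prod_beta Let_def)
  qed
  have \<psi>b: "\<psi> j e \<le> b" for j e
    by (simp add: \<psi>_def case_prod_beta Let_def)
  define sumA where "sumA j x = (\<Sum>e\<in>{e \<in> E. \<alpha> e = x}. \<psi> j e)" for j x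
  define sumB where "sumB j y = (\<Sum>e\<in>{e \<in> E. \<beta> e = y}. \<psi> j e)" for j y
  have "sumA j \<in> measurable M (count_space UNIV)" for j
    unfolding sumA_def[abs_def] using finite_fiber E \<psi>b
    by (intro fiber_sum_measurable[OF standard_edges W \<alpha> E _ \<psi>m]) auto
  from measurable_compose[OF \<alpha> this]
  have sA: "(\<lambda>e. sumA j (\<alpha> e)) \<in> measurable N (count_space UNIV)" for j .
  have "sumB j \<in> measurable M (count_space UNIV)" for j
    unfolding sumB_def[abs_def] using finite_fiber E \<psi>b
    by (intro fiber_sum_measurable[OF standard_edges W \<beta> E _ \<psi>m]) auto
  from measurable_compose[OF \<beta> this]
  have sB: "(\<lambda>e. sumB j (\<beta> e)) \<in> measurable N (count_space UNIV)" for j .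
  define ok where "ok j e \<longleftrightarrow> a \<le> sumA j (\<alpha> e) \<and> sumB j (\<beta> e) \<le> b" for j e
  define Bad where "Bad j = {e \<in> E. \<not> ok j e}" for j
  have Bad: "Bad j \<in> sets N" for j
  proof -
    have "Bad j = E - ((\<lambda>e. sumA j (\<alpha> e)) -` {a..} \<inter> space N \<inter> ((\<lambda>e. sumB j (\<beta> e)) -` {..b} \<inter> space N))"
      using EN by (auto simp: Bad_def ok_def)
    also have "\<dots> \<in> sets N"
      by (rule sets.Diff[OF E sets.Int]) (rule measurable_sets[OF sA] measurable_sets[OF sB], simp)+
    finally show ?thesis .
  qed
  \<comment> \<open>Candidate \<open>j\<close> solves the problem on the whole class of
    \<open>e\<close>. This is a Borel condition, since its failure is the saturation of
    \<open>Bad j\<close>.\<close>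
  define free where "free j e \<longleftrightarrow> meet_class E e \<inter> Bad j = {}" for j e
  have free_ex: "\<exists>j. free j e" if e: "e \<in> E" for e
  proof -
    define C where "C = meet_class E e"
    have C: "finite C" "C \<subseteq> E" using fin[OF e] meet_class_subset[OF e] by (auto simp: C_def)
    \<comment> \<open>All edges of \<open>E\<close> at an end of an edge of \<open>C\<close> belong
      to \<open>C\<close>, so the finite problem on \<open>C\<close> inherits the condition
      \<open>H\<close> and has the same vertex sums as \<open>E\<close>.\<close>
    have closed: "f' \<in> C" if "f \<in> C" "f' \<in> E" "\<alpha> f = \<alpha> f' \<or> \<beta> f = \<beta> f'" for f f'
    proof -
      have "(f, f') \<in> meet E" using that C by (auto simp: meet_def)
      then show ?thesis
        using that(1) by (auto simp: C_def meet_class_def)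
    qed
    have "\<exists>\<psi>0 :: 'e \<Rightarrow> nat. (\<forall>x\<in>\<alpha> ` C. a \<le> (\<Sum>f\<in>{f \<in> C. \<alpha> f = x}. \<psi>0 f)) \<and>
        (\<forall>y. (\<Sum>f\<in>{f \<in> C. \<beta> f = y}. \<psi>0 f) \<le> b)"
    proof (rule finite_weighted_matching[OF C(1)])
      fix S assume S: "S \<subseteq> \<alpha> ` C"
      have "f \<in> C" if f: "f \<in> E" "\<alpha> f \<in> S" for f
      proof -
        obtain f' where "f' \<in> C" "\<alpha> f = \<alpha> f'" using S f(2) by blast
        then show ?thesis using closed[of f' f] f(1) by simp
      qed
      then have "{f \<in> C. \<alpha> f \<in> S} = {f \<in> E. \<alpha> f \<in> S}"
        using C(2) by blast
      moreover have "finite S"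
        by (rule finite_subset[OF S]) (use C(1) in simp)
      moreover have "S \<subseteq> \<alpha> ` E"
        using S C(2) by blast
      ultimately show "a * card S \<le> b * card (\<beta> ` {f \<in> C. \<alpha> f \<in> S})"
        using H by simp
    qed
    then obtain \<psi>0 :: "'e \<Rightarrow> nat" where \<psi>0: "\<And>x. x \<in> \<alpha> ` C \<Longrightarrow> a \<le> (\<Sum>f\<in>{f \<in> C. \<alpha> f = x}. \<psi>0 f)"
        "\<And>y. (\<Sum>f\<in>{f \<in> C. \<beta> f = y}. \<psi>0 f) \<le> b"
      by metis
    \<comment> \<open>A single weight is at most its vertex sum, so the cap \<open>b\<close> in the
      candidates does not alter the solution.\<close>
    have \<psi>0b: "\<psi>0 f \<le> b" if "f \<in> C" for f
    proof -
      have "\<psi>0 f \<le> (\<Sum>f'\<in>{f' \<in> C. \<beta> f' = \<beta> f}. \<psi>0 f')"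
        using C(1) that by (intro member_le_sum) auto
      then show ?thesis using \<psi>0(2) order_trans by blast
    qed
    obtain r where r: "inj_on (label V r) C"
      using label_inj_on[OF V C(1)] C(2) EN by blast
    \<comment> \<open>The sum of all labels on \<open>C\<close> bounds each of them, so the table is
      long enough.\<close>
    define l where "l = map (\<lambda>n. \<psi>0 (the_inv_into C (label V r) n)) [0..<Suc (\<Sum>f\<in>C. label V r f)]"
    define j where "j = to_nat (r, l)"
    have \<psi>j: "\<psi> j f = \<psi>0 f" if f: "f \<in> C" for f
    proof -
      have lt: "label V r f < Suc (\<Sum>f\<in>C. label V r f)"
        using C(1) f by (simp add: less_Suc_eq_le member_le_sum)
      then have "l ! label V r f = \<psi>0 f"
        unfolding l_def using r f by (simp add: the_inv_into_f_f del: upt_Suc)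
      moreover have "label V r f < length l" using lt by (simp add: l_def)
      ultimately show ?thesis
        using \<psi>0b[OF f] by (simp add: \<psi>_def j_def Let_def)
    qed
    have "ok j f" if f: "f \<in> C" for f
    proof -
      have "{f' \<in> E. \<alpha> f' = \<alpha> f} = {f' \<in> C. \<alpha> f' = \<alpha> f}" "{f' \<in> E. \<beta> f' = \<beta> f} = {f' \<in> C. \<beta> f' = \<beta> f}"
        using closed[OF f] C(2) by auto
      then have "sumA j (\<alpha> f) = (\<Sum>f'\<in>{f' \<in> C. \<alpha> f' = \<alpha> f}. \<psi>0 f')"
          "sumB j (\<beta> f) = (\<Sum>f'\<in>{f' \<in> C. \<beta> f' = \<beta> f}. \<psi>0 f')"
        unfolding sumA_def sumB_def by (auto intro!: sum.cong simp: \<psi>j)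
      then show ?thesis
        using \<psi>0 f by (simp add: ok_def)
    qed
    then have "free j e" by (auto simp: free_def Bad_def C_def[symmetric])
    then show ?thesis ..
  qed
  \<comment> \<open>The disjunct \<open>e \<notin> E\<close> keeps the minimum well defined on all
    edges.\<close>
  define J where "J e = (LEAST j. e \<notin> E \<or> free j e)" for e
  have J: "free (J e) e" if "e \<in> E" for e
    using LeastI_ex[of "\<lambda>j. e \<notin> E \<or> free j e"] free_ex[OF that] that by (auto simp: J_def)
  have Jm: "J \<in> measurable N (count_space UNIV)"
    unfolding J_def[abs_def]
  proof (rule measurable_Least)
    fix j
    have "{e \<in> space N. e \<notin> E \<or> free j e} = space N - {e \<in> E. meet_class E e \<inter> Bad j \<noteq> {}}"
      using EN by (auto simp: free_def)
    moreover have "{e \<in> E. meet_class E e \<inter> Bad j \<noteq> {}} \<in> sets N"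
      by (rule meet_class_saturation_measurable[OF E Bad]) (auto simp: Bad_def)
    ultimately show "(\<lambda>e. e \<notin> E \<or> free j e) \<in> measurable N (count_space UNIV)"
      by (simp add: pred_def)
  qed
  \<comment> \<open>The selected candidate is constant on classes, so all edges at a vertex use the
    same one and the vertex sums of \<open>\<phi>\<close> are those of that candidate.\<close>
  have J_eq: "J f = J e" if "e \<in> E" "f \<in> E" "\<alpha> f = \<alpha> e \<or> \<beta> f = \<beta> e" for e f
  proof -
    have "(f, e) \<in> meet E" using that by (auto simp: meet_def)
    then have "free j f = free j e" for j unfolding free_def by (simp add: meet_class_eq)
    then show ?thesis using that by (simp add: J_def)
  qed
  define \<phi> where "\<phi> e = \<psi> (J e) e" for e
  have okJ: "ok (J e) e" if "e \<in> E" for e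
  proof -
    have "e \<in> meet_class E e" by (simp add: meet_class_def)
    then show ?thesis using J[OF that] that by (auto simp: free_def Bad_def)
  qed
  have "\<phi> \<in> measurable N (count_space UNIV)"
    unfolding \<phi>_def[abs_def] by (rule measurable_compose_countable[OF \<psi>m Jm])
  moreover have "a \<le> (\<Sum>e\<in>{e \<in> E. \<alpha> e = x}. \<phi> e)" if x: "x \<in> \<alpha> ` E" for x
  proof -
    obtain e where e: "e \<in> E" "x = \<alpha> e" using x by blast
    have "(\<Sum>e\<in>{e \<in> E. \<alpha> e = x}. \<phi> e) = sumA (J e) x"
      unfolding sumA_def \<phi>_def using J_eq[OF e(1)] e(2) by (intro sum.cong) auto
    then show ?thesis using okJ[OF e(1)] e(2) by (simp add: ok_def)
  qed
  moreover have "(\<Sum>e\<in>{e \<in> E. \<beta> e = y}. \<phi> e) \<le> b" for y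
  proof (cases "y \<in> \<beta> ` E")
    case True
    then obtain e where e: "e \<in> E" "y = \<beta> e" by blast
    have "(\<Sum>e\<in>{e \<in> E. \<beta> e = y}. \<phi> e) = sumB (J e) y"
      unfolding sumB_def \<phi>_def using J_eq[OF e(1)] e(2) by (intro sum.cong) auto
    then show ?thesis using okJ[OF e(1)] e(2) by (simp add: ok_def)
  next
    case False
    then have none: "{e \<in> E. \<beta> e = y} = {}" by auto
    show ?thesis unfolding none by simp
  qed
  ultimately show ?thesis by (rule that)
qed

end

section \<open>Neighbourhoods and a partition of unity\<close>

text \<open>Off the diagonal, two points are told apart by some \<open>W n\<close>, which gives
  countably many rectangles. With this, \<open>sets_pair_space\<close> describes the Borel sets of
  unordered pairs explicitly.\<close>

lemma diagonal_measurable: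
  assumes "standard_borel_space M"
  shows "{(x, x) | x. x \<in> space M} \<in> sets (M \<Otimes>\<^sub>M M)"
proof -
  obtain W where W: "separating M W" using standard_borel_separating[OF assms] .
  define Q where "Q n = W n \<times> (space M - W n) \<union> (space M - W n) \<times> W n" for n
  have Wm: "W n \<in> sets M" for n using W by (simp add: separating_def)
  then have Q: "Q n \<in> sets (M \<Otimes>\<^sub>M M)" for n
    unfolding Q_def by (intro sets.Un pair_measureI) auto
  have "{(x, x) | x. x \<in> space M} = space (M \<Otimes>\<^sub>M M) - (\<Union>n. Q n)"
  proof (intro equalityI subsetI)
    fix z assume z: "z \<in> space (M \<Otimes>\<^sub>M M) - (\<Union>n. Q n)"
    then obtain x y where xy: "z = (x, y)" "x \<in> space M" "y \<in> space M"
      by (auto simp: space_pair_measure)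
    then have "\<forall>n. x \<in> W n \<longleftrightarrow> y \<in> W n"
      using z by (auto simp: Q_def)
    then show "z \<in> {(x, x) | x. x \<in> space M}"
      using W xy unfolding separating_def by blast
  qed (auto simp: space_pair_measure Q_def)
  moreover have "(\<Union>n. Q n) \<in> sets (M \<Otimes>\<^sub>M M)" using Q by blast
  ultimately show ?thesis by simp
qed

section \<open>Distances, powers and neighbourhoods in the underlying simple graph\<close>

lemma graph_power_iff: "(x, y) \<in> graph_power R k \<longleftrightarrow> x \<noteq> y \<and> (\<exists>n\<le>k. (x, y) \<in> R ^^ n)"
proof -
  define D where "D = {enat n | n. (x, y) \<in> R ^^ n}"
  have gd: "graph_dist R x y = Inf D" by (simp add: graph_dist_def D_def)
  have "0 < Inf D \<longleftrightarrow> x \<noteq> y"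
  proof
    assume "0 < Inf D"
    then have "0 \<notin> D" using Inf_lower[of 0 D] by auto
    then show "x \<noteq> y" by (auto simp: D_def zero_enat_def)
  next
    assume ne: "x \<noteq> y"
    have "1 \<le> Inf D"
    proof (rule Inf_greatest)
      fix d assume "d \<in> D"
      then obtain n where n: "d = enat n" "(x, y) \<in> R ^^ n" by (auto simp: D_def)
      then have "n \<noteq> 0" using ne by (cases n) auto
      then show "1 \<le> d" using n by (simp add: one_enat_def)
    qed
    then show "0 < Inf D" by (rule less_le_trans[rotated]) simp
  qed
  moreover have "Inf D \<le> enat k \<longleftrightarrow> (\<exists>n\<le>k. (x, y) \<in> R ^^ n)"
  proof
    assume le: "Inf D \<le> enat k"
    then have ne: "D \<noteq> {}" by (auto simp: Inf_enat_def)
    then obtain d where d: "d \<in> D" by blast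
    have "Inf D = (LEAST x. x \<in> D)" using ne by (simp add: Inf_enat_def)
    then have "Inf D \<in> D" using LeastI[of "\<lambda>x. x \<in> D", OF d] by simp
    then show "\<exists>n\<le>k. (x, y) \<in> R ^^ n" using le by (auto simp: D_def)
  next
    assume "\<exists>n\<le>k. (x, y) \<in> R ^^ n"
    then obtain n where "n \<le> k" "enat n \<in> D" by (auto simp: D_def)
    then show "Inf D \<le> enat k" by (meson Inf_lower enat_ord_simps(1) order_trans)
  qed
  ultimately show ?thesis by (simp add: graph_power_def gd)
qed

text \<open>The ball of radius \<open>t\<close> around \<open>X\<close>, written as an iteration so
  that Borelness and finiteness go by induction; \<open>nbhd_iff\<close> recovers the description by
  walks.\<close>

definition nbhd :: "('v, 'e) multigraph \<Rightarrow> nat \<Rightarrow> 'v set \<Rightarrow> 'v set" where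
  "nbhd G t X = ((\<lambda>S. S \<union> neighbors G S) ^^ t) X"

lemma nbhd_0 [simp]: "nbhd G 0 X = X"
  and nbhd_Suc: "nbhd G (Suc t) X = nbhd G t X \<union> neighbors G (nbhd G t X)"
  by (simp_all add: nbhd_def)

lemma nbhd_iff: "y \<in> nbhd G t X \<longleftrightarrow> (\<exists>x\<in>X. \<exists>n\<le>t. (x, y) \<in> adjacency G ^^ n)"
proof (induction t arbitrary: y)
  case (Suc t)
  show ?case
  proof
    assume "y \<in> nbhd G (Suc t) X"
    then consider "y \<in> nbhd G t X" | z where "z \<in> nbhd G t X" "(z, y) \<in> adjacency G"
      by (auto simp: nbhd_Suc neighbors_def)
    then show "\<exists>x\<in>X. \<exists>n\<le>Suc t. (x, y) \<in> adjacency G ^^ n"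
    proof cases
      case 1
      then show ?thesis using Suc by (meson le_SucI)
    next
      case 2
      then obtain x n where "x \<in> X" "n \<le> t" "(x, z) \<in> adjacency G ^^ n" using Suc by blast
      then show ?thesis using 2(2) by (intro bexI[of _ x] exI[of _ "Suc n"]) auto
    qed
  next
    assume "\<exists>x\<in>X. \<exists>n\<le>Suc t. (x, y) \<in> adjacency G ^^ n"
    then obtain x n where xn: "x \<in> X" "n \<le> Suc t" "(x, y) \<in> adjacency G ^^ n" by blast
    show "y \<in> nbhd G (Suc t) X"
    proof (cases "n \<le> t")
      case True
      then show ?thesis using xn Suc by (auto simp: nbhd_Suc)
    next
      case False
      then have "n = Suc t" using xn by simp
      then obtain z where "(x, z) \<in> adjacency G ^^ t" "(z, y) \<in> adjacency G" using xn by auto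
      then have "z \<in> nbhd G t X" using xn(1) Suc by blast
      then show ?thesis using \<open>(z, y) \<in> adjacency G\<close> by (auto simp: nbhd_Suc neighbors_def)
    qed
  qed
qed simp

lemma nbhd_mono: "s \<le> t \<Longrightarrow> nbhd G s X \<subseteq> nbhd G t X"
  unfolding nbhd_iff subset_iff by (meson order_trans)

lemma nbhd_adjacent: "x \<in> nbhd G t X \<Longrightarrow> (x, y) \<in> adjacency G \<Longrightarrow> y \<in> nbhd G (Suc t) X"
  by (auto simp: nbhd_Suc neighbors_def)

lemma adjacency_pow_sym: "(x, y) \<in> adjacency G ^^ n \<Longrightarrow> (y, x) \<in> adjacency G ^^ n"
proof (induction n arbitrary: y)
  case (Suc n)
  then obtain z where "(x, z) \<in> adjacency G ^^ n" "(z, y) \<in> adjacency G" by auto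
  moreover have "(y, z) \<in> adjacency G"
    using calculation(2) by (auto simp: adjacency_def insert_commute)
  ultimately show ?case using Suc.IH by (meson relpow_Suc_I2)
qed simp

section \<open>The endpoint maps of a bipartite Borel graph\<close>

locale bipartite_borel_graph =
  fixes G :: "('v, 'e) multigraph" and A B :: "'v set"
  assumes borel: "borel_graph G" and locally_finite: "locally_finite G"
    and bipartition: "borel_bipartition G A B"
begin

definition \<alpha> :: "'e \<Rightarrow> 'v" where "\<alpha> e = (SOME x. x \<in> A \<inter> ends G e)"
definition \<beta> :: "'e \<Rightarrow> 'v" where "\<beta> e = (SOME y. y \<in> B \<inter> ends G e)"

lemma standard: "standard_borel_space (verts G)" "standard_borel_space (edges G)"
  using borel by (simp_all add: borel_graph_def)

lemma parts: "A \<in> sets (verts G)" "B \<in> sets (verts G)" "A \<union> B = space (verts G)" "A \<inter> B = {}"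
  using bipartition by (simp_all add: borel_bipartition_def bipartition_def)

lemma ends: 
  assumes "e \<in> space (edges G)"
  shows "\<alpha> e \<in> A" "\<beta> e \<in> B" "ends G e = {\<alpha> e, \<beta> e}" "\<alpha> e \<noteq> \<beta> e"
proof -
  obtain x y where xy: "x \<in> A" "y \<in> B" "ends G e = {x, y}"
    using bipartition assms by (auto simp: borel_bipartition_def bipartition_def)
  then have "A \<inter> ends G e = {x}" "B \<inter> ends G e = {y}"
    using parts(4) by auto
  then have "\<alpha> e = x" "\<beta> e = y" by (simp_all add: \<alpha>_def \<beta>_def)
  then show "\<alpha> e \<in> A" "\<beta> e \<in> B" "ends G e = {\<alpha> e, \<beta> e}" "\<alpha> e \<noteq> \<beta> e"
    using xy parts(4) by auto
qed

lemma ends_space: "e \<in> space (edges G) \<Longrightarrow> \<alpha> e \<in> space (verts G) \<and> \<beta> e \<in> space (verts G)"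
  using ends parts(3) by blast

lemma incident_edges_iff:
  "incident_edges G x = {e \<in> space (edges G). \<alpha> e = x} \<union> {e \<in> space (edges G). \<beta> e = x}"
  using ends(3) by (auto simp: incident_edges_def)

lemma incident_edges_A: "x \<in> A \<Longrightarrow> incident_edges G x = {e \<in> space (edges G). \<alpha> e = x}"
  and incident_edges_B: "y \<in> B \<Longrightarrow> incident_edges G y = {e \<in> space (edges G). \<beta> e = y}"
  unfolding incident_edges_iff using ends(1,2) parts(4) by auto

text \<open>The pairs that meet \<open>S\<close> correspond to a Borel subset of the square minus
  the diagonal. Applied to the parts of a set in \<open>A\<close> and in \<open>B\<close>, this
  makes the two endpoint maps Borel.\<close>

lemma meets_measurable:
  assumes "S \<in> sets (verts G)"
  shows "{e \<in> space (edges G). ends G e \<inter> S \<noteq> {}} \<in> sets (edges G)"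
proof -
  let ?V = "verts G"
  define P where "P = {p \<in> unordered_pairs (space ?V). p \<inter> S \<noteq> {}}"
  have SV: "S \<subseteq> space ?V" using assms sets.sets_into_space by blast
  have "{(x, y). {x, y} \<in> P} =
      (S \<times> space ?V \<union> space ?V \<times> S) - {(x, x) | x. x \<in> space ?V}"
    using SV by (auto simp: P_def unordered_pairs_def card_2_iff doubleton_eq_iff)
  moreover have "\<dots> \<in> sets (?V \<Otimes>\<^sub>M ?V)"
    using assms by (intro sets.Diff diagonal_measurable[OF standard(1)] sets.Un pair_measureI) auto
  ultimately have "P \<in> sets (pair_space ?V)"
    unfolding sets_pair_space[OF diagonal_measurable[OF standard(1)]] by (simp add: P_def)
  moreover have "ends G \<in> measurable (edges G) (pair_space ?V)"
    using borel by (simp add: borel_graph_def)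
  ultimately have "ends G -` P \<inter> space (edges G) \<in> sets (edges G)"
    by (rule_tac measurable_sets)
  moreover have "ends G -` P \<inter> space (edges G) = {e \<in> space (edges G). ends G e \<inter> S \<noteq> {}}"
    using ends(3,4) ends_space by (auto simp: P_def unordered_pairs_def)
  ultimately show ?thesis by simp
qed

sublocale borel_edges "edges G" "verts G" \<alpha> \<beta>
proof
  show "standard_borel_space (edges G)" "standard_borel_space (verts G)" by (rule standard)+
  have eqs: "\<alpha> -` S \<inter> space (edges G) = {e \<in> space (edges G). ends G e \<inter> (S \<inter> A) \<noteq> {}}"
      "\<beta> -` S \<inter> space (edges G) = {e \<in> space (edges G). ends G e \<inter> (S \<inter> B) \<noteq> {}}" for S
    using ends parts(4) by fastforce+
  show "\<alpha> \<in> measurable (edges G) (verts G)"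
  proof (rule measurableI)
    show "\<alpha> -` S \<inter> space (edges G) \<in> sets (edges G)" if "S \<in> sets (verts G)" for S
      unfolding eqs(1) using that parts(1) by (intro meets_measurable sets.Int)
  qed (use ends_space in blast)
  show "\<beta> \<in> measurable (edges G) (verts G)"
  proof (rule measurableI)
    show "\<beta> -` S \<inter> space (edges G) \<in> sets (edges G)" if "S \<in> sets (verts G)" for S
      unfolding eqs(2) using that parts(2) by (intro meets_measurable sets.Int)
  qed (use ends_space in blast)
  have fin: "finite (incident_edges G x)" for x
  proof (cases "x \<in> space (verts G)")
    case True
    then show ?thesis using locally_finite by (simp add: locally_finite_def)
  next
    case False
    then have "incident_edges G x = {}" using ends_space by (auto simp: incident_edges_iff)
    then show ?thesis by simp
  qed
  show "finite {e \<in> space (edges G). \<alpha> e = x}" "finite {e \<in> space (edges G). \<beta> e = x}" for x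
    using fin[of x] unfolding incident_edges_iff by simp_all
qed

lemma adjacency_iff: "(x, y) \<in> adjacency G \<longleftrightarrow>
    (\<exists>e\<in>space (edges G). x = \<alpha> e \<and> y = \<beta> e \<or> x = \<beta> e \<and> y = \<alpha> e)"
proof -
  have "(x, y) \<in> adjacency G \<longleftrightarrow> (\<exists>e\<in>space (edges G). {x, y} = ends G e)"
    by (auto simp: adjacency_def)
  also have "\<dots> \<longleftrightarrow> (\<exists>e\<in>space (edges G). {x, y} = {\<alpha> e, \<beta> e})"
    using ends(3) by (intro bex_cong) simp_all
  finally show ?thesis by (simp add: doubleton_eq_iff)
qed

lemma neighbors_eq: "neighbors G S = \<beta> ` {e \<in> space (edges G). \<alpha> e \<in> S} \<union> \<alpha> ` {e \<in> space (edges G). \<beta> e \<in> S}"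
  by (auto simp: neighbors_def adjacency_iff)

lemma neighbors_A: "S \<subseteq> A \<Longrightarrow> neighbors G S = \<beta> ` {e \<in> space (edges G). \<alpha> e \<in> S}"
proof -
  assume "S \<subseteq> A"
  then have none: "{e \<in> space (edges G). \<beta> e \<in> S} = {}" using ends(2) parts(4) by auto
  show ?thesis unfolding neighbors_eq none by simp
qed

lemma preimage_measurable:
  assumes "S \<in> sets (verts G)"
  shows "{e \<in> space (edges G). \<alpha> e \<in> S} \<in> sets (edges G)" "{e \<in> space (edges G). \<beta> e \<in> S} \<in> sets (edges G)"
  using measurable_sets[OF \<alpha> assms] measurable_sets[OF \<beta> assms]
  by (simp_all add: vimage_def Int_def conj_commute)

lemma nbhd_measurable: "X \<in> sets (verts G) \<Longrightarrow> nbhd G t X \<in> sets (verts G)"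
proof (induction t)
  case (Suc t)
  then have "nbhd G t X \<in> sets (verts G)" by simp
  note pre = preimage_measurable[OF this]
  show ?case
    unfolding nbhd_Suc neighbors_eq
    using Suc image_measurable[of \<beta>, OF _ pre(1)] image_measurable[of \<alpha>, OF _ pre(2)] by simp
qed simp

lemma nbhd_finite: "finite X \<Longrightarrow> finite (nbhd G t X)"
proof (induction t)
  case (Suc t)
  then have f: "finite (nbhd G t X)" by simp
  have "{e \<in> space (edges G). p e \<in> nbhd G t X} = (\<Union>x\<in>nbhd G t X. {e \<in> space (edges G). p e = x})"
    for p :: "'e \<Rightarrow> 'v" by auto
  then show ?case
    unfolding nbhd_Suc neighbors_eq using f finite_\<alpha> finite_\<beta> by simp
qed simp

text \<open>Edges over the \<open>R\<close>-neighbourhood of \<open>X\<close> that meet have witnesses in \<open>X\<close> at distance at most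
  \<open>R + 2 + R\<close>, so their classes live over components of \<open>X\<close> in the corresponding power of the graph.\<close>

lemma finite_meet_class:
  assumes X: "graph_finite (graph_power (adjacency G) (2 * R + 2)) X"
    and E: "E = {e \<in> space (edges G). \<alpha> e \<in> nbhd G R X}" and e: "e \<in> E"
  shows "finite (meet_class E e)"
proof -
  have "\<forall>f. \<exists>x. f \<in> E \<longrightarrow> x \<in> X \<and> (\<exists>n\<le>R. (x, \<alpha> f) \<in> adjacency G ^^ n)"
    unfolding E nbhd_iff by blast
  then obtain z where z: "\<And>f. f \<in> E \<Longrightarrow> z f \<in> X" "\<And>f. f \<in> E \<Longrightarrow> \<exists>n\<le>R. (z f, \<alpha> f) \<in> adjacency G ^^ n"
    by metis
  define GP where "GP = graph_power (adjacency G) (2 * R + 2)"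
  define C where "C = component GP X (z e)"
  have C: "finite C" using X z(1)[OF e] by (simp add: C_def GP_def graph_finite_def)
  \<comment> \<open>Powers of a graph are irreflexive, so equal witnesses are covered by the
    reflexive closure.\<close>
  have step: "(z f, z f') \<in> (GP \<inter> X \<times> X)\<^sup>*" if ff: "(f, f') \<in> meet E" for f f'
  proof (cases "z f = z f'")
    case False
    have fE: "f \<in> E" "f' \<in> E" and m: "\<alpha> f = \<alpha> f' \<or> \<beta> f = \<beta> f'" using ff by (auto simp: meet_def)
    \<comment> \<open>Edges that meet in \<open>A\<close> have the same end there; edges that meet
      in \<open>B\<close> have ends in \<open>A\<close> joined by a walk of length 2.\<close>
    have "\<exists>n\<le>2. (\<alpha> f, \<alpha> f') \<in> adjacency G ^^ n"
    proof (cases "\<alpha> f = \<alpha> f'")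
      case True
      then show ?thesis by (intro exI[of _ 0]) simp
    next
      case False
      then have "\<beta> f = \<beta> f'" using m by simp
      then have "(\<alpha> f, \<beta> f) \<in> adjacency G" "(\<beta> f, \<alpha> f') \<in> adjacency G"
        using fE E unfolding adjacency_iff by auto
      then have "(\<alpha> f, \<alpha> f') \<in> adjacency G ^^ 2" by (auto simp: numeral_2_eq_2)
      then show ?thesis by blast
    qed
    then obtain n where n: "n \<le> 2" "(\<alpha> f, \<alpha> f') \<in> adjacency G ^^ n" by blast
    obtain k where k: "k \<le> R" "(z f, \<alpha> f) \<in> adjacency G ^^ k" using z(2) fE by blast
    obtain l where l: "l \<le> R" "(z f', \<alpha> f') \<in> adjacency G ^^ l" using z(2) fE by blast
    have "(z f, z f') \<in> adjacency G ^^ (k + n + l)"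
      unfolding relpow_add using k n adjacency_pow_sym[OF l(2)] by blast
    moreover have "k + n + l \<le> 2 * R + 2" using k n l by simp
    ultimately have "(z f, z f') \<in> GP" unfolding GP_def graph_power_iff using False by blast
    then show ?thesis using z(1) fE by auto
  qed simp
  have "meet_class E e \<subseteq> {f \<in> space (edges G). \<alpha> f \<in> nbhd G R C}"
  proof
    fix f assume f: "f \<in> meet_class E e"
    then have fE: "f \<in> E" using meet_class_subset[OF e] by blast
    have "(e, f) \<in> (meet E)\<^sup>*" using f by (simp add: meet_class_def)
    then have "(z e, z f) \<in> (GP \<inter> X \<times> X)\<^sup>*"
      by (induction rule: rtrancl_induct) (use step in \<open>auto intro: rtrancl_trans\<close>)
    then have "z f \<in> C" using z(1)[OF fE] by (simp add: C_def component_def)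
    then have "\<alpha> f \<in> nbhd G R C" using z(2)[OF fE] unfolding nbhd_iff by blast
    then show "f \<in> {f \<in> space (edges G). \<alpha> f \<in> nbhd G R C}" using fE E by simp
  qed
  moreover have "{f \<in> space (edges G). \<alpha> f \<in> nbhd G R C} =
      (\<Union>x\<in>nbhd G R C. {f \<in> space (edges G). \<alpha> f = x})" by auto
  then have "finite {f \<in> space (edges G). \<alpha> f \<in> nbhd G R C}"
    using nbhd_finite[OF C] finite_\<alpha> by simp
  ultimately show ?thesis by (rule finite_subset)
qed

text \<open>A partition of unity with integer values: \<open>w i\<close> counts the radii \<open>t < R\<close> for which \<open>i\<close> is the
  least index with \<open>x\<close> in the \<open>t\<close>-neighbourhood of \<open>X i\<close>.\<close>

lemma integer_partition_of_unity:
  assumes X: "\<And>i. i \<le> s \<Longrightarrow> X i \<in> sets (verts G)" and cover: "(\<Union>i\<le>s. X i) = space (verts G)"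
  obtains w :: "nat \<Rightarrow> 'v \<Rightarrow> nat" where
    "\<And>i. i \<le> s \<Longrightarrow> w i \<in> measurable (verts G) (count_space UNIV)"
    "\<And>x. x \<in> space (verts G) \<Longrightarrow> (\<Sum>i\<le>s. w i x) = R"
    "\<And>i x. 0 < w i x \<Longrightarrow> x \<in> nbhd G R (X i)"
    "\<And>i x y. (x, y) \<in> adjacency G \<Longrightarrow> w i x \<le> w i y + 2"
proof -
  define near where "near i t = (\<Union>j<i. nbhd G t (X j))" for i t
  \<comment> \<open>\<open>cw i\<close> counts the radii whose least near index is below
    \<open>i\<close>. Its increments \<open>w i\<close> therefore telescope, and by the cover every
    radius below \<open>R\<close> is counted once.\<close>
  define cw where "cw i x = card {t. t < R \<and> x \<in> near i t}" for i x
  have cw_mono: "cw i x \<le> cw (Suc i) x" for i x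
    unfolding cw_def by (intro card_mono) (auto simp: near_def less_Suc_eq)
  define w where "w i x = cw (Suc i) x - cw i x" for i x
  have tele: "(\<Sum>i<n. w i x) = cw n x" for n x
    by (induction n) (use cw_mono in \<open>auto simp: w_def cw_def near_def\<close>)
  \<comment> \<open>Crossing an edge raises the radius by one. The shifted radii of \<open>x\<close>
    are radii of \<open>y\<close>, except possibly for the value \<open>R\<close>, which accounts
    for the summand 1.\<close>
  have cw_lip: "cw i x \<le> cw i y + 1" if xy: "(x, y) \<in> adjacency G" for i x y
  proof -
    have "Suc ` {t. t < R \<and> x \<in> near i t} \<subseteq> insert R {t. t < R \<and> y \<in> near i t}"
      using nbhd_adjacent[OF _ xy] by (auto simp: near_def)
    then have "card (Suc ` {t. t < R \<and> x \<in> near i t}) \<le> card (insert R {t. t < R \<and> y \<in> near i t})"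
      by (intro card_mono) auto
    also have "\<dots> \<le> cw i y + 1" unfolding cw_def by (simp add: card_insert_if)
    finally show ?thesis unfolding cw_def by (simp add: card_image)
  qed
  show ?thesis
  proof (rule that[of w])
    have near: "near i t \<in> sets (verts G)" if "i \<le> Suc s" for i t
      unfolding near_def using X that by (intro sets.finite_UN nbhd_measurable) auto
    have "cw i \<in> measurable (verts G) (count_space UNIV)" if "i \<le> Suc s" for i
    proof -
      have "cw i x = (\<Sum>t<R. if x \<in> near i t then 1 else 0)" for x
      proof -
        have "{t. t < R \<and> x \<in> near i t} = {..<R} \<inter> {t. x \<in> near i t}" by auto
        then show ?thesis by (simp add: cw_def sum.If_cases)
      qed
      moreover have "(\<lambda>x. \<Sum>t<R. if x \<in> near i t then 1 else 0 :: nat) \<in> measurable (verts G) (count_space UNIV)"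
        using near[OF that] by (intro measurable_count_space_sum measurable_If_set) auto
      ultimately show ?thesis by (simp add: cong: measurable_cong)
    qed
    then show "w i \<in> measurable (verts G) (count_space UNIV)" if "i \<le> s" for i
      using that measurable_count_space_binary[of "cw (Suc i)" "verts G" "cw i" "(-)"]
      by (simp add: w_def[abs_def])
    show "(\<Sum>i\<le>s. w i x) = R" if x: "x \<in> space (verts G)" for x
    proof -
      obtain i where "i \<le> s" "x \<in> X i" using x cover by blast
      then have "x \<in> near (Suc s) t" for t
        using nbhd_mono[of 0 t G "X i"] by (auto simp: near_def)
      then show ?thesis using tele[of x "Suc s"] by (simp add: cw_def lessThan_Suc_atMost)
    qed
    show "x \<in> nbhd G R (X i)" if "0 < w i x" for i x
    proof (rule ccontr)
      assume n: "x \<notin> nbhd G R (X i)"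
      have "x \<notin> nbhd G t (X i)" if "t < R" for t
        using n nbhd_mono[of t R G "X i"] that by auto
      then have "cw (Suc i) x = cw i x"
        unfolding cw_def near_def by (intro arg_cong[where f = card]) (auto simp: less_Suc_eq)
      then show False using that by (simp add: w_def)
    qed
    \<comment> \<open>Each of the two counts in the difference changes by at most 1.\<close>
    show "w i x \<le> w i y + 2" if xy: "(x, y) \<in> adjacency G" for i x y
    proof -
      have "(y, x) \<in> adjacency G" using adjacency_pow_sym[of x y 1 G] xy by simp
      then have "cw i y \<le> cw i x + 1" by (rule cw_lip)
      then show ?thesis
        using cw_lip[OF xy, of "Suc i"] cw_mono[of i y] by (simp add: w_def)
    qed
  qed
qed

end

section \<open>Gluing local weights to a multiplicity function\<close>

context bipartite_borel_graph
begin

text \<open>Edges are selected by their end in \<open>A\<close>, so a vertex of \<open>A\<close>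
  keeps either all its edges or none. Hence sets of ends of selected edges keep all their neighbors,
  and the expansion inequality survives the restriction.\<close>

lemma local_weighted_matching:
  assumes X: "X \<in> sets (verts G)" "graph_finite (graph_power (adjacency G) (2 * R + 2)) X"
    and H: "\<And>S. finite S \<Longrightarrow> S \<subseteq> A \<Longrightarrow> a * card S \<le> b * card (neighbors G S)" and a: "0 < a"
  obtains \<phi> :: "'e \<Rightarrow> nat" where "\<phi> \<in> measurable (edges G) (count_space UNIV)"
    "\<And>x. x \<in> A \<Longrightarrow> x \<in> nbhd G R X \<Longrightarrow> a \<le> (\<Sum>e\<in>{e \<in> space (edges G). \<alpha> e = x}. \<phi> e)"
    "\<And>y. (\<Sum>e\<in>{e \<in> space (edges G). \<beta> e = y}. \<phi> e) \<le> b"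
proof -
  define E where "E = {e \<in> space (edges G). \<alpha> e \<in> nbhd G R X}"
  have E: "E \<in> sets (edges G)"
    unfolding E_def by (intro preimage_measurable nbhd_measurable X)
  have fin: "finite (meet_class E e)" if "e \<in> E" for e
    by (rule finite_meet_class[OF X(2) E_def that])
  have hall: "a * card S \<le> b * card (\<beta> ` {e \<in> E. \<alpha> e \<in> S})" if S: "finite S" "S \<subseteq> \<alpha> ` E" for S
  proof -
    have SA: "S \<subseteq> A" "S \<subseteq> nbhd G R X"
      using S(2) ends(1) by (auto simp: E_def)
    then have "{e \<in> E. \<alpha> e \<in> S} = {e \<in> space (edges G). \<alpha> e \<in> S}"
      by (auto simp: E_def)
    then show ?thesis using H[OF S(1) SA(1)] neighbors_A[OF SA(1)] by simp
  qed
  show ?thesis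
  proof (rule borel_weighted_matching[OF E fin hall])
    fix \<phi> :: "'e \<Rightarrow> nat"
    assume \<phi>: "\<phi> \<in> measurable (edges G) (count_space UNIV)"
      "\<And>x. x \<in> \<alpha> ` E \<Longrightarrow> a \<le> (\<Sum>e\<in>{e \<in> E. \<alpha> e = x}. \<phi> e)"
      "\<And>y. (\<Sum>e\<in>{e \<in> E. \<beta> e = y}. \<phi> e) \<le> b"
    define \<phi>' where "\<phi>' e = (if e \<in> E then \<phi> e else 0)" for e
    have sum_eq: "(\<Sum>e\<in>{e \<in> space (edges G). p e = x}. \<phi>' e) = (\<Sum>e\<in>{e \<in> E. p e = x}. \<phi> e)"
      if "p = \<alpha> \<or> p = \<beta>" for p x
    proof -
      have "finite {e \<in> space (edges G). p e = x}" by (rule finite_fiber[OF that sets.top])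
      then show ?thesis
        by (intro sum.mono_neutral_cong_right) (auto simp: \<phi>'_def E_def)
    qed
    show ?thesis
    proof (rule that[of \<phi>'])
      show "\<phi>' \<in> measurable (edges G) (count_space UNIV)"
        unfolding \<phi>'_def[abs_def] using \<phi>(1) E by (intro measurable_If_set) auto
      show "a \<le> (\<Sum>e\<in>{e \<in> space (edges G). \<alpha> e = x}. \<phi>' e)" if x: "x \<in> A" "x \<in> nbhd G R X" for x
      proof -
        \<comment> \<open>Since \<open>a\<close> is positive, the inequality for a singleton rules
          out isolated vertices in \<open>A\<close>; so \<open>x\<close> really is an end of a
          selected edge.\<close>
        have "neighbors G {x} \<noteq> {}" using H[of "{x}"] x(1) a by auto
        then have "{e \<in> space (edges G). \<alpha> e \<in> {x}} \<noteq> {}"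
          using neighbors_A[of "{x}"] x(1) by auto
        then have "x \<in> \<alpha> ` E" using x(2) by (auto simp: E_def)
        then show ?thesis using \<phi>(2) sum_eq by simp
      qed
      show "(\<Sum>e\<in>{e \<in> space (edges G). \<beta> e = y}. \<phi>' e) \<le> b" for y
        using \<phi>(3) sum_eq by simp
    qed
  qed
qed

lemma expansion_multiplicity:
  assumes exp: "combinatorial_expansion G A" and asi: "asi G < \<infinity>"
  obtains m :: "'e \<Rightarrow> nat" and a b where "m \<in> measurable (edges G) (count_space UNIV)" "b < a"
    "\<And>x. x \<in> A \<Longrightarrow> a \<le> (\<Sum>e\<in>incident_edges G x. m e)"
    "\<And>y. y \<in> B \<Longrightarrow> (\<Sum>e\<in>incident_edges G y. m e) \<le> b"
proof -
  obtain c :: real where c: "1 < c"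
    "\<And>S. finite S \<Longrightarrow> S \<subseteq> A \<Longrightarrow> c * real (card S) \<le> real (card (neighbors G S))"
    using exp by (auto simp: combinatorial_expansion_def)
  \<comment> \<open>The real factor \<open>c\<close> is replaced by the smaller ratio of
    \<open>d + 1\<close> to \<open>d\<close>, so that integer weights can be used.\<close>
  obtain d :: nat where d: "1 < real d * (c - 1)"
    using c(1) reals_Archimedean3[of "c - 1"] by auto
  have H: "(d + 1) * card S \<le> d * card (neighbors G S)" if S: "finite S" "S \<subseteq> A" for S
  proof -
    have "real d + 1 \<le> real d * c"
      using d by (simp add: right_diff_distrib)
    then have "(real d + 1) * real (card S) \<le> real d * c * real (card S)"
      by (rule mult_right_mono) simp
    also have "\<dots> = real d * (c * real (card S))" by simp
    also have "\<dots> \<le> real d * real (card (neighbors G S))"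
      by (rule mult_left_mono[OF c(2)[OF S]]) simp
    finally have "real ((d + 1) * card S) \<le> real (d * card (neighbors G S))"
      by (simp only: of_nat_mult of_nat_add of_nat_1)
    then show ?thesis by (simp only: of_nat_le_iff)
  qed
  have "\<exists>s. \<forall>k. \<exists>X :: nat \<Rightarrow> 'v set.
     (\<forall>i\<le>s. X i \<in> sets (verts G) \<and> graph_finite (graph_power (adjacency G) k) (X i)) \<and>
     (\<Union>i\<le>s. X i) = space (verts G)"
  proof (rule ccontr)
    assume "\<not> ?thesis"
    then have "asi G = \<infinity>" unfolding asi_def by (simp add: Inf_enat_def)
    then show False using asi by simp
  qed
  then obtain s where s: "\<And>k. \<exists>X :: nat \<Rightarrow> 'v set.
     (\<forall>i\<le>s. X i \<in> sets (verts G) \<and> graph_finite (graph_power (adjacency G) k) (X i)) \<and>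
     (\<Union>i\<le>s. X i) = space (verts G)"
    by blast
  \<comment> \<open>The least \<open>R\<close> whose surplus exceeds the total loss
    \<open>2 * (s + 1) * d\<close> at vertices of \<open>B\<close>. The cover for the power
    \<open>2 * R + 2\<close> is chosen only afterwards.\<close>
  define R where "R = 2 * (s + 1) * d + 1"
  obtain X :: "nat \<Rightarrow> 'v set" where X: "\<And>i. i \<le> s \<Longrightarrow> X i \<in> sets (verts G)"
      "\<And>i. i \<le> s \<Longrightarrow> graph_finite (graph_power (adjacency G) (2 * R + 2)) (X i)"
      "(\<Union>i\<le>s. X i) = space (verts G)"
    using s[of "2 * R + 2"] by blast
  have "\<exists>w :: nat \<Rightarrow> 'v \<Rightarrow> nat.
    (\<forall>i\<le>s. w i \<in> measurable (verts G) (count_space UNIV)) \<and>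
    (\<forall>x\<in>space (verts G). (\<Sum>i\<le>s. w i x) = R) \<and>
    (\<forall>i x. 0 < w i x \<longrightarrow> x \<in> nbhd G R (X i)) \<and>
    (\<forall>i x y. (x, y) \<in> adjacency G \<longrightarrow> w i x \<le> w i y + 2)"
    by (rule integer_partition_of_unity[OF X(1,3), of R]) (assumption, metis)
  then obtain w :: "nat \<Rightarrow> 'v \<Rightarrow> nat" where
    w: "\<And>i. i \<le> s \<Longrightarrow> w i \<in> measurable (verts G) (count_space UNIV)"
    "\<And>x. x \<in> space (verts G) \<Longrightarrow> (\<Sum>i\<le>s. w i x) = R"
    "\<And>i x. 0 < w i x \<Longrightarrow> x \<in> nbhd G R (X i)"
    "\<And>i x y. (x, y) \<in> adjacency G \<Longrightarrow> w i x \<le> w i y + 2"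
    by metis
  have "\<forall>i. \<exists>\<phi> :: 'e \<Rightarrow> nat. i \<le> s \<longrightarrow> \<phi> \<in> measurable (edges G) (count_space UNIV) \<and>
    (\<forall>x\<in>A. x \<in> nbhd G R (X i) \<longrightarrow> d + 1 \<le> (\<Sum>e\<in>{e \<in> space (edges G). \<alpha> e = x}. \<phi> e)) \<and>
    (\<forall>y. (\<Sum>e\<in>{e \<in> space (edges G). \<beta> e = y}. \<phi> e) \<le> d)"
    (is "\<forall>i. \<exists>\<phi>. ?P i \<phi>")
  proof
    fix i
    show "\<exists>\<phi>. ?P i \<phi>"
    proof (cases "i \<le> s")
      case True
      show ?thesis
        by (rule local_weighted_matching[OF X(1,2)[OF True], of "d + 1" d]) (use H in auto)
    qed simp
  qed
  then obtain \<phi> :: "nat \<Rightarrow> 'e \<Rightarrow> nat" where "\<forall>i. ?P i (\<phi> i)" by (rule choice[THEN exE])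
  then have \<phi>: "i \<le> s \<Longrightarrow> \<phi> i \<in> measurable (edges G) (count_space UNIV)"
    "i \<le> s \<Longrightarrow> x \<in> A \<Longrightarrow> x \<in> nbhd G R (X i) \<Longrightarrow>
      d + 1 \<le> (\<Sum>e\<in>{e \<in> space (edges G). \<alpha> e = x}. \<phi> i e)"
    "i \<le> s \<Longrightarrow> (\<Sum>e\<in>{e \<in> space (edges G). \<beta> e = y}. \<phi> i e) \<le> d" for i x y
    by simp_all
  define m where "m e = (\<Sum>i\<le>s. w i (\<alpha> e) * \<phi> i e)" for e
  show ?thesis
  proof (rule that[of m "(R + 2 * (s + 1)) * d" "R * (d + 1)"])
    show "m \<in> measurable (edges G) (count_space UNIV)"
      unfolding m_def[abs_def]
    proof (rule measurable_count_space_sum)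
      fix i assume "i \<in> {..s}"
      then show "(\<lambda>e. w i (\<alpha> e) * \<phi> i e) \<in> measurable (edges G) (count_space UNIV)"
        using measurable_count_space_binary[OF measurable_compose[OF \<alpha> w(1)] \<phi>(1), of i i "(*)"] by simp
    qed
    show "(R + 2 * (s + 1)) * d < R * (d + 1)"
      by (simp add: R_def algebra_simps)
    show "R * (d + 1) \<le> (\<Sum>e\<in>incident_edges G x. m e)" if x: "x \<in> A" for x
    proof -
      let ?I = "{e \<in> space (edges G). \<alpha> e = x}"
      have "x \<in> space (verts G)" using x parts(3) by blast
      then have "R * (d + 1) = (\<Sum>i\<le>s. w i x * (d + 1))"
        by (simp only: w(2)[symmetric] sum_distrib_right)
      also have "\<dots> \<le> (\<Sum>i\<le>s. w i x * (\<Sum>e\<in>?I. \<phi> i e))"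
      proof (rule sum_mono)
        fix i assume i: "i \<in> {..s}"
        show "w i x * (d + 1) \<le> w i x * (\<Sum>e\<in>?I. \<phi> i e)"
        \<comment> \<open>The sums of \<open>\<phi> i\<close> are large only near
          \<open>X i\<close>, and \<open>w i\<close> vanishes elsewhere.\<close>
        proof (cases "w i x = 0")
          case False
          then have "d + 1 \<le> (\<Sum>e\<in>?I. \<phi> i e)"
            using \<phi>(2) w(3) x i by simp
          then show ?thesis by (rule mult_le_mono2)
        qed simp
      qed
      also have "\<dots> = (\<Sum>i\<le>s. \<Sum>e\<in>?I. w i (\<alpha> e) * \<phi> i e)"
      proof (rule sum.cong[OF refl])
        fix i
        have "w i x * (\<Sum>e\<in>?I. \<phi> i e) = (\<Sum>e\<in>?I. w i x * \<phi> i e)"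
          by (rule sum_distrib_left)
        also have "\<dots> = (\<Sum>e\<in>?I. w i (\<alpha> e) * \<phi> i e)"
          by (rule sum.cong[OF refl]) simp
        finally show "w i x * (\<Sum>e\<in>?I. \<phi> i e) = (\<Sum>e\<in>?I. w i (\<alpha> e) * \<phi> i e)" .
      qed
      also have "\<dots> = (\<Sum>e\<in>?I. m e)"
        unfolding m_def by (rule sum.swap)
      finally show ?thesis using incident_edges_A[OF x] by simp
    qed
    show "(\<Sum>e\<in>incident_edges G y. m e) \<le> (R + 2 * (s + 1)) * d" if y: "y \<in> B" for y
    proof -
      let ?I = "{e \<in> space (edges G). \<beta> e = y}"
      have "(\<Sum>e\<in>?I. m e) = (\<Sum>i\<le>s. \<Sum>e\<in>?I. w i (\<alpha> e) * \<phi> i e)"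
        unfolding m_def by (rule sum.swap)
      also have "\<dots> \<le> (\<Sum>i\<le>s. \<Sum>e\<in>?I. (w i y + 2) * \<phi> i e)"
      proof (intro sum_mono mult_right_mono)
        fix i e assume "e \<in> ?I"
        then have "(\<alpha> e, y) \<in> adjacency G" unfolding adjacency_iff by auto
        then show "w i (\<alpha> e) \<le> w i y + 2" by (rule w(4))
      qed simp
      also have "\<dots> = (\<Sum>i\<le>s. (w i y + 2) * (\<Sum>e\<in>?I. \<phi> i e))"
        by (simp only: sum_distrib_left)
      also have "\<dots> \<le> (\<Sum>i\<le>s. (w i y + 2) * d)"
        using \<phi>(3) by (intro sum_mono mult_left_mono) auto
      also have "\<dots> = (\<Sum>i\<le>s. w i y + 2) * d"
        by (rule sum_distrib_right[symmetric])
      also have "(\<Sum>i\<le>s. w i y + 2) = R + 2 * (s + 1)"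
      proof -
        have "y \<in> space (verts G)" using y parts(3) by blast
        then show ?thesis by (simp only: sum.distrib w(2)) simp
      qed
      finally show ?thesis using incident_edges_B[OF y] by simp
    qed
  qed
qed

end

section \<open>Passing to parallel copies\<close>

text \<open>Every edge of \<open>Q'\<close> comes from an edge of \<open>Q\<close>, so walks and
  components pull back along the injection \<open>h\<close>. Only this inclusion is available in the
  application, because edges of multiplicity 0 disappear.\<close>

lemma graph_finite_image:
  assumes h: "inj_on h V" and X: "X \<subseteq> V" "graph_finite (graph_power Q k) X"
    and Q': "\<And>x' y'. (x', y') \<in> Q' \<Longrightarrow> \<exists>x\<in>V. \<exists>y\<in>V. x' = h x \<and> y' = h y \<and> (x, y) \<in> Q"
  shows "graph_finite (graph_power Q' k) (h ` X)"
proof -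
  have pow: "(x, y) \<in> Q ^^ n" if "(h x, h y) \<in> Q' ^^ n" "x \<in> V" "y \<in> V" for x y n
    using that
  proof (induction n arbitrary: y)
    case 0
    then show ?case using inj_onD[OF h] by auto
  next
    case (Suc n)
    then obtain z' where z': "(h x, z') \<in> Q' ^^ n" "(z', h y) \<in> Q'" by auto
    then obtain z u where zu: "z \<in> V" "u \<in> V" "z' = h z" "h y = h u" "(z, u) \<in> Q"
      using Q'[OF z'(2)] by blast
    have "u = y" using inj_onD[OF h zu(4)] zu(2) Suc.prems(3) by simp
    moreover have "(x, z) \<in> Q ^^ n"
      using Suc.IH[of z] z'(1) zu(1,3) Suc.prems(2) by simp
    ultimately show ?case using zu(5) by auto
  qed
  have power_step: "(x, y) \<in> graph_power Q k \<inter> X \<times> X"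
    if "(h x, h y) \<in> graph_power Q' k" "x \<in> X" "y \<in> X" for x y
  proof -
    obtain n where n: "h x \<noteq> h y" "n \<le> k" "(h x, h y) \<in> Q' ^^ n"
      using \<open>(h x, h y) \<in> graph_power Q' k\<close> unfolding graph_power_iff by blast
    have "x \<in> V" "y \<in> V" using that(2,3) X(1) by auto
    then have "(x, y) \<in> Q ^^ n" by (rule pow[OF n(3)])
    moreover have "x \<noteq> y" using n(1) by auto
    ultimately have "(x, y) \<in> graph_power Q k" using n(2) unfolding graph_power_iff by blast
    then show ?thesis using that(2,3) by simp
  qed
  have reach: "\<exists>y\<in>X. y' = h y \<and> (x, y) \<in> (graph_power Q k \<inter> X \<times> X)\<^sup>*"
    if "(h x, y') \<in> (graph_power Q' k \<inter> h ` X \<times> h ` X)\<^sup>*" "x \<in> X" for x y'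
    using that
  proof (induction rule: rtrancl_induct)
    case base
    then show ?case by (intro bexI[of _ x]) simp_all
  next
    case (step y' z')
    then obtain y where y: "y \<in> X" "y' = h y" "(x, y) \<in> (graph_power Q k \<inter> X \<times> X)\<^sup>*"
      by blast
    obtain z where z: "z \<in> X" "z' = h z" using step.hyps(2) by blast
    have "(h y, h z) \<in> graph_power Q' k" using step.hyps(2) y(2) z(2) by simp
    then have "(y, z) \<in> graph_power Q k \<inter> X \<times> X" by (rule power_step[OF _ y(1) z(1)])
    with y(3) have "(x, z) \<in> (graph_power Q k \<inter> X \<times> X)\<^sup>*"
      by (rule rtrancl.rtrancl_into_rtrancl)
    then show ?case using z by (intro bexI[of _ z]) simp_all
  qed
  show ?thesis
    unfolding graph_finite_def
  proof
    fix x' assume "x' \<in> h ` X"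
    then obtain x where x: "x \<in> X" "x' = h x" by blast
    have "component (graph_power Q' k) (h ` X) x' \<subseteq> h ` component (graph_power Q k) X x"
    proof
      fix y' assume "y' \<in> component (graph_power Q' k) (h ` X) x'"
      then have "(h x, y') \<in> (graph_power Q' k \<inter> h ` X \<times> h ` X)\<^sup>*"
        by (simp add: component_def x(2))
      then obtain y where "y \<in> X" "y' = h y" "(x, y) \<in> (graph_power Q k \<inter> X \<times> X)\<^sup>*"
        using reach x(1) by blast
      then show "y' \<in> h ` component (graph_power Q k) X x" by (simp add: component_def)
    qed
    moreover have "finite (component (graph_power Q k) X x)"
      using X(2) x(1) by (simp add: graph_finite_def)
    ultimately show "finite (component (graph_power Q' k) (h ` X) x')"
      by (meson finite_imageI finite_subset)
  qed
qed

text \<open>The unbalanced matching property is assumed for graphs on the reals only, hence the codings \<open>h\<close>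
  and \<open>k\<close>.\<close>

locale multiplied_graph = bipartite_borel_graph G A B
  for G :: "('v, 'e) multigraph" and A B :: "'v set" +
  fixes m :: "'e \<Rightarrow> nat" and h :: "'v \<Rightarrow> real" and k :: "'e \<times> nat \<Rightarrow> real"
  assumes m: "m \<in> measurable (edges G) (count_space UNIV)"
    and h: "inj_on h (space (verts G))"
    and k: "inj_on k (space (edges G \<Otimes>\<^sub>M count_space UNIV))"
begin

definition copies :: "('e \<times> nat) set" where
  "copies = {(e, l). e \<in> space (edges G) \<and> l < m e}"

definition copy_space :: "('e \<times> nat) measure" where
  "copy_space = restrict_space (edges G \<Otimes>\<^sub>M count_space UNIV) copies"

definition multiplied :: "(real, real) multigraph" where
  "multiplied = \<lparr>verts = image_space h (verts G), edges = image_space k copy_space,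
     ends = \<lambda>r. h ` ends G (fst (inv_into copies k r))\<rparr>"

lemma copies_measurable: "copies \<in> sets (edges G \<Otimes>\<^sub>M count_space UNIV)"
proof -
  have "copies = (\<Union>l. {e \<in> space (edges G). l < m e} \<times> {l})"
    by (auto simp: copies_def)
  moreover have "{e \<in> space (edges G). l < m e} = m -` {l<..} \<inter> space (edges G)" for l
    by auto
  then have "{e \<in> space (edges G). l < m e} \<in> sets (edges G)" for l
    using measurable_sets[OF m, of "{l<..}"] by simp
  then have "{e \<in> space (edges G). l < m e} \<times> {l} \<in> sets (edges G \<Otimes>\<^sub>M count_space UNIV)" for l
    by (intro pair_measureI) auto
  ultimately show ?thesis by auto
qed

lemma space_copy_space: "space copy_space = copies"
  using sets.sets_into_space[OF copies_measurable]
  by (auto simp: copy_space_def space_restrict_space)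

lemma k_copies: "inj_on k copies"
  using sets.sets_into_space[OF copies_measurable] by (rule inj_on_subset[OF k])

lemma ends_copy: "c \<in> copies \<Longrightarrow> ends multiplied (k c) = h ` ends G (fst c)"
  using k_copies by (simp add: multiplied_def)

lemma ends_subset: "e \<in> space (edges G) \<Longrightarrow> ends G e \<subseteq> space (verts G)"
  using ends(3) ends_space by auto

lemma space_multiplied:
  "space (verts multiplied) = h ` space (verts G)" "space (edges multiplied) = k ` copies"
  by (simp_all add: multiplied_def space_copy_space)

text \<open>It suffices to test generators of the pair space on the reals. Such a set pulls back
  along \<open>h\<close> to a Borel set of pairs of original vertices, and from there to original
  edges and to their copies.\<close>

lemma multiplied_ends_measurable:
  "ends multiplied \<in> measurable (edges multiplied) (pair_space (verts multiplied))"
proof -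
  let ?V = "verts G" and ?V' = "verts multiplied"
  have hm: "h \<in> measurable ?V ?V'"
    unfolding multiplied_def using measurable_image_space[OF h] by simp
  show ?thesis
    unfolding pair_space_def
  proof (rule measurable_measure_of)
    show "ends multiplied \<in> space (edges multiplied) \<rightarrow> unordered_pairs (space ?V')"
    proof
      fix r assume "r \<in> space (edges multiplied)"
      then obtain c where c: "c \<in> copies" "r = k c" unfolding space_multiplied by blast
      then have e: "fst c \<in> space (edges G)" by (auto simp: copies_def)
      have "card (ends G (fst c)) = 2" using ends(3,4)[OF e] by simp
      then have "card (h ` ends G (fst c)) = 2"
        using card_image[OF inj_on_subset[OF h ends_subset[OF e]]] by simp
      then show "ends multiplied r \<in> unordered_pairs (space ?V')"
        unfolding c(2) ends_copy[OF c(1)] unordered_pairs_def space_multiplied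
        using ends_subset[OF e] by auto
    qed
    fix P' assume P': "P' \<in> {P. P \<subseteq> unordered_pairs (space ?V') \<and>
        {(x, y). {x, y} \<in> P} \<in> sets (?V' \<Otimes>\<^sub>M ?V')}"
    define P where "P = {p \<in> unordered_pairs (space ?V). h ` p \<in> P'}"
    have "(\<lambda>z. (h (fst z), h (snd z))) \<in> measurable (?V \<Otimes>\<^sub>M ?V) (?V' \<Otimes>\<^sub>M ?V')"
      by (intro measurable_Pair measurable_compose[OF measurable_fst hm] measurable_compose[OF measurable_snd hm])
    then have "(\<lambda>z. (h (fst z), h (snd z))) -` {(x, y). {x, y} \<in> P'} \<inter> space (?V \<Otimes>\<^sub>M ?V) \<in> sets (?V \<Otimes>\<^sub>M ?V)"
      using P' by (intro measurable_sets) auto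
    also have "(\<lambda>z. (h (fst z), h (snd z))) -` {(x, y). {x, y} \<in> P'} \<inter> space (?V \<Otimes>\<^sub>M ?V) =
        {(x, y). {x, y} \<in> P}"
    proof -
      have "x \<noteq> y" if "{h x, h y} \<in> P'" for x y
        using that P' by (auto simp: unordered_pairs_def)
      then show ?thesis
        by (auto simp: P_def space_pair_measure unordered_pairs_def)
    qed
    finally have "P \<in> sets (pair_space ?V)"
      unfolding sets_pair_space[OF diagonal_measurable[OF standard(1)]] by (simp add: P_def)
    then have Q: "ends G -` P \<inter> space (edges G) \<in> sets (edges G)"
      using borel unfolding borel_graph_def by (intro measurable_sets) auto
    have "{c \<in> copies. fst c \<in> ends G -` P \<inter> space (edges G)} =
        copies \<inter> (ends G -` P \<inter> space (edges G)) \<times> UNIV" by auto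
    also have "\<dots> \<in> sets copy_space"
      unfolding copy_space_def sets_restrict_space using Q by (intro imageI pair_measureI) auto
    finally have "k ` {c \<in> copies. fst c \<in> ends G -` P \<inter> space (edges G)} \<in> sets (edges multiplied)"
      unfolding multiplied_def by (simp add: image_space_generator)
    moreover have "k ` {c \<in> copies. fst c \<in> ends G -` P \<inter> space (edges G)} =
        ends multiplied -` P' \<inter> space (edges multiplied)"
    proof -
      have "fst c \<in> ends G -` P \<inter> space (edges G) \<longleftrightarrow> ends multiplied (k c) \<in> P'" if c: "c \<in> copies" for c
      proof -
        have e: "fst c \<in> space (edges G)" using c by (auto simp: copies_def)
        then have "ends G (fst c) \<in> unordered_pairs (space ?V)"
          using ends_subset[OF e] ends(3,4)[OF e] by (simp add: unordered_pairs_def)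
        then show ?thesis using e ends_copy[OF c] by (simp add: P_def)
      qed
      then show ?thesis unfolding space_multiplied by auto
    qed
    ultimately show "ends multiplied -` P' \<inter> space (edges multiplied) \<in> sets (edges multiplied)"
      by simp
  qed blast
qed

lemma multiplied_borel: "borel_graph multiplied"
  unfolding borel_graph_def
proof (intro conjI multiplied_ends_measurable)
  show "standard_borel_space (verts multiplied)"
    unfolding multiplied_def using standard_borel_image_space[OF standard(1) h] by simp
  have "standard_borel_space copy_space"
    unfolding copy_space_def
    by (intro standard_borel_restrict_space standard_borel_pair_count_space standard copies_measurable)
  then show "standard_borel_space (edges multiplied)"
    unfolding multiplied_def using standard_borel_image_space[of copy_space k] k_copies
    by (simp add: space_copy_space)
qed

lemma multiplied_incident_edges:
  assumes x: "x \<in> space (verts G)"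
  shows "incident_edges multiplied (h x) = k ` (SIGMA e:incident_edges G x. {..<m e})"
proof -
  have "h x \<in> ends multiplied (k c) \<longleftrightarrow> x \<in> ends G (fst c)" if c: "c \<in> copies" for c
  proof -
    have "ends G (fst c) \<subseteq> space (verts G)"
      by (rule ends_subset) (use c in \<open>auto simp: copies_def\<close>)
    then show ?thesis
      unfolding ends_copy[OF c] using inj_on_image_mem_iff[OF h x] by simp
  qed
  then have "incident_edges multiplied (h x) = k ` {c \<in> copies. x \<in> ends G (fst c)}"
    unfolding incident_edges_def space_multiplied by auto
  also have "{c \<in> copies. x \<in> ends G (fst c)} = (SIGMA e:incident_edges G x. {..<m e})"
    by (auto simp: copies_def incident_edges_def)
  finally show ?thesis .
qed

lemma finite_incident_edges: "x \<in> space (verts G) \<Longrightarrow> finite (incident_edges G x)"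
  using locally_finite by (simp add: locally_finite_def)

lemma multiplied_locally_finite: "locally_finite multiplied"
  unfolding locally_finite_def space_multiplied
proof
  fix x' assume "x' \<in> h ` space (verts G)"
  then obtain x where x: "x \<in> space (verts G)" "x' = h x" by blast
  show "finite (incident_edges multiplied x')"
    unfolding x(2) multiplied_incident_edges[OF x(1)] using finite_incident_edges[OF x(1)] by simp
qed

lemma multiplied_degree:
  assumes x: "x \<in> space (verts G)"
  shows "degree multiplied (h x) = (\<Sum>e\<in>incident_edges G x. m e)"
proof -
  have "(SIGMA e:incident_edges G x. {..<m e}) \<subseteq> copies"
    by (auto simp: copies_def incident_edges_def)
  then have "inj_on k (SIGMA e:incident_edges G x. {..<m e})"
    by (rule inj_on_subset[OF k_copies])
  then show ?thesis
    unfolding degree_def multiplied_incident_edges[OF x]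
    using finite_incident_edges[OF x] by (simp add: card_image)
qed

lemma multiplied_bipartition: "bipartition multiplied (h ` A) (h ` B)"
  unfolding bipartition_def
proof (intro conjI ballI)
  show "h ` A \<union> h ` B = space (verts multiplied)"
    unfolding space_multiplied parts(3)[symmetric] by auto
  show "h ` A \<inter> h ` B = {}"
    using inj_on_image_Int[OF h, of A B] parts(3,4) by auto
  fix r assume "r \<in> space (edges multiplied)"
  then obtain c where c: "c \<in> copies" "r = k c" unfolding space_multiplied by blast
  then have e: "fst c \<in> space (edges G)" by (auto simp: copies_def)
  have "ends multiplied r = {h (\<alpha> (fst c)), h (\<beta> (fst c))}"
    unfolding c(2) ends_copy[OF c(1)] ends(3)[OF e] by simp
  then show "\<exists>x\<in>h ` A. \<exists>y\<in>h ` B. ends multiplied r = {x, y}"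
    using ends(1,2)[OF e] by blast
qed

lemma multiplied_adjacency:
  assumes "(x', y') \<in> adjacency multiplied"
  shows "\<exists>x\<in>space (verts G). \<exists>y\<in>space (verts G). x' = h x \<and> y' = h y \<and> (x, y) \<in> adjacency G"
proof -
  obtain c where c: "c \<in> copies" "{x', y'} = h ` ends G (fst c)"
    using assms unfolding adjacency_def space_multiplied by (auto simp: ends_copy)
  then have e: "fst c \<in> space (edges G)" by (auto simp: copies_def)
  have "{x', y'} = {h (\<alpha> (fst c)), h (\<beta> (fst c))}" using c(2) ends(3)[OF e] by simp
  then consider "x' = h (\<alpha> (fst c))" "y' = h (\<beta> (fst c))" | "x' = h (\<beta> (fst c))" "y' = h (\<alpha> (fst c))"
    by (auto simp: doubleton_eq_iff)
  then show ?thesis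
    using ends_space[OF e] e unfolding adjacency_iff by cases blast+
qed

text \<open>The images of a cover of the original graph serve for the copies: parallel edges do not
  affect distances, and losing edges can only increase them.\<close>

lemma multiplied_asi: "asi multiplied \<le> asi G"
  unfolding asi_def
proof (rule Inf_superset_mono, clarify)
  fix s
  assume s: "\<forall>k. \<exists>X :: nat \<Rightarrow> 'v set.
     (\<forall>i\<le>s. X i \<in> sets (verts G) \<and> graph_finite (graph_power (adjacency G) k) (X i)) \<and>
     (\<Union>i\<le>s. X i) = space (verts G)"
  have "\<exists>X :: nat \<Rightarrow> real set.
     (\<forall>i\<le>s. X i \<in> sets (verts multiplied) \<and> graph_finite (graph_power (adjacency multiplied) k) (X i)) \<and>
     (\<Union>i\<le>s. X i) = space (verts multiplied)" for k
  proof -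
    obtain X :: "nat \<Rightarrow> 'v set" where
      XX: "(\<forall>i\<le>s. X i \<in> sets (verts G) \<and> graph_finite (graph_power (adjacency G) k) (X i)) \<and>
        (\<Union>i\<le>s. X i) = space (verts G)"
      using spec[OF s, of k] ..
    then have X: "i \<le> s \<Longrightarrow> X i \<in> sets (verts G)"
        "i \<le> s \<Longrightarrow> graph_finite (graph_power (adjacency G) k) (X i)" for i
      by simp_all
    have XU: "(\<Union>i\<le>s. X i) = space (verts G)" using XX by (rule conjunct2)
    show ?thesis
    proof (intro exI[of _ "\<lambda>i. h ` X i"] conjI allI impI)
      fix i assume i: "i \<le> s"
      show "h ` X i \<in> sets (verts multiplied)"
        unfolding multiplied_def using image_space_generator[OF X(1)[OF i]] by simp
      show "graph_finite (graph_power (adjacency multiplied) k) (h ` X i)"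
        using sets.sets_into_space[OF X(1)[OF i]] X(2)[OF i] multiplied_adjacency
        by (rule graph_finite_image[OF h])
    next
      show "(\<Union>i\<le>s. h ` X i) = space (verts multiplied)"
        unfolding space_multiplied XU[symmetric] image_UN by (rule refl)
    qed
  qed
  then show "\<exists>s'. enat s = enat s' \<and> (\<forall>k. \<exists>X :: nat \<Rightarrow> real set.
     (\<forall>i\<le>s'. X i \<in> sets (verts multiplied) \<and> graph_finite (graph_power (adjacency multiplied) k) (X i)) \<and>
     (\<Union>i\<le>s'. X i) = space (verts multiplied))"
    by (intro exI[of _ s] conjI refl allI)
qed

text \<open>Different edges of the projection come from different copies, so their ends stay
  disjoint. The projection forgets a countable coordinate and is thus a countable union of Borel
  sections.\<close>

lemma matching_from_multiplied:
  assumes M': "borel_matching multiplied M'" "covers multiplied M' (h ` A)"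
  shows "\<exists>M. borel_matching G M \<and> covers G M A"
proof -
  define Q where "Q = k -` M' \<inter> copies"
  have M's: "M' \<subseteq> k ` copies"
    using M'(1) by (simp add: borel_matching_def matching_def space_multiplied)
  have "k \<in> measurable copy_space (edges multiplied)"
    unfolding multiplied_def using measurable_image_space[of k copy_space] k_copies space_copy_space by simp
  then have "k -` M' \<inter> space copy_space \<in> sets copy_space"
    by (rule measurable_sets) (use M'(1) in \<open>simp add: borel_matching_def\<close>)
  then have Q: "Q \<in> sets (edges G \<Otimes>\<^sub>M count_space UNIV)"
    unfolding Q_def space_copy_space unfolding copy_space_def
    using sets_restrict_space_iff[of copies "edges G \<Otimes>\<^sub>M count_space UNIV"] copies_measurable
      sets.sets_into_space[OF copies_measurable]
    by (simp add: Int_absorb2 Int_absorb1)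
  define M where "M = {e. \<exists>l. (e, l) \<in> Q}"
  have M_eq: "M = (\<Union>l. (\<lambda>e. (e, l)) -` Q \<inter> space (edges G))"
    by (auto simp: M_def Q_def copies_def)
  have "(\<lambda>e. (e, l)) -` Q \<inter> space (edges G) \<in> sets (edges G)" for l
    by (rule measurable_sets[OF _ Q]) simp
  then have Mm: "M \<in> sets (edges G)"
    unfolding M_eq by (rule sets.countable_UN''[OF countableI_type])
  have "ends G e \<inter> ends G f = {}" if ef: "e \<in> M" "f \<in> M" "e \<noteq> f" for e f
  proof -
    obtain l l' where ll: "(e, l) \<in> Q" "(f, l') \<in> Q" using ef(1,2) unfolding M_def by blast
    then have c: "(e, l) \<in> copies" "(f, l') \<in> copies" "k (e, l) \<in> M'" "k (f, l') \<in> M'"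
      by (auto simp: Q_def)
    have "k (e, l) \<noteq> k (f, l')"
      using c(1,2) ef(3) inj_onD[OF k_copies] by blast
    then have "ends multiplied (k (e, l)) \<inter> ends multiplied (k (f, l')) = {}"
      using M'(1) c(3,4) by (simp add: borel_matching_def matching_def)
    then show ?thesis using ends_copy c(1,2) by auto
  qed
  then have "borel_matching G M"
    using Mm sets.sets_into_space[OF Mm] by (simp add: borel_matching_def matching_def)
  moreover have "covers G M A"
    unfolding covers_def
  proof
    fix x assume x: "x \<in> A"
    then obtain r where r: "r \<in> M'" "h x \<in> ends multiplied r"
      using M'(2) by (auto simp: covers_def)
    then obtain c where c: "c \<in> copies" "r = k c" using M's by blast
    have xV: "x \<in> space (verts G)" using x parts(3) by blast
    have e: "fst c \<in> space (edges G)" using c(1) by (auto simp: copies_def)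
    have "x \<in> ends G (fst c)"
      using r(2) inj_on_image_mem_iff[OF h xV ends_subset[OF e]] by (simp add: c(2) ends_copy[OF c(1)])
    moreover have "fst c \<in> M"
      using c r(1) by (cases c) (auto simp: M_def Q_def)
    ultimately show "\<exists>e\<in>M. x \<in> ends G e" by blast
  qed
  ultimately show ?thesis by blast
qed

end

theorem theorem1p13:
  assumes "unbalanced_matching_property TYPE(real) TYPE(real)"
  shows "expansion_matching_property TYPE('v) TYPE('e)"
  unfolding expansion_matching_property_def
proof (intro allI impI, elim conjE)
  fix G :: "('v, 'e) multigraph" and A B
  assume G: "borel_graph G" "locally_finite G" "asi G < \<infinity>" "borel_bipartition G A B"
    "combinatorial_expansion G A"
  interpret bipartite_borel_graph G A B
    by unfold_locales (rule G)+
  obtain m :: "'e \<Rightarrow> nat" and a b where mult: "m \<in> measurable (edges G) (count_space UNIV)" "b < a"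
    "\<And>x. x \<in> A \<Longrightarrow> a \<le> (\<Sum>e\<in>incident_edges G x. m e)"
    "\<And>y. y \<in> B \<Longrightarrow> (\<Sum>e\<in>incident_edges G y. m e) \<le> b"
    by (rule expansion_multiplicity[OF G(5,3)]) blast
  obtain h :: "'v \<Rightarrow> real" where h: "inj_on h (space (verts G))"
    using standard_borel_inj_real[OF standard(1)] .
  obtain k :: "'e \<times> nat \<Rightarrow> real" where k: "inj_on k (space (edges G \<Otimes>\<^sub>M count_space UNIV))"
    using standard_borel_inj_real[OF standard_borel_pair_count_space[OF standard(2)]] .
  interpret multiplied_graph G A B m h k
    by unfold_locales (rule mult(1) h k)+
  have AV: "x \<in> space (verts G)" if "x \<in> A \<or> x \<in> B" for x
    using that parts(3) by blast
  have "of_type multiplied (h ` A) (h ` B) a b"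
    unfolding of_type_def using mult(3,4) AV by (auto simp: multiplied_degree)
  then have "unbalanced multiplied (h ` A) (h ` B)"
    using mult(2) unfolding unbalanced_def by blast
  moreover have "asi multiplied < \<infinity>"
    using multiplied_asi G(3) by (rule le_less_trans)
  ultimately obtain M' where "borel_matching multiplied M'" "covers multiplied M' (h ` A)"
    using assms multiplied_borel multiplied_locally_finite multiplied_bipartition
    unfolding unbalanced_matching_property_def by blast
  then show "\<exists>M. borel_matching G M \<and> covers G M A"
    by (rule matching_from_multiplied)
qed

end
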